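(* Let $n=7$ or $n=8$ and let $M^n$ be a smooth manifold admitting a smooth stable $3$-form $\phi$. Then the tangent bundle $TM^n$ has a canonical structure of a real simple Malcev algebra bundle, whose fibrewise multiplication $\circ_\phi$ is determined by $$\langle x\circ_\phi y,z\rangle_\phi=\phi(x,y,z)\qquad (x,y,z\in T_pM,\ p\in M),$$ where $\langle\cdot,\cdot\rangle_\phi$ is the reduced symmetric bilinear form of $\phi$.
   Context: A $3$-form on an $n$-dimensional real vector space $V$ is stable if its $GL(V)$-orbit is open in $\Lambda^3V^*$; a differential $3$-form on $M$ is stable if it is stable at each point. A real Malcev algebra is a real vector space with an anticommutative bilinear product satisfying $(xy)(xz)=((xy)z)x+((yz)x)x+((zx)x)y$ (every Lie algebra is a Malcev algebra); it is simple if its product is not identically zero and it has no proper nonzero ideals. The reduced symmetric bilinear form, on $V=T_pM$, is defined as follows. For $n=7$: $\langle v,w\rangle_\phi=\langle (v\rfloor\phi)\wedge(w\rfloor\phi)\wedge\phi,\rho\rangle$, where $\rho\in\Lambda^7V$ is nonzero. For $n=8$: let $S^\phi(v,w)\in V\otimes\Lambda^8V^*$ be the element corresponding to the $7$-form $(v\rfloor\phi)\wedge(w\rfloor\phi)\wedge\phi$ under the isomorphism $V\otimes\Lambda^8V^*\to\Lambda^7V^*$, $v\otimes\theta\mapsto v\rfloor\theta$; let $L_v=S^\phi(v,\cdot)$; let $B^\phi(v,w)=\mathrm{Tr}(L_v\circ L_w)\in(\Lambda^8V^* )^{\otimes2}$; then $\langle v,w\rangle_\phi=\langle B^\phi(v,w),\rho^2\rangle$,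 where $\rho\in\Lambda^8V$ is nonzero. On the manifold, $\rho$ is chosen smoothly and nowhere vanishing (for $n=8$ only $\rho^2$ enters, so $\rho$ need only be chosen up to sign). *)

theory Defs
  imports
    "HOL-Analysis.Analysis"
    "HOL-Combinatorics.Permutations"
    "HOL-Library.Function_Algebras"
begin

section \<open>Pointwise real vector space structure on functions\<close>

instantiation "fun" :: (type, scaleR) scaleR
begin

definition scaleR_fun_def: "a *\<^sub>R f = (\<lambda>x. a *\<^sub>R f x)"

instance ..

end

instance "fun" :: (type, real_vector) real_vector
  by standard (simp_all add: fun_eq_iff scaleR_fun_def algebra_simps)


section \<open>Multilinear algebra on a linear subspace\<close>

text \<open>
  Throughout, \<open>V\<close> is a (finite-dimensional) linear subspace of an ambient real vector
  space, and a form on \<open>V\<close> is a function on lists of vectors.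
\<close>

definition linear_map_on ::
  "'v::real_vector set \<Rightarrow> ('v \<Rightarrow> 'w::real_vector) \<Rightarrow> bool" where
  "linear_map_on V f \<longleftrightarrow>
     (\<forall>x\<in>V. \<forall>y\<in>V. f (x + y) = f x + f y) \<and> (\<forall>a. \<forall>x\<in>V. f (a *\<^sub>R x) = a *\<^sub>R f x)"

text \<open>The space \<open>\<Lambda>\<^sup>kV\<^sup>*\<close>; forms are extended by \<open>0\<close> so that equality of forms is equality
  of functions.\<close>

definition alt_forms :: "nat \<Rightarrow> 'v::real_vector set \<Rightarrow> ('v list \<Rightarrow> real) set" where
  "alt_forms k V = {\<omega>.
     (\<forall>xs. length xs \<noteq> k \<or> \<not> set xs \<subseteq> V \<longrightarrow> \<omega> xs = 0) \<and>
     (\<forall>xs i x y a. length xs = k \<and> set xs \<subseteq> V \<and> i < k \<and> x \<in> V \<and> y \<in> V \<longrightarrow>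
        \<omega> (xs[i := a *\<^sub>R x + y]) = a * \<omega> (xs[i := x]) + \<omega> (xs[i := y])) \<and>
     (\<forall>xs i j. length xs = k \<and> i < j \<and> j < k \<and> xs ! i = xs ! j \<longrightarrow> \<omega> xs = 0)}"

definition interior_product :: "'v \<Rightarrow> ('v list \<Rightarrow> real) \<Rightarrow> 'v list \<Rightarrow> real"  (infixr "\<rfloor>" 75) where
  "v \<rfloor> \<omega> = (\<lambda>xs. \<omega> (v # xs))"

definition wedge ::
  "nat \<Rightarrow> nat \<Rightarrow> ('v list \<Rightarrow> real) \<Rightarrow> ('v list \<Rightarrow> real) \<Rightarrow> 'v list \<Rightarrow> real" where
  "wedge p q \<alpha> \<beta> = (\<lambda>xs. if length xs = p + q then
     (\<Sum>\<pi> | \<pi> permutes {..<p+q}. of_int (sign \<pi>) *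
        \<alpha> (map (\<lambda>i. xs ! \<pi> i) [0..<p]) * \<beta> (map (\<lambda>i. xs ! \<pi> i) [p..<p+q]))
     / (fact p * fact q) else 0)"

definition pullback_form ::
  "'v::real_vector set \<Rightarrow> ('v \<Rightarrow> 'v) \<Rightarrow> ('v list \<Rightarrow> real) \<Rightarrow> 'v list \<Rightarrow> real" where
  "pullback_form V g \<omega> = (\<lambda>xs. if set xs \<subseteq> V then \<omega> (map g xs) else 0)"

definition general_linear :: "'v::real_vector set \<Rightarrow> ('v \<Rightarrow> 'v) set" where
  "general_linear V = {g. linear_map_on V g \<and> bij_betw g V V}"

text \<open>
  The topology on \<open>alt_forms 3 V\<close> is the subspace topology of the product topology
  (pointwise convergence); for finite-dimensional \<open>V\<close> it is the unique Hausdorff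
  vector space topology.
\<close>

definition stable_form :: "'v::real_vector set \<Rightarrow> ('v list \<Rightarrow> real) \<Rightarrow> bool" where
  "stable_form V \<phi> \<longleftrightarrow> \<phi> \<in> alt_forms 3 V \<and>
     openin (top_of_set (alt_forms 3 V)) ((\<lambda>g. pullback_form V g \<phi>) ` general_linear V)"

text \<open>\<open>\<Lambda>\<^sup>nV\<close> as the dual of \<open>\<Lambda>\<^sup>nV\<^sup>*\<close>: the pairing of \<open>\<omega>\<close> with \<open>\<rho>\<close> is \<open>\<rho> \<omega>\<close>.\<close>

definition multivectors :: "nat \<Rightarrow> 'v::real_vector set \<Rightarrow> (('v list \<Rightarrow> real) \<Rightarrow> real) set" where
  "multivectors n V = {\<rho>. linear_map_on (alt_forms n V) \<rho>}"

definition trace_on :: "'v::real_vector set \<Rightarrow> ('v \<Rightarrow> 'v) \<Rightarrow> real" where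
  "trace_on V f = (let B = (SOME B. B \<subseteq> V \<and> independent B \<and> V \<subseteq> span B)
                   in \<Sum>b\<in>B. representation B (f b) b)"


section \<open>The reduced symmetric bilinear form of a 3-form\<close>

definition reduced_7form ::
  "('v list \<Rightarrow> real) \<Rightarrow> 'v \<Rightarrow> 'v \<Rightarrow> 'v list \<Rightarrow> real" where
  "reduced_7form \<phi> v w = wedge 4 3 (wedge 2 2 (v \<rfloor> \<phi>) (w \<rfloor> \<phi>)) \<phi>"

text \<open>An element of \<open>V \<otimes> \<Lambda>\<^sup>8V\<^sup>*\<close> is represented by the linear map \<open>\<Lambda>\<^sup>8V \<rightarrow> V\<close> that
  contracts it with \<open>\<rho> \<in> \<Lambda>\<^sup>8V\<close>. Since \<open>dim \<Lambda>\<^sup>8V\<^sup>* = 1\<close>, every element is decomposable.\<close>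

definition tensor8 ::
  "'v::real_vector set \<Rightarrow> 'v \<Rightarrow> ('v list \<Rightarrow> real) \<Rightarrow> (('v list \<Rightarrow> real) \<Rightarrow> real) \<Rightarrow> 'v" where
  "tensor8 V u \<theta> = (\<lambda>\<rho>. if \<rho> \<in> multivectors 8 V then \<rho> \<theta> *\<^sub>R u else 0)"

definition S_tensor ::
  "'v::real_vector set \<Rightarrow> ('v list \<Rightarrow> real) \<Rightarrow> 'v \<Rightarrow> 'v \<Rightarrow> (('v list \<Rightarrow> real) \<Rightarrow> real) \<Rightarrow> 'v" where
  "S_tensor V \<phi> v w =
     (THE t. \<exists>u\<in>V. \<exists>\<theta>\<in>alt_forms 8 V. t = tensor8 V u \<theta> \<and> u \<rfloor> \<theta> = reduced_7form \<phi> v w)"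

text \<open>\<open>B\<^sup>\<phi>(v,w) = Tr(L\<^sub>v \<circ> L\<^sub>w) \<in> (\<Lambda>\<^sup>8V\<^sup>*)\<^sup>\<otimes>\<^sup>2\<close>, represented as a bilinear form on \<open>\<Lambda>\<^sup>8V\<close>: the two
  factors \<open>\<Lambda>\<^sup>8V\<^sup>*\<close> coming from \<open>L\<^sub>v\<close> and \<open>L\<^sub>w\<close> are paired with \<open>\<rho>\<close> and \<open>\<sigma>\<close>.\<close>

definition B_tensor ::
  "'v::real_vector set \<Rightarrow> ('v list \<Rightarrow> real) \<Rightarrow> 'v \<Rightarrow> 'v \<Rightarrow>
     (('v list \<Rightarrow> real) \<Rightarrow> real) \<Rightarrow> (('v list \<Rightarrow> real) \<Rightarrow> real) \<Rightarrow> real" where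
  "B_tensor V \<phi> v w \<rho> \<sigma> =
     trace_on V (\<lambda>x. S_tensor V \<phi> v (S_tensor V \<phi> w x \<sigma>) \<rho>)"

text \<open>Only meaningful for \<open>n = 7\<close> and \<open>n = 8\<close>, where \<open>n = dim V\<close>.\<close>

definition reduced_form ::
  "nat \<Rightarrow> 'v::real_vector set \<Rightarrow> ('v list \<Rightarrow> real) \<Rightarrow> (('v list \<Rightarrow> real) \<Rightarrow> real) \<Rightarrow>
     'v \<Rightarrow> 'v \<Rightarrow> real" where
  "reduced_form n V \<phi> \<rho> v w =
     (if n = 7 then \<rho> (reduced_7form \<phi> v w) else B_tensor V \<phi> v w \<rho> \<rho>)"


section \<open>Malcev algebras\<close>

definition malcev_algebra :: "'v::real_vector set \<Rightarrow> ('v \<Rightarrow> 'v \<Rightarrow> 'v) \<Rightarrow> bool" where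
  "malcev_algebra V m \<longleftrightarrow>
     subspace V \<and>
     (\<forall>x\<in>V. \<forall>y\<in>V. m x y \<in> V) \<and>
     (\<forall>x\<in>V. linear_map_on V (m x)) \<and>
     (\<forall>y\<in>V. linear_map_on V (\<lambda>x. m x y)) \<and>
     (\<forall>x\<in>V. \<forall>y\<in>V. m x y = - m y x) \<and>
     (\<forall>x\<in>V. \<forall>y\<in>V. \<forall>z\<in>V.
        m (m x y) (m x z) =
          m (m (m x y) z) x + m (m (m y z) x) x + m (m (m z x) x) y)"

definition algebra_ideal ::
  "'v::real_vector set \<Rightarrow> ('v \<Rightarrow> 'v \<Rightarrow> 'v) \<Rightarrow> 'v set \<Rightarrow> bool" where
  "algebra_ideal V m I \<longleftrightarrow> I \<subseteq> V \<and> subspace I \<and> (\<forall>x\<in>I. \<forall>y\<in>V. m x y \<in> I \<and> m y x \<in> I)"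

definition simple_malcev_algebra :: "'v::real_vector set \<Rightarrow> ('v \<Rightarrow> 'v \<Rightarrow> 'v) \<Rightarrow> bool" where
  "simple_malcev_algebra V m \<longleftrightarrow>
     malcev_algebra V m \<and>
     (\<exists>x\<in>V. \<exists>y\<in>V. m x y \<noteq> 0) \<and>
     (\<forall>I. algebra_ideal V m I \<longrightarrow> I = {0} \<or> I = V)"


section \<open>Smooth manifolds and their tangent bundles\<close>

text \<open>\<open>C\<^sup>k\<close> and \<open>C\<^sup>\<infinity>\<close> maps on an open set \<open>S\<close>, via iterated directional derivatives.\<close>

primrec Ck_on ::
  "nat \<Rightarrow> 'a::euclidean_space set \<Rightarrow> ('a \<Rightarrow> 'b::euclidean_space) \<Rightarrow> bool" where
  "Ck_on 0 S f \<longleftrightarrow> continuous_on S f"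
| "Ck_on (Suc k) S f \<longleftrightarrow>
     (\<forall>x\<in>S. f differentiable (at x)) \<and>
     (\<forall>v. Ck_on k S (\<lambda>x. frechet_derivative f (at x) v))"

definition smooth_on ::
  "'a::euclidean_space set \<Rightarrow> ('a \<Rightarrow> 'b::euclidean_space) \<Rightarrow> bool" where
  "smooth_on S f \<longleftrightarrow> (\<forall>k. Ck_on k S f)"

type_synonym ('m, 'n) chart = "'m set \<times> ('m \<Rightarrow> real ^ 'n)"

abbreviation chart_dom :: "('m, 'n) chart \<Rightarrow> 'm set" where
  "chart_dom c \<equiv> fst c"

abbreviation chart_map :: "('m, 'n) chart \<Rightarrow> 'm \<Rightarrow> real ^ 'n" where
  "chart_map c \<equiv> snd c"

definition chart_inv :: "('m, 'n) chart \<Rightarrow> real ^ 'n \<Rightarrow> 'm" where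
  "chart_inv c = inv_into (chart_dom c) (chart_map c)"

definition is_chart :: "('m::topological_space, 'n::finite) chart \<Rightarrow> bool" where
  "is_chart c \<longleftrightarrow>
     open (chart_dom c) \<and> open (chart_map c ` chart_dom c) \<and>
     homeomorphism (chart_dom c) (chart_map c ` chart_dom c) (chart_map c) (chart_inv c)"

definition transition ::
  "('m, 'n) chart \<Rightarrow> ('m, 'n) chart \<Rightarrow> real ^ 'n \<Rightarrow> real ^ 'n" where
  "transition c d = chart_map d \<circ> chart_inv c"

text \<open>A smooth atlas (not necessarily maximal) whose underlying manifold is the whole type.\<close>

definition smooth_atlas :: "('m::topological_space, 'n::finite) chart set \<Rightarrow> bool" where
  "smooth_atlas A \<longleftrightarrow>
     (\<forall>c\<in>A. is_chart c) \<and> (\<Union>c\<in>A. chart_dom c) = UNIV \<and>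
     (\<forall>c\<in>A. \<forall>d\<in>A. smooth_on (chart_map c ` (chart_dom c \<inter> chart_dom d)) (transition c d))"

text \<open>A tangent vector at \<open>p\<close> is the family of its coordinate vectors in all charts around \<open>p\<close>,
  related by the derivatives of the coordinate changes.\<close>

definition tangent_space ::
  "('m::topological_space, 'n::finite) chart set \<Rightarrow> 'm \<Rightarrow> (('m, 'n) chart \<Rightarrow> real ^ 'n) set" where
  "tangent_space A p = {v.
     (\<forall>c. c \<notin> A \<or> p \<notin> chart_dom c \<longrightarrow> v c = 0) \<and>
     (\<forall>c\<in>A. \<forall>d\<in>A. p \<in> chart_dom c \<and> p \<in> chart_dom d \<longrightarrow>
        v d = frechet_derivative (transition c d) (at (chart_map c p)) (v c))}"

text \<open>The tangent vector at \<open>p\<close> with coordinate vector \<open>e\<close> in the chart \<open>c\<close>.\<close>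

definition tangent_vector ::
  "('m::topological_space, 'n::finite) chart set \<Rightarrow> ('m, 'n) chart \<Rightarrow> 'm \<Rightarrow> real ^ 'n \<Rightarrow>
     (('m, 'n) chart \<Rightarrow> real ^ 'n)" where
  "tangent_vector A c p e = (\<lambda>d. if d \<in> A \<and> p \<in> chart_dom d
     then frechet_derivative (transition c d) (at (chart_map c p)) e else 0)"

definition smooth_function_on ::
  "('m::topological_space, 'n::finite) chart set \<Rightarrow> 'm set \<Rightarrow>
     ('m \<Rightarrow> 'b::euclidean_space) \<Rightarrow> bool" where
  "smooth_function_on A U f \<longleftrightarrow>
     (\<forall>c\<in>A. smooth_on (chart_map c ` (U \<inter> chart_dom c)) (\<lambda>x. f (chart_inv c x)))"

definition smooth_form_on ::
  "('m::topological_space, 'n::finite) chart set \<Rightarrow> nat \<Rightarrow> 'm set \<Rightarrow>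
     ('m \<Rightarrow> (('m, 'n) chart \<Rightarrow> real ^ 'n) list \<Rightarrow> real) \<Rightarrow> bool" where
  "smooth_form_on A k U \<omega> \<longleftrightarrow>
     (\<forall>p\<in>U. \<omega> p \<in> alt_forms k (tangent_space A p)) \<and>
     (\<forall>c\<in>A. \<forall>es. length es = k \<longrightarrow>
        smooth_on (chart_map c ` (U \<inter> chart_dom c))
          (\<lambda>x. \<omega> (chart_inv c x) (map (tangent_vector A c (chart_inv c x)) es)))"

text \<open>
  The fields \<open>\<rho>\<close> of nonzero \<open>n\<close>-vectors on an \<open>n\<close>-manifold used to form the reduced bilinear
  form. Smoothness is tested against smooth local \<open>n\<close>-forms. For \<open>n = 7\<close> the field \<open>\<rho>\<close>
  itself is smooth; otherwise only its square is, i.e. \<open>\<rho>\<close> is chosen up to sign.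
\<close>

definition admissible_multivector_field ::
  "('m::topological_space, 'n::finite) chart set \<Rightarrow>
     ('m \<Rightarrow> ((('m, 'n) chart \<Rightarrow> real ^ 'n) list \<Rightarrow> real) \<Rightarrow> real) \<Rightarrow> bool" where
  "admissible_multivector_field A \<rho> \<longleftrightarrow>
     (\<forall>p. \<rho> p \<in> multivectors CARD('n) (tangent_space A p) \<and>
          (\<exists>\<omega>\<in>alt_forms CARD('n) (tangent_space A p). \<rho> p \<omega> \<noteq> 0)) \<and>
     (if CARD('n) = 7
      then \<forall>U \<omega>. open U \<and> smooth_form_on A CARD('n) U \<omega> \<longrightarrow>
             smooth_function_on A U (\<lambda>p. \<rho> p (\<omega> p))
      else \<forall>U \<omega> \<omega>'. open U \<and> smooth_form_on A CARD('n) U \<omega> \<and> smooth_form_on A CARD('n) U \<omega>' \<longrightarrow>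
             smooth_function_on A U (\<lambda>p. \<rho> p (\<omega> p) * \<rho> p (\<omega>' p)))"

text \<open>
  A local trivialisation \<open>TM|\<^sub>U \<cong> U \<times> \<real>\<^sup>n\<close>. As it is fibrewise linear, it is smooth iff the
  images of the coordinate vector fields are; its inverse is then smooth as well.
\<close>

definition tangent_trivialization ::
  "('m::topological_space, 'n::finite) chart set \<Rightarrow> 'm set \<Rightarrow>
     ('m \<Rightarrow> (('m, 'n) chart \<Rightarrow> real ^ 'n) \<Rightarrow> real ^ 'n) \<Rightarrow> bool" where
  "tangent_trivialization A U \<Psi> \<longleftrightarrow>
     (\<forall>q\<in>U. linear_map_on (tangent_space A q) (\<Psi> q) \<and>
            bij_betw (\<Psi> q) (tangent_space A q) UNIV) \<and>
     (\<forall>c\<in>A. \<forall>e. smooth_on (chart_map c ` (U \<inter> chart_dom c))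
        (\<lambda>x. \<Psi> (chart_inv c x) (tangent_vector A c (chart_inv c x) e)))"

text \<open>
  Every fibre is a simple Malcev algebra, and locally \<open>TM\<close> is smoothly isomorphic, as a bundle
  of algebras, to the product with a fixed simple Malcev algebra on \<open>\<real>\<^sup>n\<close>. In particular the
  multiplication is smooth.
\<close>

definition simple_malcev_bundle ::
  "('m::topological_space, 'n::finite) chart set \<Rightarrow>
     ('m \<Rightarrow> (('m, 'n) chart \<Rightarrow> real ^ 'n) \<Rightarrow> (('m, 'n) chart \<Rightarrow> real ^ 'n) \<Rightarrow>
        (('m, 'n) chart \<Rightarrow> real ^ 'n)) \<Rightarrow> bool" where
  "simple_malcev_bundle A m \<longleftrightarrow>
     (\<forall>p. simple_malcev_algebra (tangent_space A p) (m p)) \<and>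
     (\<forall>p. \<exists>U \<Psi> \<mu>. open U \<and> p \<in> U \<and>
        simple_malcev_algebra (UNIV :: (real ^ 'n) set) \<mu> \<and>
        tangent_trivialization A U \<Psi> \<and>
        (\<forall>q\<in>U. \<forall>x\<in>tangent_space A q. \<forall>y\<in>tangent_space A q.
           \<Psi> q (m q x y) = \<mu> (\<Psi> q x) (\<Psi> q y)))"

end

theory Submission imports Defs begin

text \<open>
  Everything is compared with one explicit form \<open>T\<^sub>0\<close> for each \<open>n\<close>, whose algebra is known: the split
  octonionic form for \<open>n = 7\<close> and the Cartan form of \<open>sl(3)\<close> for \<open>n = 8\<close>. The stable orbits are open and the
  reduced form depends polynomially on the 3-form, so a polynomial identity valid on the orbit of \<open>T\<^sub>0\<close>,
  such as the Malcev identity after Cramer's rule, holds for all 3-forms, while nondegeneracy of the reduced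
  form and submersivity of the orbit map \<open>g \<mapsto> g\<^sup>*T\<close> are nonvanishing conditions on covariant polynomials,
  which hold on every open orbit as soon as they hold at \<open>T\<^sub>0\<close>. A local section of the orbit map through
  \<open>\<phi>\<^sub>p\<close> then trivializes the bundle of algebras near \<open>p\<close>, up to the scaling factor by which \<open>\<rho>\<close> enters.
\<close>

section \<open>Calculus of smooth maps\<close>

text \<open>There are several real open orbits (compact and split G2 forms, the real forms of
  sl(3)), and they are never classified. A polynomial in t that is nonzero at t = 1 has finitely
  many zeros, so on the line from a stable T towards the model there are points of the orbit of T,
  close to T, where it does not vanish. What is transferred in this way is submersivity rather than
  openness, because the inverse function theorem turns it into smooth sections. Simplicity is not a
  polynomial condition, so it is deduced directly from submersivity by counting dimensions. Two
  scalings need care. The product changes by a power of \<open>det g\<close> and by the choice of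
  \<open>\<rho>\<close>; a product is quadratic in its arguments while a linear map scales linearly,
  so one scalar function multiplied into the trivialization absorbs both factors and no root is
  extracted. The existence of an admissible \<open>\<rho>\<close> is also to be proved, with no
  orientation given: the Gram determinant has a weight divisible by 9, its real ninth root exists
  because 9 is odd, and it is smooth because the determinant never vanishes.\<close>

lemma Ck_on_cong:
  assumes "open S" "\<And>x. x \<in> S \<Longrightarrow> f x = g x"
  shows "Ck_on k S f \<longleftrightarrow> Ck_on k S g"
  using assms(2)
proof (induction k arbitrary: f g)
  case 0
  then show ?case by (simp cong: continuous_on_cong)
next
  case (Suc k)
  have hd: "(f has_derivative F) (at x) \<longleftrightarrow> (g has_derivative F) (at x)" if "x \<in> S" for x F
    using Suc.prems has_derivative_transform_within_open[OF _ assms(1) that] by metis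
  then have fd: "frechet_derivative f (at x) = frechet_derivative g (at x)" if "x \<in> S" for x
    using that unfolding frechet_derivative_def by simp
  have "f differentiable (at x) \<longleftrightarrow> g differentiable (at x)" if "x \<in> S" for x
    using hd[OF that] unfolding differentiable_def by auto
  moreover have "Ck_on k S (\<lambda>x. frechet_derivative f (at x) v) \<longleftrightarrow>
      Ck_on k S (\<lambda>x. frechet_derivative g (at x) v)" for v
    by (rule Suc.IH) (simp add: fd)
  ultimately show ?case by auto
qed

lemma Ck_on_subset: "Ck_on k S f \<Longrightarrow> T \<subseteq> S \<Longrightarrow> Ck_on k T f"
  by (induction k arbitrary: f) (auto intro: continuous_on_subset)

lemma Ck_on_mono: "Ck_on (Suc k) S f \<Longrightarrow> Ck_on k S f"
proof (induction k arbitrary: f)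
  case 0
  then show ?case
    by (auto intro!: continuous_at_imp_continuous_on differentiable_imp_continuous_within)
next
  case (Suc k)
  then show ?case by (metis Ck_on.simps(2))
qed

text \<open>Admits any formula for the derivative in place of \<open>frechet_derivative\<close>. The
  closure rules below are inductions on k whose step differentiates once by such a formula.\<close>

lemma Ck_on_SucI:
  assumes "open S" "\<And>x. x \<in> S \<Longrightarrow> (f has_derivative f' x) (at x)"
    and "\<And>v. Ck_on k S (\<lambda>x. f' x v)"
  shows "Ck_on (Suc k) S f"
proof -
  have "frechet_derivative f (at x) = f' x" if "x \<in> S" for x
    using frechet_derivative_at[OF assms(2)[OF that]] by simp
  then have "Ck_on k S (\<lambda>x. frechet_derivative f (at x) v)" for v
    using assms(3)[of v] Ck_on_cong[OF assms(1), of "\<lambda>x. frechet_derivative f (at x) v" "\<lambda>x. f' x v"]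
    by auto
  with assms(2) show ?thesis by (auto simp: differentiable_def)
qed

lemma Ck_on_SucD:
  assumes "Ck_on (Suc k) S f"
  shows "x \<in> S \<Longrightarrow> (f has_derivative frechet_derivative f (at x)) (at x)"
    and "Ck_on k S (\<lambda>x. frechet_derivative f (at x) v)"
  using assms by (auto simp: frechet_derivative_works)

lemma Ck_on_const: "open S \<Longrightarrow> Ck_on k S (\<lambda>x. c)"
proof (induction k arbitrary: c)
  case (Suc k)
  show ?case
    by (rule Ck_on_SucI[where f' = "\<lambda>_ _. 0"]) (rule Suc.prems has_derivative_const Suc.IH)+
qed simp

lemma Ck_on_add:
  assumes "open S"
  shows "Ck_on k S f \<Longrightarrow> Ck_on k S g \<Longrightarrow> Ck_on k S (\<lambda>x. f x + g x)"
proof (induction k arbitrary: f g)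
  case 0
  then show ?case by (auto intro: continuous_intros)
next
  case (Suc k)
  show ?case
    by (rule Ck_on_SucI[OF assms has_derivative_add[OF Ck_on_SucD(1)[OF Suc.prems(1)] Ck_on_SucD(1)[OF Suc.prems(2)]]])
       (assumption | intro Suc.IH Ck_on_SucD(2)[OF Suc.prems(1)] Ck_on_SucD(2)[OF Suc.prems(2)])+
qed

lemma Ck_on_bilinear:
  assumes "open S" "bounded_bilinear pr"
  shows "Ck_on k S f \<Longrightarrow> Ck_on k S g \<Longrightarrow> Ck_on k S (\<lambda>x. pr (f x) (g x))"
proof (induction k arbitrary: f g)
  case 0
  then show ?case by (auto intro: bounded_bilinear.continuous_on[OF assms(2)])
next
  case (Suc k)
  show ?case
    by (rule Ck_on_SucI[OF assms(1) bounded_bilinear.FDERIV[OF assms(2) Ck_on_SucD(1)[OF Suc.prems(1)]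
          Ck_on_SucD(1)[OF Suc.prems(2)]]])
       (assumption | intro Ck_on_add[OF assms(1)] Suc.IH Ck_on_SucD(2)[OF Suc.prems(1)] Ck_on_SucD(2)[OF Suc.prems(2)]
         Ck_on_mono[OF Suc.prems(1)] Ck_on_mono[OF Suc.prems(2)])+
qed

lemma Ck_on_bounded_linear:
  assumes "open S" "bounded_linear L" "Ck_on k S f"
  shows "Ck_on k S (\<lambda>x. L (f x))"
  using assms(3)
proof (induction k arbitrary: f)
  case 0
  then show ?case by (auto intro: bounded_linear.continuous_on[OF assms(2)])
next
  case (Suc k)
  show ?case
    by (rule Ck_on_SucI[OF assms(1) bounded_linear.has_derivative[OF assms(2) Ck_on_SucD(1)[OF Suc.prems]]])
       (assumption | intro Suc.IH Ck_on_SucD(2)[OF Suc.prems])+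
qed

lemma Ck_on_sum:
  assumes "open S" "finite I" "\<And>i. i \<in> I \<Longrightarrow> Ck_on k S (f i)"
  shows "Ck_on k S (\<lambda>x. \<Sum>i\<in>I. f i x)"
  using assms(2,3)
proof (induction I rule: finite_induct)
  case empty
  then show ?case using Ck_on_const[OF assms(1), of _ 0] by simp
next
  case (insert i I)
  then show ?case using Ck_on_add[OF assms(1), of _ "f i" "\<lambda>x. \<Sum>i\<in>I. f i x"] by simp
qed

lemma Ck_on_compose:
  assumes "open S" "open T"
  shows "Ck_on k T f \<Longrightarrow> Ck_on k S g \<Longrightarrow> g ` S \<subseteq> T \<Longrightarrow> Ck_on k S (\<lambda>x. f (g x))"
proof (induction k arbitrary: f)
  case 0
  then show ?case by (auto intro: continuous_on_compose2)
next
  case (Suc k)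
  let ?f' = "\<lambda>y. frechet_derivative f (at y)" and ?g' = "\<lambda>x. frechet_derivative g (at x)"
  have 1: "((\<lambda>x. f (g x)) has_derivative (\<lambda>v. ?f' (g x) (?g' x v))) (at x)" if "x \<in> S" for x
    by (rule has_derivative_compose[OF Ck_on_SucD(1)[OF Suc.prems(2) that] Ck_on_SucD(1)[OF Suc.prems(1)]])
       (use that Suc.prems(3) in auto)
  \<comment> \<open>The direction in which f is differentiated varies with x, whereas
    \<open>Ck_on\<close> controls derivatives in fixed directions only. Expansion in
    \<open>Basis\<close> leaves finitely many fixed directions with coefficients taken from the
    derivative of g.\<close>
  have 2: "?f' (g x) w = (\<Sum>b\<in>Basis. (w \<bullet> b) *\<^sub>R ?f' (g x) b)" if "x \<in> S" for x w
  proof -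
    have "linear (?f' (g x))"
      using Ck_on_SucD(1)[OF Suc.prems(1)] that Suc.prems(3) has_derivative_linear by blast
    then have "?f' (g x) (\<Sum>b\<in>Basis. (w \<bullet> b) *\<^sub>R b) = (\<Sum>b\<in>Basis. (w \<bullet> b) *\<^sub>R ?f' (g x) b)"
      by (simp add: linear_sum linear_scale)
    then show ?thesis by (simp add: euclidean_representation)
  qed
  have "((\<lambda>x. f (g x)) has_derivative (\<lambda>v. \<Sum>b\<in>Basis. (?g' x v \<bullet> b) *\<^sub>R ?f' (g x) b)) (at x)"
    if "x \<in> S" for x
    by (rule has_derivative_eq_rhs[OF 1[OF that]]) (rule ext, rule 2[OF that])
  moreover have "Ck_on k S (\<lambda>x. \<Sum>b\<in>Basis. (?g' x v \<bullet> b) *\<^sub>R ?f' (g x) b)" for v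
    by (intro Ck_on_sum Ck_on_bilinear[OF _ bounded_bilinear_scaleR] Suc.IH[OF Ck_on_SucD(2)[OF Suc.prems(1)]]
        Ck_on_mono[OF Suc.prems(2)] Ck_on_SucD(2)[OF Suc.prems(2)] Suc.prems(3)
        Ck_on_bounded_linear[OF _ bounded_linear_inner_left] assms finite_Basis)
  ultimately show ?case by (rule Ck_on_SucI[OF assms(1)])
qed

lemma Ck_on_inverse:
  fixes f :: "'a::euclidean_space \<Rightarrow> real"
  assumes "open S" "\<And>x. x \<in> S \<Longrightarrow> f x \<noteq> 0"
  shows "Ck_on k S f \<Longrightarrow> Ck_on k S (\<lambda>x. inverse (f x))"
proof (induction k)
  case 0
  then show ?case using assms(2) by (auto intro: continuous_intros)
next
  case (Suc k)
  have d: "((\<lambda>x. inverse (f x)) has_derivative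
      (\<lambda>v. (-1) *\<^sub>R (inverse (f x) * frechet_derivative f (at x) v * inverse (f x)))) (at x)" if "x \<in> S" for x
    using Deriv.has_derivative_inverse[OF assms(2)[OF that] Ck_on_SucD(1)[OF Suc.prems that]] by simp
  have "Ck_on k S f" by (rule Ck_on_mono[OF Suc.prems])
  note IH = Suc.IH[OF this]
  show ?case
    by (rule Ck_on_SucI[OF assms(1) d], assumption)
       (intro Ck_on_bounded_linear[OF assms(1) bounded_linear_scaleR_right]
         Ck_on_bilinear[OF assms(1) bounded_bilinear_mult] IH Ck_on_SucD(2)[OF Suc.prems])
qed

lemma smooth_on_const [intro]: "open S \<Longrightarrow> smooth_on S (\<lambda>x. c)"
  by (simp add: smooth_on_def Ck_on_const)

lemma smooth_on_add: "open S \<Longrightarrow> smooth_on S f \<Longrightarrow> smooth_on S g \<Longrightarrow> smooth_on S (\<lambda>x. f x + g x)"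
  by (simp add: smooth_on_def Ck_on_add)

lemma smooth_on_mult:
  fixes f g :: "'a::euclidean_space \<Rightarrow> real"
  shows "open S \<Longrightarrow> smooth_on S f \<Longrightarrow> smooth_on S g \<Longrightarrow> smooth_on S (\<lambda>x. f x * g x)"
  unfolding smooth_on_def by (rule allI, rule Ck_on_bilinear[OF _ bounded_bilinear_mult]) auto

lemma smooth_on_scaleR:
  "open S \<Longrightarrow> smooth_on S f \<Longrightarrow> smooth_on S g \<Longrightarrow> smooth_on S (\<lambda>x. f x *\<^sub>R g x)"
  unfolding smooth_on_def by (rule allI, rule Ck_on_bilinear[OF _ bounded_bilinear_scaleR]) auto

lemma smooth_on_bounded_linear:
  "open S \<Longrightarrow> bounded_linear L \<Longrightarrow> smooth_on S f \<Longrightarrow> smooth_on S (\<lambda>x. L (f x))"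
  unfolding smooth_on_def by (rule allI, rule Ck_on_bounded_linear[where L = L]) auto

lemma smooth_on_sum:
  "open S \<Longrightarrow> finite I \<Longrightarrow> (\<And>i. i \<in> I \<Longrightarrow> smooth_on S (f i)) \<Longrightarrow> smooth_on S (\<lambda>x. \<Sum>i\<in>I. f i x)"
  by (simp add: smooth_on_def Ck_on_sum)

lemma smooth_on_prod:
  fixes f :: "'i \<Rightarrow> 'a::euclidean_space \<Rightarrow> real"
  assumes "open S"
  shows "finite I \<Longrightarrow> (\<And>i. i \<in> I \<Longrightarrow> smooth_on S (f i)) \<Longrightarrow> smooth_on S (\<lambda>x. \<Prod>i\<in>I. f i x)"
proof (induction I rule: finite_induct)
  case empty
  then show ?case using smooth_on_const[OF assms, of 1] by simp
next
  case (insert i I)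
  then show ?case using smooth_on_mult[OF assms, of "f i" "\<lambda>x. \<Prod>i\<in>I. f i x"] by simp
qed

lemma smooth_on_compose:
  "open S \<Longrightarrow> open T \<Longrightarrow> smooth_on T f \<Longrightarrow> smooth_on S g \<Longrightarrow> g ` S \<subseteq> T \<Longrightarrow> smooth_on S (\<lambda>x. f (g x))"
  unfolding smooth_on_def by (rule allI, rule Ck_on_compose[where T = T]) auto

lemma smooth_on_inverse:
  fixes f :: "'a::euclidean_space \<Rightarrow> real"
  shows "open S \<Longrightarrow> (\<And>x. x \<in> S \<Longrightarrow> f x \<noteq> 0) \<Longrightarrow> smooth_on S f \<Longrightarrow> smooth_on S (\<lambda>x. inverse (f x))"
  by (simp add: smooth_on_def Ck_on_inverse)

lemma smooth_on_subset: "smooth_on S f \<Longrightarrow> T \<subseteq> S \<Longrightarrow> smooth_on T f"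
  by (auto simp: smooth_on_def intro: Ck_on_subset)

lemma smooth_on_cong:
  "open S \<Longrightarrow> (\<And>x. x \<in> S \<Longrightarrow> f x = g x) \<Longrightarrow> smooth_on S f \<longleftrightarrow> smooth_on S g"
  using Ck_on_cong[of S f g] by (auto simp: smooth_on_def)

lemma smooth_on_imp_continuous_on: "smooth_on S f \<Longrightarrow> continuous_on S f"
  unfolding smooth_on_def by (metis Ck_on.simps(1))

lemma smooth_on_has_derivative:
  "smooth_on S f \<Longrightarrow> x \<in> S \<Longrightarrow> (f has_derivative frechet_derivative f (at x)) (at x)"
  by (rule Ck_on_SucD(1)[of 0]) (auto simp only: smooth_on_def)

lemma smooth_on_frechet_derivative:
  "smooth_on S f \<Longrightarrow> smooth_on S (\<lambda>x. frechet_derivative f (at x) v)"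
  unfolding smooth_on_def by (intro allI Ck_on_SucD(2)) (rule spec)

lemma smooth_on_vec_iff:
  fixes f :: "'a::euclidean_space \<Rightarrow> real ^ 'k"
  assumes "open S"
  shows "smooth_on S f \<longleftrightarrow> (\<forall>i. smooth_on S (\<lambda>x. f x $ i))"
proof
  assume "smooth_on S f"
  then show "\<forall>i. smooth_on S (\<lambda>x. f x $ i)"
    by (intro allI smooth_on_bounded_linear[OF assms bounded_linear_vec_nth])
next
  assume "\<forall>i. smooth_on S (\<lambda>x. f x $ i)"
  then have "smooth_on S (\<lambda>x. \<Sum>i\<in>UNIV. f x $ i *\<^sub>R (axis i 1 :: real ^ 'k))"
    by (intro smooth_on_sum smooth_on_scaleR smooth_on_const assms) auto
  moreover have "(\<Sum>i\<in>UNIV. f x $ i *\<^sub>R (axis i 1 :: real ^ 'k)) = f x" for x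
    by (simp add: basis_expansion scalar_mult_eq_scaleR[symmetric])
  then have "(\<lambda>x. \<Sum>i\<in>UNIV. f x $ i *\<^sub>R (axis i 1 :: real ^ 'k)) = f" by (rule ext)
  ultimately show "smooth_on S f" by (simp only:)
qed

lemma smooth_on_det:
  fixes f :: "'a::euclidean_space \<Rightarrow> real ^ 'k ^ 'k"
  assumes "open S" "\<And>i j. smooth_on S (\<lambda>x. f x $ i $ j)"
  shows "smooth_on S (\<lambda>x. det (f x))"
  unfolding det_def
  by (intro smooth_on_sum smooth_on_mult smooth_on_prod smooth_on_const assms) auto

lemma smooth_on_real_polynomial_function:
  assumes "real_polynomial_function p" "open S" "smooth_on S f"
  shows "smooth_on S (\<lambda>x. p (f x))"
  using assms(1)
proof induction
  case (linear L)
  then show ?case using smooth_on_bounded_linear assms(2,3) by blast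
qed (use assms(2) in \<open>simp_all add: smooth_on_const smooth_on_add smooth_on_mult\<close>)

text \<open>The equation is solved by \<open>s = \<bar>D\<bar>\<^sup>c\<close>; smoothness follows by bootstrapping.\<close>

lemma smooth_on_logarithmic_derivative:
  fixes s D :: "'a::euclidean_space \<Rightarrow> real"
  assumes S: "open S" and D: "smooth_on S D" and nz: "\<And>x. x \<in> S \<Longrightarrow> D x \<noteq> 0"
    and s: "\<And>x. x \<in> S \<Longrightarrow>
      (s has_derivative (\<lambda>v. c *\<^sub>R (s x * (frechet_derivative D (at x) v * inverse (D x))))) (at x)"
  shows "smooth_on S s"
proof -
  have "Ck_on k S s" for k
  proof (induction k)
    case 0
    show ?case by (simp, rule continuous_at_imp_continuous_on) (use s has_derivative_continuous in blast)
  next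
    case (Suc k)
    have "Ck_on k S (\<lambda>x. frechet_derivative D (at x) v)" for v
      using smooth_on_frechet_derivative[OF D] by (simp add: smooth_on_def)
    moreover have "Ck_on k S (\<lambda>x. inverse (D x))"
      using smooth_on_inverse[OF S nz D] by (simp add: smooth_on_def)
    ultimately have "Ck_on k S (\<lambda>x. c *\<^sub>R (s x * (frechet_derivative D (at x) v * inverse (D x))))" for v
      by (intro Ck_on_bounded_linear[OF S bounded_linear_scaleR_right]
         Ck_on_bilinear[OF S bounded_bilinear_mult] Suc.IH)
    with Ck_on_SucI[OF S s] show ?case by blast
  qed
  then show ?thesis by (simp add: smooth_on_def)
qed

section \<open>Alternating forms\<close>

lemma alt_forms_outside: "\<omega> \<in> alt_forms k V \<Longrightarrow> length xs \<noteq> k \<or> \<not> set xs \<subseteq> V \<Longrightarrow> \<omega> xs = 0"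
  by (auto simp: alt_forms_def)

lemma alt_forms_update:
  assumes "\<omega> \<in> alt_forms k V" "length xs = k" "set xs \<subseteq> V" "i < k" "x \<in> V" "y \<in> V"
  shows "\<omega> (xs[i := a *\<^sub>R x + y]) = a * \<omega> (xs[i := x]) + \<omega> (xs[i := y])"
  using assms unfolding alt_forms_def by blast

lemma alt_forms_eq_zero:
  "\<omega> \<in> alt_forms k V \<Longrightarrow> length xs = k \<Longrightarrow> i < j \<Longrightarrow> j < k \<Longrightarrow> xs ! i = xs ! j \<Longrightarrow> \<omega> xs = 0"
  unfolding alt_forms_def by blast

text \<open>If the length is wrong or another entry leaves V, all three values are 0. Later
  expansions therefore need no bookkeeping about the remaining slots.\<close>

lemma alt_forms_linear:
  assumes \<omega>: "\<omega> \<in> alt_forms k V" and V: "x \<in> V" "y \<in> V" "subspace V"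
  shows "\<omega> (us @ (a *\<^sub>R x + y) # ws) = a * \<omega> (us @ x # ws) + \<omega> (us @ y # ws)"
proof (cases "length (us @ x # ws) = k \<and> set (us @ x # ws) \<subseteq> V")
  case True
  then show ?thesis
    using alt_forms_update[OF \<omega>, of "us @ x # ws" "length us" x y a] V
    by (auto simp: list_update_append)
next
  case False
  have "a *\<^sub>R x + y \<in> V" using V by (simp add: subspace_add subspace_scale)
  with False V show ?thesis
    using alt_forms_outside[OF \<omega>, of "us @ (a *\<^sub>R x + y) # ws"]
      alt_forms_outside[OF \<omega>, of "us @ x # ws"] alt_forms_outside[OF \<omega>, of "us @ y # ws"]
    by auto
qed

lemma alt_forms_add:
  assumes "\<omega> \<in> alt_forms k V" "x \<in> V" "y \<in> V" "subspace V"
  shows "\<omega> (us @ (x + y) # ws) = \<omega> (us @ x # ws) + \<omega> (us @ y # ws)"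
  using alt_forms_linear[OF assms, of us 1 ws] by simp

lemma alt_forms_zero:
  assumes "\<omega> \<in> alt_forms k V" "subspace V"
  shows "\<omega> (us @ 0 # ws) = 0"
  using alt_forms_linear[OF assms(1) _ _ assms(2), of 0 0 us 1 ws] subspace_0[OF assms(2)] by simp

lemma alt_forms_scale:
  assumes "\<omega> \<in> alt_forms k V" "x \<in> V" "subspace V"
  shows "\<omega> (us @ (a *\<^sub>R x) # ws) = a * \<omega> (us @ x # ws)"
  using alt_forms_linear[OF assms(1,2) _ assms(3), of 0 us a ws] subspace_0[OF assms(3)]
    alt_forms_zero[OF assms(1,3)] by simp

lemma alt_forms_sum:
  assumes \<omega>: "\<omega> \<in> alt_forms k V" and V: "subspace V" and I: "finite I" "\<And>i. i \<in> I \<Longrightarrow> x i \<in> V"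
  shows "\<omega> (us @ (\<Sum>i\<in>I. c i *\<^sub>R x i) # ws) = (\<Sum>i\<in>I. c i * \<omega> (us @ x i # ws))"
  using I
proof (induction I rule: finite_induct)
  case empty
  then show ?case by (simp add: alt_forms_zero[OF \<omega> V])
next
  case (insert i I)
  have "(\<Sum>i\<in>I. c i *\<^sub>R x i) \<in> V" using insert V by (auto intro!: subspace_sum subspace_scale)
  then show ?case using insert alt_forms_linear[OF \<omega> _ _ V, of "x i" "\<Sum>i\<in>I. c i *\<^sub>R x i"] by simp
qed

lemma alt_forms_repeat:
  assumes "\<omega> \<in> alt_forms k V"
  shows "\<omega> (us @ x # vs @ x # ws) = 0"
proof (cases "length (us @ x # vs @ x # ws) = k")
  case True
  have "(us @ x # vs @ x # ws) ! (length us) = x"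
      "(us @ x # vs @ x # ws) ! (length us + Suc (length vs)) = x"
    by (simp, metis append_Cons append_Nil append_assoc length_append length_Cons nth_append_length
        add_Suc_right list.size(3) add_0 append.assoc)
  then show ?thesis using alt_forms_eq_zero[OF assms, of "us @ x # vs @ x # ws" "length us" "length us + Suc (length vs)"] True by simp
next
  case False
  then show ?thesis using alt_forms_outside[OF assms] by blast
qed

text \<open>Polarization: expand the vanishing value at x + y in both slots. Outside V both sides
  are 0, so the rule has the unconditional form that \<open>sort_sign\<close> asks for.\<close>

lemma alt_forms_swap:
  assumes \<omega>: "\<omega> \<in> alt_forms k V" and V: "subspace V"
  shows "\<omega> (us @ x # y # ws) = - \<omega> (us @ y # x # ws)"
proof (cases "x \<in> V \<and> y \<in> V")
  case True
  then have xy: "x + y \<in> V" using V by (simp add: subspace_add)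
  have r: "\<omega> (us @ z # z # ws) = 0" for z using alt_forms_repeat[OF \<omega>, of us z "[]" ws] by simp
  have "0 = \<omega> (us @ (x + y) # (x + y) # ws)" by (simp add: r)
  also have "\<dots> = \<omega> (us @ x # (x + y) # ws) + \<omega> (us @ y # (x + y) # ws)"
    using alt_forms_add[OF \<omega> _ _ V] True by blast
  also have "\<dots> = \<omega> (us @ x # y # ws) + \<omega> (us @ y # x # ws)"
    using True alt_forms_add[OF \<omega> _ _ V, of x y "us @ [x]" ws] alt_forms_add[OF \<omega> _ _ V, of x y "us @ [y]" ws]
    by (simp add: r)
  finally show ?thesis by simp
next
  case False
  then show ?thesis using alt_forms_outside[OF \<omega>, of "us @ x # y # ws"] alt_forms_outside[OF \<omega>, of "us @ y # x # ws"]
    by auto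
qed

lemma alt_forms_comb:
  assumes \<omega>: "\<omega> \<in> alt_forms k V" "\<eta> \<in> alt_forms k V"
  shows "(\<lambda>xs. a * \<omega> xs + b * \<eta> xs) \<in> alt_forms k V"
  unfolding alt_forms_def mem_Collect_eq
proof (intro conjI allI impI)
  fix xs :: "'a list" assume "length xs \<noteq> k \<or> \<not> set xs \<subseteq> V"
  then show "a * \<omega> xs + b * \<eta> xs = 0" using alt_forms_outside \<omega> by (metis add_0 mult_zero_right)
next
  fix xs :: "'a list" and i x y c assume "length xs = k \<and> set xs \<subseteq> V \<and> i < k \<and> x \<in> V \<and> y \<in> V"
  then show "a * \<omega> (xs[i := c *\<^sub>R x + y]) + b * \<eta> (xs[i := c *\<^sub>R x + y]) =
    c * (a * \<omega> (xs[i := x]) + b * \<eta> (xs[i := x])) + (a * \<omega> (xs[i := y]) + b * \<eta> (xs[i := y]))"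
    using alt_forms_update[OF \<omega>(1), of xs i x y c] alt_forms_update[OF \<omega>(2), of xs i x y c]
    by (simp add: algebra_simps)
next
  fix xs :: "'a list" and i j assume "length xs = k \<and> i < j \<and> j < k \<and> xs ! i = xs ! j"
  then have "\<omega> xs = 0" "\<eta> xs = 0" using alt_forms_eq_zero \<omega> by (metis, metis)
  then show "a * \<omega> xs + b * \<eta> xs = 0" by simp
qed

text \<open>The parity of the number of inversions. The recursive form can be evaluated by
  rewriting, which the explicit tables below depend on.\<close>

primrec insertion_sign :: "nat list \<Rightarrow> int" where
  "insertion_sign [] = 1"
| "insertion_sign (x # l) = (-1) ^ length (filter (\<lambda>y. y < x) l) * insertion_sign l"

lemma insort_sign:
  fixes \<delta> :: "nat list \<Rightarrow> real"
  assumes swap: "\<And>us x y ws. \<delta> (us @ x # y # ws) = - \<delta> (us @ y # x # ws)"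
  shows "sorted l \<Longrightarrow> \<delta> (us @ x # l) = (-1) ^ length (filter (\<lambda>y. y < x) l) * \<delta> (us @ insort x l)"
proof (induction l arbitrary: us)
  case (Cons y l)
  show ?case
  proof (cases "x \<le> y")
    case True
    then have "filter (\<lambda>z. z < x) (y # l) = []" using Cons.prems by (auto simp: filter_empty_conv)
    then show ?thesis using True by simp
  next
    case False
    have "\<delta> (us @ x # y # l) = - \<delta> ((us @ [y]) @ x # l)" using swap[of us x y l] by simp
    also have "\<dots> = - ((-1) ^ length (filter (\<lambda>z. z < x) l) * \<delta> ((us @ [y]) @ insort x l))"
      using Cons.IH[of "us @ [y]"] Cons.prems by (subst Cons.IH) simp_all
    finally show ?thesis using False by simp
  qed
qed simp

text \<open>Only antisymmetry under adjacent swaps enters, so the same lemma serves the arguments of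
  an alternating form, the covector slots of \<open>monomial_form\<close>, and
  \<open>volume_form\<close>.\<close>

lemma sort_sign:
  fixes \<delta> :: "nat list \<Rightarrow> real"
  assumes swap: "\<And>us x y ws. \<delta> (us @ x # y # ws) = - \<delta> (us @ y # x # ws)"
  shows "\<delta> l = insertion_sign l * \<delta> (sort l)"
proof -
  have "\<delta> (us @ l) = insertion_sign l * \<delta> (us @ sort l)" for us
  proof (induction l arbitrary: us)
    case (Cons x l)
    have len: "length (filter (\<lambda>y. y < x) (sort l)) = length (filter (\<lambda>y. y < x) l)"
      by (metis mset_filter mset_sort size_mset)
    have "\<delta> (us @ x # l) = \<delta> ((us @ [x]) @ l)" by simp
    also have "\<dots> = insertion_sign l * \<delta> (us @ x # sort l)" using Cons.IH[of "us @ [x]"] by simp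
    also have "\<dots> = insertion_sign l * ((-1) ^ length (filter (\<lambda>y. y < x) l) * \<delta> (us @ insort x (sort l)))"
      using insort_sign[of \<delta> "sort l" us x, OF swap] len by simp
    finally show ?case by simp
  qed simp
  from this[of "[]"] show ?thesis by simp
qed

text \<open>The difference of the two forms vanishes on lists of spanning vectors, by sorting if the
  indices are distinct and by alternation otherwise. Multilinear expansion then carries this to all
  lists.\<close>

lemma alt_forms_eqI:
  fixes b :: "nat \<Rightarrow> 'v::real_vector"
  assumes V: "subspace V" and b: "\<And>i. i < n \<Longrightarrow> b i \<in> V"
    and span: "\<And>x. x \<in> V \<Longrightarrow> \<exists>c. x = (\<Sum>i<n. c i *\<^sub>R b i)"
    and \<omega>: "\<omega> \<in> alt_forms k V" "\<eta> \<in> alt_forms k V"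
    and eq: "\<And>l. sorted_wrt (<) l \<Longrightarrow> set l \<subseteq> {..<n} \<Longrightarrow> length l = k \<Longrightarrow> \<omega> (map b l) = \<eta> (map b l)"
  shows "\<omega> = \<eta>"
proof -
  define \<delta> where "\<delta> = (\<lambda>xs. 1 * \<omega> xs + (- 1) * \<eta> xs)"
  have \<delta>: "\<delta> \<in> alt_forms k V" unfolding \<delta>_def by (rule alt_forms_comb[OF \<omega>])
  have basis: "\<delta> (map b l) = 0" if l: "set l \<subseteq> {..<n}" for l
  proof (cases "distinct l \<and> length l = k")
    case True
    have "\<delta> (map b l) = insertion_sign l * \<delta> (map b (sort l))"
      by (rule sort_sign[where \<delta> = "\<lambda>l. \<delta> (map b l)"]) (simp only: map_append list.map, rule alt_forms_swap[OF \<delta> V])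
    moreover have "\<delta> (map b (sort l)) = 0"
      using eq[of "sort l"] True l by (simp add: \<delta>_def strict_sorted_iff)
    ultimately show ?thesis by simp
  next
    case False
    show ?thesis
    proof (cases "distinct l")
      case True
      with False show ?thesis using alt_forms_outside[OF \<delta>, of "map b l"] by simp
    next
      case False
      then obtain us x vs ws where "l = us @ [x] @ vs @ [x] @ ws" using not_distinct_decomp by blast
      then show ?thesis using alt_forms_repeat[OF \<delta>, of "map b us" "b x" "map b vs" "map b ws"] by simp
    qed
  qed
  \<comment> \<open>The list consists of arbitrary vectors followed by spanning vectors. The last
    arbitrary vector is expanded, and each of its summands joins the second part.\<close>
  have "\<delta> (us @ map b l) = 0" if "set us \<subseteq> V" "set l \<subseteq> {..<n}" for us l
    using that
  proof (induction us arbitrary: l rule: rev_induct)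
    case Nil
    then show ?case using basis by simp
  next
    case (snoc u us)
    from snoc.prems have "u \<in> V" by simp
    from span[OF this] obtain c where u: "u = (\<Sum>i<n. c i *\<^sub>R b i)" by blast
    have "\<delta> ((us @ [u]) @ map b l) = (\<Sum>i<n. c i * \<delta> (us @ map b (i # l)))"
      using alt_forms_sum[OF \<delta> V, of "{..<n}" b us c "map b l"] b u by simp
    also have "\<delta> (us @ map b (i # l)) = 0" if "i < n" for i
      using snoc.IH[of "i # l"] snoc.prems that by auto
    then have "(\<Sum>i<n. c i * \<delta> (us @ map b (i # l))) = 0" by simp
    finally show ?case .
  qed
  from this[of _ "[]"] have "\<delta> xs = 0" for xs
    using alt_forms_outside[OF \<delta>, of xs] by auto
  then show ?thesis by (auto simp: \<delta>_def fun_eq_iff)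
qed

section \<open>Contraction and wedge product of alternating forms\<close>

lemma interior_product_alt_forms:
  assumes "\<omega> \<in> alt_forms (Suc k) V" "v \<in> V"
  shows "v \<rfloor> \<omega> \<in> alt_forms k V"
  unfolding alt_forms_def mem_Collect_eq interior_product_def
proof (intro conjI allI impI)
  fix xs :: "'a list" assume "length xs \<noteq> k \<or> \<not> set xs \<subseteq> V"
  then show "\<omega> (v # xs) = 0" using alt_forms_outside[OF assms(1), of "v # xs"] by auto
next
  fix xs :: "'a list" and i x y a assume "length xs = k \<and> set xs \<subseteq> V \<and> i < k \<and> x \<in> V \<and> y \<in> V"
  then show "\<omega> (v # xs[i := a *\<^sub>R x + y]) = a * \<omega> (v # xs[i := x]) + \<omega> (v # xs[i := y])"
    using alt_forms_update[OF assms(1), of "v # xs" "Suc i" x y a] assms(2) by simp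
next
  fix xs :: "'a list" and i j assume *: "length xs = k \<and> i < j \<and> j < k \<and> xs ! i = xs ! j"
  show "\<omega> (v # xs) = 0" using alt_forms_eq_zero[OF assms(1), of "v # xs" "Suc i" "Suc j"] * by simp
qed

lemma map_perm_update:
  fixes \<pi> :: "nat \<Rightarrow> nat"
  assumes "inj \<pi>" "length xs = n" "\<pi> j < n"
  shows "map (\<lambda>k. xs[\<pi> j := z] ! \<pi> k) [a..<b] =
    (if a \<le> j \<and> j < b then (map (\<lambda>k. xs ! \<pi> k) [a..<b])[j - a := z] else map (\<lambda>k. xs ! \<pi> k) [a..<b])"
proof -
  have "xs[\<pi> j := z] ! \<pi> k = (if k = j then z else xs ! \<pi> k)" for k
    using assms by (auto simp: nth_list_update inj_eq)
  then show ?thesis by (auto intro!: nth_equalityI simp: nth_list_update)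
qed

text \<open>In the summand of \<pi>, slot i of the list reaches exactly one of the two factors, at
  position j with \<pi> j = i; this gives linearity, and vanishing off V. For equal entries i and j,
  composing \<pi> with the transposition of i and j flips the sign of each summand, so the sum
  equals its negative.\<close>

lemma wedge_alt_forms:
  assumes \<alpha>: "\<alpha> \<in> alt_forms p V" and \<beta>: "\<beta> \<in> alt_forms q V" and V: "subspace V"
  shows "wedge p q \<alpha> \<beta> \<in> alt_forms (p + q) V"
proof -
  let ?P = "{\<pi>. \<pi> permutes {..<p + q}}"
  define A where "A xs \<pi> = map (\<lambda>i. xs ! \<pi> i) [0..<p]" for xs :: "'a list" and \<pi> :: "nat \<Rightarrow> nat"
  define B where "B xs \<pi> = map (\<lambda>i. xs ! \<pi> i) [p..<p + q]" for xs :: "'a list" and \<pi> :: "nat \<Rightarrow> nat"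
  define t where "t xs \<pi> = of_int (sign \<pi>) * \<alpha> (A xs \<pi>) * \<beta> (B xs \<pi>)" for xs \<pi>
  have w: "wedge p q \<alpha> \<beta> xs = (\<Sum>\<pi>\<in>?P. t xs \<pi>) / (fact p * fact q)" if "length xs = p + q" for xs
    using that by (simp add: wedge_def t_def A_def B_def)
  have fin: "finite ?P" by (simp add: finite_permutations)
  show ?thesis
    unfolding alt_forms_def mem_Collect_eq
  proof (intro conjI allI impI)
    fix xs :: "'a list" assume *: "length xs \<noteq> p + q \<or> \<not> set xs \<subseteq> V"
    show "wedge p q \<alpha> \<beta> xs = 0"
    proof (cases "length xs = p + q")
      case True
      with * obtain i where i: "i < p + q" "xs ! i \<notin> V" by (auto simp: subset_iff in_set_conv_nth)
      have "t xs \<pi> = 0" if "\<pi> \<in> ?P" for \<pi>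
      proof -
        from that have \<pi>: "\<pi> permutes {..<p + q}" by simp
        define j where "j = inv \<pi> i"
        have j: "\<pi> j = i" "j < p + q"
          using \<pi> i by (auto simp: j_def permutes_inverses permutes_inv permutes_in_image[OF permutes_inv[OF \<pi>], of i, simplified])
        show ?thesis
        proof (cases "j < p")
          case True
          then have "xs ! i \<in> set (A xs \<pi>)" using j by (auto simp: A_def intro!: image_eqI[of _ _ j])
          then have "\<alpha> (A xs \<pi>) = 0" using alt_forms_outside[OF \<alpha>] i by blast
          then show ?thesis by (simp add: t_def)
        next
          case False
          then have "xs ! i \<in> set (B xs \<pi>)" using j by (auto simp: B_def intro!: image_eqI[of _ _ j])
          then have "\<beta> (B xs \<pi>) = 0" using alt_forms_outside[OF \<beta>] i by blast
          then show ?thesis by (simp add: t_def)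
        qed
      qed
      then show ?thesis using w[OF True] by simp
    qed (simp add: wedge_def)
  next
    fix xs :: "'a list" and i x y a assume *: "length xs = p + q \<and> set xs \<subseteq> V \<and> i < p + q \<and> x \<in> V \<and> y \<in> V"
    have "t (xs[i := a *\<^sub>R x + y]) \<pi> = a * t (xs[i := x]) \<pi> + t (xs[i := y]) \<pi>" if "\<pi> \<in> ?P" for \<pi>
    proof -
      from that have \<pi>: "\<pi> permutes {..<p + q}" by simp
      define j where "j = inv \<pi> i"
      have j: "i = \<pi> j" "j < p + q"
        using \<pi> * by (auto simp: j_def permutes_inverses permutes_inv permutes_in_image[OF permutes_inv[OF \<pi>], of i, simplified])
      have inj: "inj \<pi>" using \<pi> permutes_inj by blast
      have j': "\<pi> j < p + q" using j * by simp
      have AV: "set (A xs \<pi>) \<subseteq> V" "set (B xs \<pi>) \<subseteq> V"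
        using * permutes_in_image[OF \<pi>] by (force simp: A_def B_def subset_iff)+
      have A: "A (xs[\<pi> j := z]) \<pi> = (if j < p then (A xs \<pi>)[j := z] else A xs \<pi>)"
        and B: "B (xs[\<pi> j := z]) \<pi> = (if j < p then B xs \<pi> else (B xs \<pi>)[j - p := z])" for z
        using map_perm_update[OF inj _ j', of xs z 0 p] map_perm_update[OF inj _ j', of xs z p "p + q"] * j
        by (auto simp: A_def B_def)
      have "length (A xs \<pi>) = p" "length (B xs \<pi>) = q" by (auto simp: A_def B_def)
      then show ?thesis
        unfolding t_def j(1) A B
        using alt_forms_update[OF \<alpha>, of "A xs \<pi>" j x y a] alt_forms_update[OF \<beta>, of "B xs \<pi>" "j - p" x y a] AV j *
        by (auto simp: algebra_simps)
    qed
    then show "wedge p q \<alpha> \<beta> (xs[i := a *\<^sub>R x + y]) =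
        a * wedge p q \<alpha> \<beta> (xs[i := x]) + wedge p q \<alpha> \<beta> (xs[i := y])"
      using * by (simp add: w sum.distrib sum_distrib_left add_divide_distrib)
  next
    fix xs :: "'a list" and i j assume *: "length xs = p + q \<and> i < j \<and> j < p + q \<and> xs ! i = xs ! j"
    let ?s = "Transposition.transpose i j"
    have s: "?s permutes {..<p + q}" using * by (intro permutes_swap_id) auto
    have "xs ! ?s k = xs ! k" for k using * by (auto simp: Transposition.transpose_def)
    then have "t xs (?s \<circ> \<pi>) = - t xs \<pi>" if "\<pi> \<in> ?P" for \<pi>
    proof -
      have "sign (?s \<circ> \<pi>) = - sign \<pi>"
        using that * by (simp add: sign_compose[OF permutation_swap_id permutes_imp_permutation[of "{..<p + q}"]] sign_swap_id)
      then show ?thesis using \<open>\<And>k. xs ! ?s k = xs ! k\<close> by (simp add: t_def A_def B_def)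
    qed
    moreover have "(\<Sum>\<pi>\<in>?P. t xs \<pi>) = (\<Sum>\<pi>\<in>?P. t xs (?s \<circ> \<pi>))"
      by (rule setum_permutations_compose_left[OF s])
    ultimately have "(\<Sum>\<pi>\<in>?P. t xs \<pi>) = - (\<Sum>\<pi>\<in>?P. t xs \<pi>)" by (simp add: sum_negf)
    then show "wedge p q \<alpha> \<beta> xs = 0" using w * by simp
  qed
qed

lemma reduced_7form_alt_forms:
  assumes "\<phi> \<in> alt_forms 3 V" "subspace V" "v \<in> V" "w \<in> V"
  shows "reduced_7form \<phi> v w \<in> alt_forms 7 V"
proof -
  have "v \<rfloor> \<phi> \<in> alt_forms 2 V" "w \<rfloor> \<phi> \<in> alt_forms 2 V"
    using assms interior_product_alt_forms[of \<phi> 2] by (auto simp: numeral_eq_Suc)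
  from wedge_alt_forms[OF wedge_alt_forms[OF this assms(2)] assms(1,2)]
  show ?thesis by (simp add: reduced_7form_def)
qed

text \<open>The wedge product only permutes arguments, so it commutes with applying any map to all
  of them. Naturality of the reduced 7-form follows at once.\<close>

lemma wedge_map:
  "wedge p q \<alpha> \<beta> (map f xs) = wedge p q (\<lambda>ys. \<alpha> (map f ys)) (\<lambda>ys. \<beta> (map f ys)) xs"
proof -
  have *: "map (\<lambda>i. map f xs ! \<pi> i) [a..<b] = map f (map (\<lambda>i. xs ! \<pi> i) [a..<b])"
    if "\<pi> permutes {..<p + q}" "length xs = p + q" "b \<le> p + q" for \<pi> a b
    using permutes_in_image[OF that(1)] that by auto
  show ?thesis
  proof (cases "length xs = p + q")
    case True
    have "(\<Sum>\<pi> | \<pi> permutes {..<p + q}. of_int (sign \<pi>) *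
        \<alpha> (map (\<lambda>i. map f xs ! \<pi> i) [0..<p]) * \<beta> (map (\<lambda>i. map f xs ! \<pi> i) [p..<p + q])) =
      (\<Sum>\<pi> | \<pi> permutes {..<p + q}. of_int (sign \<pi>) *
        \<alpha> (map f (map (\<lambda>i. xs ! \<pi> i) [0..<p])) * \<beta> (map f (map (\<lambda>i. xs ! \<pi> i) [p..<p + q])))"
      by (rule sum.cong[OF refl], rule arg_cong2[where f = "(*)"], rule arg_cong2[where f = "(*)", OF refl])
        (auto simp only: mem_Collect_eq * True)
    then show ?thesis using True by (simp add: wedge_def del: map_map)
  qed (simp add: wedge_def)
qed

lemma reduced_7form_map:
  "reduced_7form \<phi> (f v) (f w) (map f xs) = reduced_7form (\<lambda>ys. \<phi> (map f ys)) v w xs"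
  by (simp add: reduced_7form_def wedge_map interior_product_def)

section \<open>Wedge products of monomial forms\<close>

text \<open>The wedge product of the listed covectors, as the determinant of the matrix of their
  values.\<close>

definition monomial_form :: "('v \<Rightarrow> real) list \<Rightarrow> 'v list \<Rightarrow> real" where
  "monomial_form \<alpha>s xs = (if length xs = length \<alpha>s then
     (\<Sum>\<pi> | \<pi> permutes {..<length \<alpha>s}. of_int (sign \<pi>) * (\<Prod>i<length \<alpha>s. (\<alpha>s ! i) (xs ! \<pi> i))) else 0)"

lemma prod_lessThan_add: "(\<Prod>i<p + q. f i) = (\<Prod>i<p. f i) * (\<Prod>j<q. f (p + j) :: real)" for p q :: nat
  by (induction q) (simp_all add: mult.assoc)

text \<open>The block sum of two permutations, with \<tau> shifted by p.\<close>

lemma permutes_juxtapose: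
  fixes p q :: nat
  assumes "\<sigma> permutes {..<p}" "\<tau> permutes {..<q}"
  obtains \<epsilon> where "\<epsilon> permutes {..<p + q}" "sign \<epsilon> = sign \<sigma> * sign \<tau>"
    "\<And>i. i < p \<Longrightarrow> \<epsilon> i = \<sigma> i" "\<And>j. j < q \<Longrightarrow> \<epsilon> (p + j) = p + \<tau> j"
proof (rule that)
  let ?t = "map_permutation {..<q} ((+) p) \<tau>"
  have im: "(+) p ` {..<q} = {p..<p + q}"
    by (simp add: lessThan_atLeast0 add.commute)
  have "?t permutes {p..<p + q}"
    by (rule map_permutation_permutes[OF _ assms(2)]) (simp add: bij_betw_def im)
  then have t: "?t permutes {..<p + q}" by (rule permutes_subset) auto
  have s: "\<sigma> permutes {..<p + q}" using assms(1) by (rule permutes_subset) auto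
  show "\<sigma> \<circ> ?t permutes {..<p + q}" by (rule permutes_compose[OF t s])
  have "sign ?t = sign \<tau>" by (rule sign_map_permutation[OF _ assms(2)]) auto
  then show "sign (\<sigma> \<circ> ?t) = sign \<sigma> * sign \<tau>"
    using s t by (simp add: sign_compose permutes_imp_permutation[of "{..<p + q}"])
  show "(\<sigma> \<circ> ?t) i = \<sigma> i" if "i < p" for i
    using permutes_not_in[OF \<open>?t permutes {p..<p + q}\<close>, of i] that by simp
  show "(\<sigma> \<circ> ?t) (p + j) = p + \<tau> j" if "j < q" for j
    using that map_permutation_apply[of "(+) p" "{..<q}" j \<tau>] permutes_not_in[OF assms(1), of "p + \<tau> j"] by simp
qed

text \<open>For each pair \<sigma>, \<tau> of permutations of the two blocks, reindexing \<pi> by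
  their block sum turns the sum over \<pi> into the full determinant sum. This happens p! q! times,
  which the denominator in \<open>wedge\<close> cancels, so monomials multiply by
  concatenation.\<close>

lemma wedge_monomial_form:
  assumes p: "length A = p" and q: "length B = q"
  shows "wedge p q (monomial_form A) (monomial_form B) = monomial_form (A @ B)"
proof
  fix xs :: "'a list"
  show "wedge p q (monomial_form A) (monomial_form B) xs = monomial_form (A @ B) xs"
  proof (cases "length xs = p + q")
    case True
    define P where "P k = {\<pi>. \<pi> permutes {..<k}}" for k :: nat
    define G where "G \<pi> = of_int (sign \<pi>) * (\<Prod>i<p + q. ((A @ B) ! i) (xs ! \<pi> i))" for \<pi>
    define a where "a \<pi> \<sigma> = of_int (sign \<sigma>) * (\<Prod>i<p. (A ! i) (xs ! \<pi> (\<sigma> i)))" for \<pi> \<sigma> :: "nat \<Rightarrow> nat"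
    define b where "b \<pi> \<tau> = of_int (sign \<tau>) * (\<Prod>j<q. (B ! j) (xs ! \<pi> (p + \<tau> j)))" for \<pi> \<tau> :: "nat \<Rightarrow> nat"
    have fin: "finite (P k)" for k by (simp add: P_def finite_permutations)
    have A: "monomial_form A (map (\<lambda>i. xs ! \<pi> i) [0..<p]) = (\<Sum>\<sigma>\<in>P p. a \<pi> \<sigma>)" for \<pi>
      unfolding monomial_form_def P_def a_def using p
      by (auto intro!: sum.cong prod.cong simp: permutes_in_image[of _ "{..<p}", simplified lessThan_iff])
    have B: "monomial_form B (map (\<lambda>i. xs ! \<pi> i) [p..<p + q]) = (\<Sum>\<tau>\<in>P q. b \<pi> \<tau>)" for \<pi>
      unfolding monomial_form_def P_def b_def using q
      by (auto intro!: sum.cong prod.cong simp: permutes_in_image[of _ "{..<q}", simplified lessThan_iff])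
    have G_sum: "(\<Sum>\<pi>\<in>P (p + q). of_int (sign \<pi>) * a \<pi> \<sigma> * b \<pi> \<tau>) = (\<Sum>\<pi>\<in>P (p + q). G \<pi>)"
      if "\<sigma> \<in> P p" "\<tau> \<in> P q" for \<sigma> \<tau>
    proof -
      from that have "\<sigma> permutes {..<p}" "\<tau> permutes {..<q}" by (auto simp: P_def)
      then obtain \<epsilon> where \<epsilon>: "\<epsilon> permutes {..<p + q}" "sign \<epsilon> = sign \<sigma> * sign \<tau>"
        "\<And>i. i < p \<Longrightarrow> \<epsilon> i = \<sigma> i" "\<And>j. j < q \<Longrightarrow> \<epsilon> (p + j) = p + \<tau> j"
        by (rule permutes_juxtapose) blast
      have "of_int (sign \<pi>) * a \<pi> \<sigma> * b \<pi> \<tau> = G (\<pi> \<circ> \<epsilon>)" if "\<pi> \<in> P (p + q)" for \<pi>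
      proof -
        have "sign (\<pi> \<circ> \<epsilon>) = sign \<pi> * (sign \<sigma> * sign \<tau>)"
          using that \<epsilon>(1,2) by (simp add: P_def sign_compose permutes_imp_permutation[of "{..<p + q}"])
        moreover have "(\<Prod>i<p + q. ((A @ B) ! i) (xs ! (\<pi> \<circ> \<epsilon>) i)) =
            (\<Prod>i<p. (A ! i) (xs ! \<pi> (\<sigma> i))) * (\<Prod>j<q. (B ! j) (xs ! \<pi> (p + \<tau> j)))"
          unfolding prod_lessThan_add using p by (simp add: nth_append \<epsilon>)
        ultimately show ?thesis by (simp add: G_def a_def b_def)
      qed
      then have "(\<Sum>\<pi>\<in>P (p + q). of_int (sign \<pi>) * a \<pi> \<sigma> * b \<pi> \<tau>) = (\<Sum>\<pi>\<in>P (p + q). G (\<pi> \<circ> \<epsilon>))"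
        by simp
      also have "\<dots> = (\<Sum>\<pi>\<in>P (p + q). G \<pi>)"
        unfolding P_def by (rule sum_permutations_compose_right[OF \<epsilon>(1), symmetric])
      finally show ?thesis .
    qed
    have "(\<Sum>\<pi>\<in>P (p + q). of_int (sign \<pi>) * (\<Sum>\<sigma>\<in>P p. a \<pi> \<sigma>) * (\<Sum>\<tau>\<in>P q. b \<pi> \<tau>)) =
        (\<Sum>\<pi>\<in>P (p + q). \<Sum>\<sigma>\<in>P p. \<Sum>\<tau>\<in>P q. of_int (sign \<pi>) * a \<pi> \<sigma> * b \<pi> \<tau>)"
      by (intro sum.cong refl) (simp only: mult.assoc sum_product, simp only: sum_distrib_left)
    also have "\<dots> = (\<Sum>\<sigma>\<in>P p. \<Sum>\<pi>\<in>P (p + q). \<Sum>\<tau>\<in>P q. of_int (sign \<pi>) * a \<pi> \<sigma> * b \<pi> \<tau>)"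
      by (rule sum.swap)
    also have "\<dots> = (\<Sum>\<sigma>\<in>P p. \<Sum>\<tau>\<in>P q. \<Sum>\<pi>\<in>P (p + q). of_int (sign \<pi>) * a \<pi> \<sigma> * b \<pi> \<tau>)"
      by (rule sum.cong[OF refl], rule sum.swap)
    also have "\<dots> = (\<Sum>\<sigma>\<in>P p. \<Sum>\<tau>\<in>P q. \<Sum>\<pi>\<in>P (p + q). G \<pi>)"
      by (intro sum.cong refl G_sum)
    also have "\<dots> = fact p * fact q * (\<Sum>\<pi>\<in>P (p + q). G \<pi>)"
      by (simp add: P_def card_permutations[of _ p] card_permutations[of _ q])
    finally show ?thesis
      unfolding wedge_def using True p q A B by (simp add: monomial_form_def P_def G_def)
  qed (simp add: wedge_def monomial_form_def p q)
qed

lemma monomial_form_swap: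
  "monomial_form (us @ x # y # ws) xs = - monomial_form (us @ y # x # ws) xs"
proof (cases "length xs = length (us @ x # y # ws)")
  case True
  let ?k = "length (us @ x # y # ws)" and ?i = "length us"
  let ?s = "Transposition.transpose ?i (Suc ?i)"
  define F where "F \<pi> = of_int (sign \<pi>) * (\<Prod>i<?k. ((us @ y # x # ws) ! i) (xs ! \<pi> i))" for \<pi>
  have s: "?s permutes {..<?k}" by (intro permutes_swap_id) auto
  have nth: "(us @ x # y # ws) ! i = (us @ y # x # ws) ! ?s i" for i
    by (auto simp: nth_append Transposition.transpose_def nth_Cons split: nat.splits)
  have "of_int (sign \<pi>) * (\<Prod>i<?k. ((us @ x # y # ws) ! i) (xs ! \<pi> i)) = - F (\<pi> \<circ> ?s)"
    if "\<pi> permutes {..<?k}" for \<pi>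
  proof -
    have "sign (\<pi> \<circ> ?s) = - sign \<pi>"
      using that by (simp add: sign_compose[OF permutes_imp_permutation[of "{..<?k}"] permutation_swap_id] sign_swap_id)
    moreover have "(\<Prod>i<?k. ((us @ x # y # ws) ! i) (xs ! \<pi> i)) =
        (\<Prod>i<?k. ((us @ x # y # ws) ! ?s i) (xs ! \<pi> (?s i)))"
      by (subst prod.permute[OF s]) (simp add: o_def)
    ultimately show ?thesis by (simp add: F_def nth)
  qed
  then have "monomial_form (us @ x # y # ws) xs = (\<Sum>\<pi> | \<pi> permutes {..<?k}. - F (\<pi> \<circ> ?s))"
    using True unfolding monomial_form_def by (auto intro!: sum.cong)
  also have "\<dots> = - (\<Sum>\<pi> | \<pi> permutes {..<?k}. F (\<pi> \<circ> ?s))" by (simp only: sum_negf)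
  also have "\<dots> = - (\<Sum>\<pi> | \<pi> permutes {..<?k}. F \<pi>)"
    by (rule arg_cong[where f = uminus], rule sum_permutations_compose_right[OF s, symmetric])
  finally show ?thesis using True by (simp add: monomial_form_def F_def)
qed (simp add: monomial_form_def)

text \<open>Sort the covectors first. For a sorted index list m the summand of \<pi> survives only
  if m is c permuted by \<pi>; both lists being sorted forces m = c, and distinctness of c then
  forces \<pi> to be the identity.\<close>

lemma monomial_form_basis:
  fixes cf :: "nat \<Rightarrow> 'v \<Rightarrow> real"
  assumes cf: "\<And>i j. i \<in> set l \<Longrightarrow> j \<in> set c \<Longrightarrow> cf i (b j) = (if i = j then 1 else 0)"
    and c: "sorted_wrt (<) c"
  shows "monomial_form (map cf l) (map b c) = (if sort l = c then of_int (insertion_sign l) else 0)"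
proof -
  define \<delta> where "\<delta> l = monomial_form (map cf l) (map b c)" for l
  have "\<delta> l = insertion_sign l * \<delta> (sort l)"
    by (rule sort_sign) (simp only: \<delta>_def map_append list.map, rule monomial_form_swap)
  moreover have "\<delta> m = (if m = c then 1 else 0)" if m: "sorted m" "set m = set l" for m
  proof (cases "length m = length c")
    case True
    let ?k = "length c"
    have cf': "cf (m ! i) (b (c ! j)) = (if m ! i = c ! j then 1 else 0)" if "i < ?k" "j < ?k" for i j
      using cf[of "m ! i" "c ! j"] that m True by (metis nth_mem)
    have t: "(\<Prod>i<?k. cf (m ! i) (b (c ! \<pi> i))) = (if m = c \<and> \<pi> = id then 1 else 0)"
      if \<pi>: "\<pi> permutes {..<?k}" for \<pi>
    proof -
      have lt: "\<pi> i < ?k" if "i < ?k" for i using permutes_in_image[OF \<pi>, of i] that by simp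
      have "(\<Prod>i<?k. cf (m ! i) (b (c ! \<pi> i))) = (\<Prod>i<?k. if m ! i = c ! \<pi> i then 1 else 0)"
        by (intro prod.cong refl cf') (auto simp: lt)
      also have "\<dots> = (if \<forall>i<?k. m ! i = c ! \<pi> i then 1 else 0)" by auto
      also have "(\<forall>i<?k. m ! i = c ! \<pi> i) \<longleftrightarrow> m = c \<and> \<pi> = id"
      proof
        assume *: "\<forall>i<?k. m ! i = c ! \<pi> i"
        then have "m = permute_list \<pi> c" by (intro nth_equalityI) (auto simp: permute_list_nth[OF \<pi>] True)
        then have "mset m = mset c" using \<pi> by simp
        then have mc: "m = c" using m(1) c by (metis sorted_sort_id properties_for_sort strict_sorted_iff)
        have "\<pi> i = i" for i
        proof (cases "i < ?k")
          case True
          then show ?thesis using * mc lt c by (metis strict_sorted_iff nth_eq_iff_index_eq)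
        qed (use permutes_not_in[OF \<pi>] in auto)
        with mc show "m = c \<and> \<pi> = id" by auto
      qed auto
      finally show ?thesis .
    qed
    have "\<delta> m = (\<Sum>\<pi> | \<pi> permutes {..<?k}. of_int (sign \<pi>) * (\<Prod>i<?k. cf (m ! i) (b (c ! \<pi> i))))"
      using True permutes_in_image[of _ "{..<?k}"]
      by (auto simp: \<delta>_def monomial_form_def intro!: sum.cong prod.cong)
    also have "\<dots> = (\<Sum>\<pi> | \<pi> permutes {..<?k}. if \<pi> = id then (if m = c then 1 else 0) else 0)"
      by (intro sum.cong refl) (auto simp: t)
    also have "\<dots> = (if m = c then 1 else 0)"
      using permutes_id[of "{..<?k}"] by (simp add: finite_permutations)
    finally show ?thesis .
  qed (auto simp: \<delta>_def monomial_form_def)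
  ultimately show ?thesis by (simp add: \<delta>_def)
qed

lemma monomial_form_2: "monomial_form [\<alpha>, \<beta>] [x, y] = \<alpha> x * \<beta> y - \<alpha> y * \<beta> x"
proof -
  have f: "finite {1::nat}" "0 \<notin> {1::nat}" by auto
  have k: "{..<length [\<alpha>, \<beta>]} = insert 0 {1}" by auto
  show ?thesis
    unfolding monomial_form_def k sum_over_permutations_insert[OF f] permutes_sing
    by (simp add: k sign_swap_id lessThan_Suc numeral_2_eq_2)
qed

lemma monomial_form_3:
  "monomial_form [\<alpha>, \<beta>, \<gamma>] [x, y, z] =
     \<alpha> x * (\<beta> y * \<gamma> z - \<beta> z * \<gamma> y) - \<alpha> y * (\<beta> x * \<gamma> z - \<beta> z * \<gamma> x) + \<alpha> z * (\<beta> x * \<gamma> y - \<beta> y * \<gamma> x)"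
proof -
  have f: "finite {1::nat, 2}" "0 \<notin> {1::nat, 2}" "finite {2::nat}" "1 \<notin> {2::nat}" by auto
  have k: "{..<length [\<alpha>, \<beta>, \<gamma>]} = insert 0 (insert 1 {2})" by auto
  show ?thesis
    unfolding monomial_form_def k sum_over_permutations_insert[OF f(1,2)] sum_over_permutations_insert[OF f(3,4)]
      permutes_sing
    by (simp add: sign_swap_id sign_compose permutation_swap_id permutation_compose Transposition.transpose_def
        numeral_eq_Suc lessThan_Suc algebra_simps)
qed

lemma interior_product_monomial_form:
  "v \<rfloor> monomial_form [\<alpha>, \<beta>, \<gamma>] =
    (\<lambda>xs. \<alpha> v * monomial_form [\<beta>, \<gamma>] xs - \<beta> v * monomial_form [\<alpha>, \<gamma>] xs + \<gamma> v * monomial_form [\<alpha>, \<beta>] xs)"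
proof
  fix xs
  show "(v \<rfloor> monomial_form [\<alpha>, \<beta>, \<gamma>]) xs =
    \<alpha> v * monomial_form [\<beta>, \<gamma>] xs - \<beta> v * monomial_form [\<alpha>, \<gamma>] xs + \<gamma> v * monomial_form [\<alpha>, \<beta>] xs"
  proof (cases "length xs = 2")
    case True
    then obtain x y where "xs = [x, y]" by (auto simp: numeral_2_eq_2 length_Suc_conv)
    then show ?thesis by (simp add: interior_product_def monomial_form_2 monomial_form_3 algebra_simps)
  qed (simp add: monomial_form_def interior_product_def)
qed

section \<open>Integer combinations of monomial forms as executable lists\<close>

definition form_of :: "(nat \<Rightarrow> 'v \<Rightarrow> real) \<Rightarrow> (int \<times> nat list) list \<Rightarrow> 'v list \<Rightarrow> real" where
  "form_of cf T xs = (\<Sum>(a, l)\<leftarrow>T. of_int a * monomial_form (map cf l) xs)"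

definition wedge_terms :: "(int \<times> nat list) list \<Rightarrow> (int \<times> nat list) list \<Rightarrow> (int \<times> nat list) list" where
  "wedge_terms S T = concat (map (\<lambda>(a, l). map (\<lambda>(b, m). (a * b, l @ m)) T) S)"

text \<open>The signs +, -, + come from moving the contracted covector to the front, as in
  \<open>interior_product_monomial_form\<close> evaluated at a basis vector.\<close>

fun contract_terms :: "nat \<Rightarrow> (int \<times> nat list) list \<Rightarrow> (int \<times> nat list) list" where
  "contract_terms i ((a, [x, y, z]) # T) =
     (if x = i then [(a, [y, z])] else []) @ (if y = i then [(- a, [x, z])] else []) @
     (if z = i then [(a, [x, y])] else []) @ contract_terms i T"
| "contract_terms i (t # T) = contract_terms i T"
| "contract_terms i [] = []"

text \<open>For increasing c this is the coefficient of the monomial with indices c, hence the value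
  of the form on the basis vectors with these indices.\<close>

definition eval_terms :: "nat list \<Rightarrow> (int \<times> nat list) list \<Rightarrow> int" where
  "eval_terms c T = (\<Sum>(a, l)\<leftarrow>T. if sort l = c then a * insertion_sign l else 0)"

lemma wedge_add_left: "wedge p q (\<lambda>xs. \<alpha> xs + \<beta> xs) \<gamma> = (\<lambda>xs. wedge p q \<alpha> \<gamma> xs + wedge p q \<beta> \<gamma> xs)"
  by (auto simp: wedge_def fun_eq_iff add_divide_distrib[symmetric] sum.distrib[symmetric] algebra_simps)

lemma wedge_add_right: "wedge p q \<gamma> (\<lambda>xs. \<alpha> xs + \<beta> xs) = (\<lambda>xs. wedge p q \<gamma> \<alpha> xs + wedge p q \<gamma> \<beta> xs)"
  by (auto simp: wedge_def fun_eq_iff add_divide_distrib[symmetric] sum.distrib[symmetric] algebra_simps)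

lemma wedge_scale: "wedge p q (\<lambda>xs. a * \<alpha> xs) (\<lambda>xs. b * \<beta> xs) = (\<lambda>xs. a * b * wedge p q \<alpha> \<beta> xs)"
  by (auto simp: wedge_def fun_eq_iff sum_distrib_left algebra_simps)

lemma wedge_zero: "wedge p q (\<lambda>xs. 0) \<beta> = (\<lambda>xs. 0)" "wedge p q \<alpha> (\<lambda>xs. 0) = (\<lambda>xs. 0)"
  by (auto simp: wedge_def fun_eq_iff)

lemma form_of_simps:
  "form_of cf [] = (\<lambda>xs. 0)"
  "form_of cf ((a, l) # T) = (\<lambda>xs. of_int a * monomial_form (map cf l) xs + form_of cf T xs)"
  by (simp_all add: form_of_def fun_eq_iff)

lemma form_of_append: "form_of cf (S @ T) xs = form_of cf S xs + form_of cf T xs"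
  by (simp add: form_of_def)

lemma wedge_form_of:
  assumes "\<forall>(a, l)\<in>set S. length l = p" "\<forall>(a, l)\<in>set T. length l = q"
  shows "wedge p q (form_of cf S) (form_of cf T) = form_of cf (wedge_terms S T)"
proof -
  have 1: "wedge p q (\<lambda>xs. of_int a * monomial_form (map cf l) xs) (form_of cf T) =
      form_of cf (map (\<lambda>(b, m). (a * b, l @ m)) T)" if "length l = p" for a l
    using assms(2)
  proof (induction T)
    case (Cons t T)
    obtain b m where t: "t = (b, m)" by force
    have "wedge p q (\<lambda>xs. of_int a * monomial_form (map cf l) xs) (\<lambda>xs. of_int b * monomial_form (map cf m) xs) =
        (\<lambda>xs. of_int (a * b) * monomial_form (map cf (l @ m)) xs)"
      using that Cons.prems t by (simp add: wedge_scale wedge_monomial_form)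
    then show ?case using Cons by (simp add: t form_of_simps wedge_add_right)
  qed (simp add: form_of_simps wedge_zero)
  show ?thesis using assms(1)
  proof (induction S)
    case (Cons s S)
    obtain a l where s: "s = (a, l)" by force
    show ?case using Cons
      by (simp add: s form_of_simps wedge_add_left 1 wedge_terms_def form_of_append fun_eq_iff)
  qed (simp add: form_of_simps wedge_zero wedge_terms_def)
qed

lemma interior_product_form_of:
  assumes "\<forall>(a, l)\<in>set T. length l = 3 \<and> set l \<subseteq> {..<n}"
    and cf: "\<And>k. k < n \<Longrightarrow> cf k v = (if k = i then 1 else 0)"
  shows "v \<rfloor> form_of cf T = form_of cf (contract_terms i T)"
  using assms(1)
proof (induction T)
  case Nil
  then show ?case by (simp add: form_of_simps interior_product_def)
next
  case (Cons t T)
  obtain a l where t: "t = (a, l)" by force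
  with Cons.prems obtain x y z where l: "l = [x, y, z]" by (auto simp: numeral_3_eq_3 length_Suc_conv)
  have xyz: "x < n" "y < n" "z < n" using Cons.prems t l by auto
  have "v \<rfloor> form_of cf (t # T) = (\<lambda>xs. of_int a * (v \<rfloor> monomial_form (map cf l)) xs + (v \<rfloor> form_of cf T) xs)"
    by (simp add: t form_of_simps interior_product_def)
  then show ?case using Cons xyz
    by (auto simp: t l interior_product_monomial_form form_of_simps form_of_append fun_eq_iff cf algebra_simps)
qed

lemma set_contract_terms: "(a, l) \<in> set (contract_terms i T) \<Longrightarrow> length l = 2"
  by (induction i T rule: contract_terms.induct) (auto split: if_splits)

lemma form_of_basis:
  assumes "\<forall>(a, l)\<in>set T. set l \<subseteq> {..<n}"
    and cf: "\<And>k j. k < n \<Longrightarrow> j < n \<Longrightarrow> cf k (b j) = (if k = j then 1 else 0)"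
    and c: "sorted_wrt (<) c" "set c \<subseteq> {..<n}"
  shows "form_of cf T (map b c) = of_int (eval_terms c T)"
  using assms(1)
proof (induction T)
  case Nil
  then show ?case by (simp add: form_of_simps eval_terms_def)
next
  case (Cons t T)
  obtain a l where t: "t = (a, l)" by force
  have "monomial_form (map cf l) (map b c) = (if sort l = c then of_int (insertion_sign l) else 0)"
    by (rule monomial_form_basis[OF _ c(1)], rule cf) (use Cons.prems t c(2) in auto)
  then show ?case using Cons by (simp add: t form_of_simps eval_terms_def)
qed

text \<open>Replaces the nested sums over permutations of 4 and 7 letters by integer arithmetic on
  lists of terms.\<close>

lemma reduced_7form_form_of:
  assumes T: "\<forall>(a, l)\<in>set T. length l = 3 \<and> set l \<subseteq> {..<n}"
    and cf: "\<And>k j. k < n \<Longrightarrow> j < n \<Longrightarrow> cf k (b j) = (if k = j then 1 else 0)"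
    and ij: "i < n" "j < n" and c: "sorted_wrt (<) c" "set c \<subseteq> {..<n}"
  shows "reduced_7form (form_of cf T) (b i) (b j) (map b c) =
    of_int (eval_terms c (wedge_terms (wedge_terms (contract_terms i T) (contract_terms j T)) T))"
proof -
  let ?ci = "contract_terms i T" and ?cj = "contract_terms j T"
  let ?W = "wedge_terms (wedge_terms ?ci ?cj) T"
  have int: "b i \<rfloor> form_of cf T = form_of cf ?ci" "b j \<rfloor> form_of cf T = form_of cf ?cj"
    using ij cf by (auto intro!: interior_product_form_of[OF T])
  have w2: "\<forall>(a, l)\<in>set (wedge_terms ?ci ?cj). length l = 4"
    by (auto simp: wedge_terms_def dest!: set_contract_terms)
  have w: "wedge 4 3 (wedge 2 2 (form_of cf ?ci) (form_of cf ?cj)) (form_of cf T) = form_of cf ?W"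
    using w2 T by (subst wedge_form_of, use set_contract_terms in blast, use set_contract_terms in blast)
      (auto intro!: wedge_form_of)
  have sub: "\<forall>(a, l)\<in>set (contract_terms k T). set l \<subseteq> {..<n}" for k
    using T by (induction k T rule: contract_terms.induct) (auto split: if_splits)
  have "\<forall>(a, l)\<in>set ?W. set l \<subseteq> {..<n}"
    using sub[of i] sub[of j] T by (fastforce simp: wedge_terms_def)
  then show ?thesis unfolding reduced_7form_def int w by (rule form_of_basis[of _ n cf b c]) (assumption | rule cf c)+
qed

section \<open>Forms in coordinates\<close>

text \<open>The index type of \<open>real ^ 'n\<close> carries no order, but the signs of sorted
  index lists need one; an arbitrary enumeration is fixed once.\<close>

definition idx :: "nat \<Rightarrow> 'n::finite" where
  "idx = (SOME f. bij_betw f {..<CARD('n)} UNIV)"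

lemma bij_betw_idx: "bij_betw (idx :: nat \<Rightarrow> 'n::finite) {..<CARD('n)} UNIV"
proof -
  have "\<exists>f :: nat \<Rightarrow> 'n. bij_betw f {..<CARD('n)} UNIV"
    using ex_bij_betw_nat_finite[of "UNIV :: 'n set"] by (auto simp: lessThan_atLeast0)
  then show ?thesis unfolding idx_def by (rule someI_ex)
qed

definition pos :: "'n::finite \<Rightarrow> nat" where
  "pos = inv_into {..<CARD('n)} idx"

lemma pos_less [simp]: "pos (p :: 'n::finite) < CARD('n)"
  using bij_betw_inv_into[OF bij_betw_idx] unfolding pos_def by (auto simp: bij_betw_def)

lemma idx_pos [simp]: "idx (pos p) = p"
  unfolding pos_def by (rule bij_betw_inv_into_right[OF bij_betw_idx]) simp

lemma pos_idx [simp]: "i < CARD('n) \<Longrightarrow> pos (idx i :: 'n::finite) = i"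
  unfolding pos_def by (rule bij_betw_inv_into_left[OF bij_betw_idx]) simp

lemma idx_eq_iff: "i < CARD('n) \<Longrightarrow> j < CARD('n) \<Longrightarrow> (idx i :: 'n::finite) = idx j \<longleftrightarrow> i = j"
  by (metis pos_idx)

lemma sum_UNIV_idx: "(\<Sum>p\<in>UNIV. f p) = (\<Sum>i<CARD('n). f (idx i :: 'n::finite))"
  using sum.reindex_bij_betw[OF bij_betw_idx, of f] by simp

definition eb :: "nat \<Rightarrow> real ^ 'n" where
  "eb i = axis (idx i) 1"

definition cf :: "nat \<Rightarrow> real ^ 'n \<Rightarrow> real" where
  "cf i x = x $ idx i"

lemma cf_eb: "i < CARD('n) \<Longrightarrow> j < CARD('n) \<Longrightarrow> cf i (eb j :: real ^ 'n::finite) = (if i = j then 1 else 0)"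
  by (simp add: cf_def eb_def axis_def idx_eq_iff)

lemma eb_expansion: "x = (\<Sum>i<CARD('n). cf i x *\<^sub>R (eb i :: real ^ 'n::finite))"
proof -
  have "x = (\<Sum>p\<in>UNIV. x $ p *\<^sub>R axis p 1)"
    by (simp add: basis_expansion scalar_mult_eq_scaleR[symmetric])
  then show ?thesis by (simp add: sum_UNIV_idx cf_def eb_def)
qed

lemma alt_forms_UNIV_eqI:
  fixes \<omega> \<eta> :: "(real ^ 'n::finite) list \<Rightarrow> real"
  assumes "\<omega> \<in> alt_forms k UNIV" "\<eta> \<in> alt_forms k UNIV"
    and "\<And>l. sorted_wrt (<) l \<Longrightarrow> set l \<subseteq> {..<CARD('n)} \<Longrightarrow> length l = k \<Longrightarrow> \<omega> (map eb l) = \<eta> (map eb l)"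
  shows "\<omega> = \<eta>"
proof (rule alt_forms_eqI[where b = eb and n = "CARD('n)", OF subspace_UNIV UNIV_I _ assms])
  show "\<exists>c. x = (\<Sum>i<CARD('n). c i *\<^sub>R eb i)" for x :: "real ^ 'n"
    using eb_expansion[of x] by (intro exI)
qed

subsection \<open>The volume form\<close>

definition volume_form :: "(real ^ 'n::finite) list \<Rightarrow> real" where
  "volume_form xs = (if length xs = CARD('n) then det (\<chi> p. xs ! pos p) else 0)"

lemma volume_form_alt_forms: "volume_form \<in> alt_forms CARD('n) (UNIV :: (real ^ 'n::finite) set)"
  unfolding alt_forms_def mem_Collect_eq
proof (intro conjI allI impI)
  fix xs :: "(real ^ 'n) list" assume "length xs \<noteq> CARD('n) \<or> \<not> set xs \<subseteq> UNIV"
  then show "volume_form xs = 0" by (auto simp: volume_form_def)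
next
  fix xs :: "(real ^ 'n) list" and i :: nat and x y :: "real ^ 'n" and a :: real
  assume *: "length xs = CARD('n) \<and> set xs \<subseteq> UNIV \<and> i < CARD('n) \<and> x \<in> UNIV \<and> y \<in> UNIV"
  have u: "(\<chi> p :: 'n. xs[i := z] ! pos p) = (\<chi> p. if p = idx i then z else xs ! pos p)" for z
  proof -
    have "i = pos p \<longleftrightarrow> p = idx i" for p :: 'n using * by auto
    then have "xs[i := z] ! pos p = (if p = idx i then z else xs ! pos p)" for p :: 'n
      using * by (cases "p = idx i") auto
    then show ?thesis by simp
  qed
  have sm: "a *s x = a *\<^sub>R x" by (simp add: vec_eq_iff)
  show "volume_form (xs[i := a *\<^sub>R x + y]) = a * volume_form (xs[i := x]) + volume_form (xs[i := y])"
    using * det_row_add[of "idx i" "\<lambda>_. a *\<^sub>R x" "\<lambda>_. y" "\<lambda>p. xs ! pos p"]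
      det_row_mul[of "idx i" a "\<lambda>_. x" "\<lambda>p. xs ! pos p", unfolded sm]
    by (simp add: volume_form_def u)
next
  fix xs :: "(real ^ 'n) list" and i j :: nat
  assume *: "length xs = CARD('n) \<and> i < j \<and> j < CARD('n) \<and> xs ! i = xs ! j"
  have "det (\<chi> p. xs ! pos p) = 0"
    by (rule det_identical_rows[of "idx i :: 'n" "idx j"]) (use * in \<open>auto simp: row_def idx_eq_iff\<close>)
  then show "volume_form xs = 0" by (simp add: volume_form_def)
qed

lemma volume_form_basis: "volume_form (map eb [0..<CARD('n)] :: (real ^ 'n::finite) list) = 1"
proof -
  have "(\<chi> p. map eb [0..<CARD('n)] ! pos p) = (mat 1 :: real ^ 'n ^ 'n)"
    by (auto simp: vec_eq_iff mat_def eb_def axis_def)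
  then show ?thesis by (simp add: volume_form_def)
qed

lemma volume_form_map: "volume_form (map ((*v) g) xs) = det g * volume_form (xs :: (real ^ 'n::finite) list)"
proof (cases "length xs = CARD('n)")
  case True
  have "(\<chi> p :: 'n. map ((*v) g) xs ! pos p) = (\<chi> p. xs ! pos p) ** Finite_Cartesian_Product.transpose g"
    using True by (simp add: vec_eq_iff matrix_vector_mult_def matrix_matrix_mult_def
        Finite_Cartesian_Product.transpose_def mult.commute)
  then show ?thesis using True by (simp add: volume_form_def det_mul det_transpose)
qed (simp add: volume_form_def)

text \<open>The only increasing list of n indices below n is the full one, so a top form is
  determined by a single value.\<close>

lemma top_form_eq_volume_form:
  assumes "\<omega> \<in> alt_forms CARD('n) (UNIV :: (real ^ 'n::finite) set)"
  shows "\<omega> xs = \<omega> (map eb [0..<CARD('n)]) * volume_form xs"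
proof -
  let ?c = "\<omega> (map eb [0..<CARD('n)])"
  have "(\<lambda>xs. ?c * volume_form xs + 0 * volume_form xs) \<in> alt_forms CARD('n) (UNIV :: (real ^ 'n) set)"
    by (rule alt_forms_comb[OF volume_form_alt_forms volume_form_alt_forms])
  then have v: "(\<lambda>xs. ?c * volume_form xs) \<in> alt_forms CARD('n) (UNIV :: (real ^ 'n) set)" by simp
  have "\<omega> = (\<lambda>xs. ?c * volume_form xs)"
  proof (rule alt_forms_UNIV_eqI[OF assms v])
    fix l assume l: "sorted_wrt (<) l" "set l \<subseteq> {..<CARD('n)}" "length l = CARD('n)"
    then have "set l = {..<CARD('n)}"
      by (metis card_subset_eq card_lessThan distinct_card finite_lessThan strict_sorted_iff)
    then have "l = [0..<CARD('n)]"
      using l by (intro sorted_distinct_set_unique) (auto simp: strict_sorted_iff lessThan_atLeast0)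
    then show "\<omega> (map eb l) = ?c * volume_form (map eb l :: (real ^ 'n) list)" by (simp add: volume_form_basis)
  qed
  then show ?thesis by (rule fun_cong)
qed

definition omit :: "nat \<Rightarrow> nat \<Rightarrow> nat list" where
  "omit n m = filter (\<lambda>i. i \<noteq> m) [0..<n]"

lemma omit_props: "sorted_wrt (<) (omit n m)" "set (omit n m) = {..<n} - {m}"
  "m < n \<Longrightarrow> length (omit n m) = n - 1"
proof -
  show s: "sorted_wrt (<) (omit n m)" unfolding omit_def by (intro sorted_wrt_filter) simp
  show *: "set (omit n m) = {..<n} - {m}" by (auto simp: omit_def)
  show "length (omit n m) = n - 1" if "m < n"
    using s * that by (metis card_Diff_singleton card_lessThan distinct_card lessThan_iff strict_sorted_iff)
qed

lemma insertion_sign_sorted: "sorted_wrt (<) l \<Longrightarrow> insertion_sign l = 1"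
proof (induction l)
  case (Cons x l)
  then have "filter (\<lambda>y. y < x) l = []" by (auto simp: filter_empty_conv)
  with Cons show ?case by simp
qed simp

text \<open>For p = m, the vector \<open>eb m\<close> has to pass the m basis vectors with smaller
  index; otherwise an argument is repeated.\<close>

lemma volume_form_omit:
  assumes m: "m < CARD('n)" and p: "p < CARD('n)"
  shows "volume_form (eb p # map eb (omit CARD('n) m) :: (real ^ 'n::finite) list) = (if p = m then (-1) ^ m else 0)"
proof (cases "p = m")
  case False
  then have "p \<in> set (omit CARD('n) m)" using p by (simp add: omit_props)
  then obtain us ws where "omit CARD('n) m = us @ p # ws" by (meson split_list)
  then show ?thesis using alt_forms_repeat[OF volume_form_alt_forms, of "[]" "eb p :: real ^ 'n" "map eb us" "map eb ws"] False
    by simp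
next
  case True
  let ?l = "omit CARD('n) m"
  have "volume_form (map eb (m # ?l) :: (real ^ 'n) list) =
      insertion_sign (m # ?l) * volume_form (map eb (sort (m # ?l)) :: (real ^ 'n) list)"
    by (rule sort_sign[where \<delta> = "\<lambda>l. volume_form (map eb l :: (real ^ 'n) list)"])
       (simp only: map_append list.map, rule alt_forms_swap[OF volume_form_alt_forms subspace_UNIV])
  moreover have "sort (m # ?l) = [0..<CARD('n)]"
  proof (rule sorted_distinct_set_unique)
    have "distinct ?l" using omit_props(1) strict_sorted_iff by blast
    then show "distinct (sort (m # ?l))" unfolding distinct_sort by (simp add: omit_props(2))
    show "set (sort (m # ?l)) = set [0..<CARD('n)]"
      unfolding set_sort using m by (auto simp: omit_props(2))
  qed (simp_all only: sorted_sort sorted_upt distinct_upt)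
  moreover have "length (filter (\<lambda>y. y < m) ?l) = m"
  proof -
    have "distinct ?l" using omit_props(1) strict_sorted_iff by blast
    then have "length (filter (\<lambda>y. y < m) ?l) = card (set (filter (\<lambda>y. y < m) ?l))"
      by (intro distinct_card[symmetric] distinct_filter)
    also have "set (filter (\<lambda>y. y < m) ?l) = {..<m}" using m by (auto simp: omit_props)
    finally show ?thesis by simp
  qed
  ultimately show ?thesis using True by (simp add: volume_form_basis insertion_sign_sorted[OF omit_props(1)])
qed

subsection \<open>Tensors of degree 3\<close>

text \<open>Alternating tensors do not form a type of their own. The space of all arrays is a
  Euclidean space, so polynomial functions, derivatives and the inverse function theorem apply to
  it, and \<open>alternating\<close> stays a linear condition.\<close>

type_synonym 'n tensor = "real ^ ('n \<times> 'n \<times> 'n)"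

definition tform :: "'n::finite tensor \<Rightarrow> (real ^ 'n) list \<Rightarrow> real" where
  "tform T xs = (if length xs = 3
     then \<Sum>i\<in>UNIV. \<Sum>j\<in>UNIV. \<Sum>k\<in>UNIV. T $ (i, j, k) * (xs ! 0 $ i) * (xs ! 1 $ j) * (xs ! 2 $ k) else 0)"

definition tensor_of :: "((real ^ 'n) list \<Rightarrow> real) \<Rightarrow> 'n::finite tensor" where
  "tensor_of \<omega> = (\<chi> p. case p of (i, j, k) \<Rightarrow> \<omega> [axis i 1, axis j 1, axis k 1])"

definition alternating :: "'n::finite tensor \<Rightarrow> bool" where
  "alternating T \<longleftrightarrow> (\<forall>i j k. T $ (j, i, k) = - T $ (i, j, k) \<and> T $ (i, k, j) = - T $ (i, j, k))"

lemma tensor_of_nth [simp]: "tensor_of \<omega> $ (i, j, k) = \<omega> [axis i 1, axis j 1, axis k 1]"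
  by (simp add: tensor_of_def)

lemma tform_linear1: "tform T [a *\<^sub>R x + x', y, z] = a * tform T [x, y, z] + tform T [x', y, z]"
  by (simp add: tform_def sum.distrib sum_distrib_left algebra_simps)

lemma tform_linear2: "tform T [x, a *\<^sub>R y + y', z] = a * tform T [x, y, z] + tform T [x, y', z]"
  by (simp add: tform_def sum.distrib sum_distrib_left algebra_simps)

lemma tform_linear3: "tform T [x, y, a *\<^sub>R z + z'] = a * tform T [x, y, z] + tform T [x, y, z']"
  by (simp add: tform_def sum.distrib sum_distrib_left algebra_simps)

lemma linear_tform:
  "linear (\<lambda>x. tform T [x, y, z])" "linear (\<lambda>y. tform T [x, y, z])" "linear (\<lambda>z. tform T [x, y, z])"
  using tform_linear1[of T 1] tform_linear1[of T _ _ 0] tform_linear2[of T _ 1] tform_linear2[of T _ _ _ 0]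
    tform_linear3[of T _ _ 1] tform_linear3[of T _ _ _ _ 0]
  by (auto intro!: linearI simp: tform_def sum_distrib_left algebra_simps sum.distrib)

lemma tform_axis: "tform T [axis i 1, axis j 1, axis k 1] = T $ (i, j, k)"
  by (simp add: tform_def axis_def if_distrib[where f = "\<lambda>x. _ * x"] cong: if_cong)

lemma tensor_of_tform: "tensor_of (tform T) = T"
  by (simp add: vec_eq_iff split_paired_all tform_axis)

lemma alternating_tform:
  assumes "alternating T"
  shows "tform T [y, x, z] = - tform T [x, y, z]" "tform T [x, z, y] = - tform T [x, y, z]"
proof -
  have *: "T $ (j, i, k) = - T $ (i, j, k)" "T $ (i, k, j) = - T $ (i, j, k)" for i j k
    using assms unfolding alternating_def by blast+
  have "tform T [y, x, z] = (\<Sum>j\<in>UNIV. \<Sum>i\<in>UNIV. \<Sum>k\<in>UNIV. T $ (j, i, k) * y $ j * x $ i * z $ k)"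
    by (simp add: tform_def)
  also have "\<dots> = (\<Sum>i\<in>UNIV. \<Sum>j\<in>UNIV. \<Sum>k\<in>UNIV. - (T $ (i, j, k) * x $ i * y $ j * z $ k))"
    by (subst sum.swap) (intro sum.cong refl, subst *(1), simp add: mult.commute mult.left_commute)
  finally show "tform T [y, x, z] = - tform T [x, y, z]" by (simp add: tform_def sum_negf)
  have "tform T [x, z, y] = (\<Sum>i\<in>UNIV. \<Sum>k\<in>UNIV. \<Sum>j\<in>UNIV. T $ (i, k, j) * x $ i * z $ k * y $ j)"
    by (simp add: tform_def)
  also have "\<dots> = (\<Sum>i\<in>UNIV. \<Sum>j\<in>UNIV. \<Sum>k\<in>UNIV. - (T $ (i, j, k) * x $ i * y $ j * z $ k))"
    by (rule sum.cong[OF refl], subst sum.swap) (intro sum.cong refl, subst *(2), simp add: mult.commute mult.left_commute)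
  finally show "tform T [x, z, y] = - tform T [x, y, z]" by (simp add: tform_def sum_negf)
qed

lemma length_3E: "length xs = 3 \<Longrightarrow> (\<And>x y z. xs = [x, y, z] \<Longrightarrow> P) \<Longrightarrow> P"
  by (auto simp: numeral_3_eq_3 length_Suc_conv)

lemma alternating_imp_alt_forms:
  assumes "alternating T"
  shows "tform T \<in> alt_forms 3 UNIV"
  unfolding alt_forms_def mem_Collect_eq
proof (intro conjI allI impI)
  fix xs :: "(real ^ 'a) list" assume "length xs \<noteq> 3 \<or> \<not> set xs \<subseteq> UNIV"
  then show "tform T xs = 0" by (simp add: tform_def)
next
  fix xs :: "(real ^ 'a) list" and i :: nat and x y :: "real ^ 'a" and a :: real
  assume *: "length xs = 3 \<and> set xs \<subseteq> UNIV \<and> i < 3 \<and> x \<in> UNIV \<and> y \<in> UNIV"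
  then obtain u v w where "xs = [u, v, w]" using length_3E by blast
  moreover have "i = 0 \<or> i = 1 \<or> i = 2" using * by auto
  ultimately show "tform T (xs[i := a *\<^sub>R x + y]) = a * tform T (xs[i := x]) + tform T (xs[i := y])"
    by (auto simp: tform_linear1 tform_linear2 tform_linear3)
next
  fix xs :: "(real ^ 'a) list" and i j :: nat
  assume *: "length xs = 3 \<and> i < j \<and> j < 3 \<and> xs ! i = xs ! j"
  then obtain u v w where xs: "xs = [u, v, w]" using length_3E by blast
  have r: "tform T [u, u, w] = 0" "tform T [u, v, v] = 0" "tform T [u, v, u] = 0" for u v w
    using alternating_tform[OF assms, of u u w] alternating_tform[OF assms, of u v v]
      alternating_tform[OF assms, of u u v] by auto
  have "i = 0 \<and> j = 1 \<or> i = 0 \<and> j = 2 \<or> i = 1 \<and> j = 2" using * by auto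
  then show "tform T xs = 0" using * by (auto simp: xs r)
qed

lemma alt_forms_tensor_of:
  assumes "\<omega> \<in> alt_forms 3 UNIV"
  shows "alternating (tensor_of \<omega>)" "tform (tensor_of \<omega>) = \<omega>"
proof -
  show a: "alternating (tensor_of \<omega>)"
    unfolding alternating_def tensor_of_nth
  proof (intro allI conjI)
    fix i j k :: 'a
    show "\<omega> [axis j 1, axis i 1, axis k 1] = - \<omega> [axis i 1, axis j 1, axis k 1]"
      using alt_forms_swap[OF assms subspace_UNIV, of "[]" "axis j 1" "axis i 1" "[axis k 1]"] by simp
    show "\<omega> [axis i 1, axis k 1, axis j 1] = - \<omega> [axis i 1, axis j 1, axis k 1]"
      using alt_forms_swap[OF assms subspace_UNIV, of "[axis i 1]" "axis k 1" "axis j 1" "[]"] by simp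
  qed
  show "tform (tensor_of \<omega>) = \<omega>"
  proof (rule alt_forms_UNIV_eqI[OF alternating_imp_alt_forms[OF a] assms])
    fix l :: "nat list" assume "length l = 3"
    then obtain i j k where "l = [i, j, k]" using length_3E by blast
    then show "tform (tensor_of \<omega>) (map eb l) = \<omega> (map eb l)"
      by (simp add: eb_def tform_axis)
  qed
qed

definition pb :: "real ^ 'n ^ 'n \<Rightarrow> 'n tensor \<Rightarrow> 'n::finite tensor" where
  "pb g T = (\<chi> p. case p of (i, j, k) \<Rightarrow> tform T [g *v axis i 1, g *v axis j 1, g *v axis k 1])"

lemma tform_map_alt_forms:
  fixes f :: "'b::real_vector \<Rightarrow> real ^ 'n::finite"
  assumes "alternating T" "linear f"
  shows "(\<lambda>xs. tform T (map f xs)) \<in> alt_forms 3 UNIV"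
  unfolding alt_forms_def mem_Collect_eq
proof (intro conjI allI impI)
  note T = alternating_imp_alt_forms[OF assms(1)]
  fix xs :: "'b list" and i j :: nat assume "length xs = 3 \<and> i < j \<and> j < 3 \<and> xs ! i = xs ! j"
  then show "tform T (map f xs) = 0" using alt_forms_eq_zero[OF T, of "map f xs" i j] by simp
next
  note T = alternating_imp_alt_forms[OF assms(1)]
  fix xs :: "'b list" and i :: nat and x y :: 'b and a :: real assume "length xs = 3 \<and> set xs \<subseteq> UNIV \<and> i < 3 \<and> x \<in> UNIV \<and> y \<in> UNIV"
  then show "tform T (map f (xs[i := a *\<^sub>R x + y])) = a * tform T (map f (xs[i := x])) + tform T (map f (xs[i := y]))"
    using alt_forms_update[OF T, of "map f xs" i "f x" "f y" a] assms(2)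
    by (simp add: map_update linear_add linear_scale)
qed (simp add: tform_def)

lemma
  assumes "alternating T"
  shows alternating_pb: "alternating (pb g T)"
    and tform_pb: "tform (pb g T) xs = tform T (map ((*v) g) xs)"
proof -
  have *: "(\<lambda>xs. tform T (map ((*v) g) xs)) \<in> alt_forms 3 UNIV"
    by (rule tform_map_alt_forms[OF assms matrix_vector_mul_linear])
  have "pb g T = tensor_of (\<lambda>xs. tform T (map ((*v) g) xs))"
    by (simp add: vec_eq_iff split_paired_all pb_def)
  then show "alternating (pb g T)" "tform (pb g T) xs = tform T (map ((*v) g) xs)"
    using alt_forms_tensor_of[OF *] by auto
qed

lemma tform_eqI: "(\<And>x y z. tform S [x, y, z] = tform T [x, y, z]) \<Longrightarrow> S = T"
proof -
  assume *: "\<And>x y z. tform S [x, y, z] = tform T [x, y, z]"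
  have "S $ (i, j, k) = T $ (i, j, k)" for i j k
    using *[of "axis i 1" "axis j 1" "axis k 1"] by (simp add: tform_axis)
  then show "S = T" by (simp add: vec_eq_iff split_paired_all)
qed

lemma pb_pb: "alternating T \<Longrightarrow> pb g (pb h T) = pb (h ** g) T"
  by (rule tform_eqI) (simp add: tform_pb alternating_pb matrix_vector_mul_assoc)

lemma pb_mat_1: "pb (mat 1) T = T"
  by (simp add: pb_def vec_eq_iff split_paired_all tform_axis)

section \<open>The reduced bilinear form in coordinates\<close>

text \<open>The vector whose contraction with \<open>volume_form\<close> is the reduced 7-form; the
  sign undoes the one in \<open>volume_form_omit\<close>.\<close>

definition S8 :: "'n::finite tensor \<Rightarrow> real ^ 'n \<Rightarrow> real ^ 'n \<Rightarrow> real ^ 'n" where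
  "S8 T x y = (\<chi> p. (-1) ^ pos p * reduced_7form (tform T) x y (map eb (omit CARD('n) (pos p))))"

text \<open>The reduced form for the n-vector that takes the value 1 on \<open>volume_form\<close>;
  see \<open>reduced_form_eq\<close>.\<close>

definition Bf :: "'n::finite tensor \<Rightarrow> real ^ 'n \<Rightarrow> real ^ 'n \<Rightarrow> real" where
  "Bf T x y = (if CARD('n) = 7 then reduced_7form (tform T) x y (map eb [0..<CARD('n)])
     else trace (matrix (S8 T x) ** matrix (S8 T y)))"

text \<open>The number of factors \<open>\<rho>\<close> in the reduced form, hence also the power of
  \<open>det g\<close> by which \<open>Bf\<close> changes under pullback.\<close>

definition weight :: "'n::finite itself \<Rightarrow> nat" where
  "weight _ = (if CARD('n) = 7 then 1 else 2)"

lemma interior_product_tform: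
  "(a *\<^sub>R v + v') \<rfloor> tform T = (\<lambda>xs. a * (v \<rfloor> tform T) xs + (v' \<rfloor> tform T) xs)"
proof
  fix xs
  show "((a *\<^sub>R v + v') \<rfloor> tform T) xs = a * (v \<rfloor> tform T) xs + (v' \<rfloor> tform T) xs"
  proof (cases "length xs = 2")
    case True
    then obtain x y where "xs = [x, y]" by (auto simp: numeral_2_eq_2 length_Suc_conv)
    then show ?thesis by (simp add: interior_product_def tform_linear1)
  qed (simp add: interior_product_def tform_def)
qed

lemma wedge_linear_left:
  "wedge p q (\<lambda>xs. a * \<alpha> xs + \<beta> xs) \<gamma> = (\<lambda>xs. a * wedge p q \<alpha> \<gamma> xs + wedge p q \<beta> \<gamma> xs)"
  using wedge_add_left[of p q "\<lambda>xs. a * \<alpha> xs" \<beta> \<gamma>] wedge_scale[of p q a \<alpha> 1 \<gamma>] by simp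

lemma wedge_linear_right:
  "wedge p q \<gamma> (\<lambda>xs. a * \<alpha> xs + \<beta> xs) = (\<lambda>xs. a * wedge p q \<gamma> \<alpha> xs + wedge p q \<gamma> \<beta> xs)"
  using wedge_add_right[of p q \<gamma> "\<lambda>xs. a * \<alpha> xs" \<beta>] wedge_scale[of p q 1 \<gamma> a \<alpha>] by simp

lemma reduced_7form_linear:
  "reduced_7form (tform T) (a *\<^sub>R v + v') w xs =
     a * reduced_7form (tform T) v w xs + reduced_7form (tform T) v' w xs"
  "reduced_7form (tform T) w (a *\<^sub>R v + v') xs =
     a * reduced_7form (tform T) w v xs + reduced_7form (tform T) w v' xs"
  by (simp_all add: reduced_7form_def interior_product_tform wedge_linear_left wedge_linear_right)

lemma linearI_combination:
  fixes f :: "'a::real_vector \<Rightarrow> 'b::real_vector"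
  assumes "\<And>a x y. f (a *\<^sub>R x + y) = a *\<^sub>R f x + f y"
  shows "linear f"
proof -
  have 0: "f 0 = 0" using assms[of 1 0 0] by simp
  show ?thesis
    using assms[of 1] assms[of _ _ 0] 0 by (intro linearI) simp_all
qed

lemma linear_S8: "linear (S8 T x)" "linear (\<lambda>x. S8 T x y)"
  by (rule linearI_combination, simp add: vec_eq_iff S8_def reduced_7form_linear distrib_left mult.left_commute)+

lemma matrix_linear_combination:
  "matrix (\<lambda>x. a *\<^sub>R f x + g x) = a *\<^sub>R matrix f + matrix g"
  by (simp add: matrix_def vec_eq_iff)

lemma trace_linear: "trace (a *\<^sub>R M + N) = a * trace M + trace (N :: real ^ 'n ^ 'n)"
  by (simp add: trace_def sum.distrib sum_distrib_left)

lemma S8_combination: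
  "S8 T (a *\<^sub>R x + y) = (\<lambda>z. a *\<^sub>R S8 T x z + S8 T y z)"
  by (auto simp: fun_eq_iff vec_eq_iff S8_def reduced_7form_linear distrib_left mult.left_commute)

lemma linear_Bf: "linear (Bf T x)" "linear (\<lambda>x. Bf T x y)"
proof -
  have 1: "(a *\<^sub>R M + N) ** P = a *\<^sub>R (M ** P) + N ** P" "P ** (a *\<^sub>R M + N) = a *\<^sub>R (P ** M) + P ** N"
    for a and M N P :: "real ^ 'a ^ 'a"
    by (simp_all add: matrix_matrix_mult_def vec_eq_iff sum.distrib sum_distrib_left algebra_simps)
  show "linear (Bf T x)" "linear (\<lambda>x. Bf T x y)"
    by (rule linearI_combination,
        simp add: Bf_def reduced_7form_linear S8_combination matrix_linear_combination 1 trace_linear)+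
qed

subsection \<open>Polynomial dependence on the form\<close>

lemma real_polynomial_function_nth: "real_polynomial_function (\<lambda>T :: real ^ 'k. T $ i)"
  by (intro real_polynomial_function.intros(1) bounded_linear_vec_nth)

lemma real_polynomial_function_tform: "real_polynomial_function (\<lambda>T. tform T xs)"
proof (cases "length xs = 3")
  case True
  then show ?thesis unfolding tform_def
    by (simp only: if_True simp_thms)
       (intro real_polynomial_function_sum real_polynomial_function.intros(4) real_polynomial_function_nth
        real_polynomial_function.intros(2) finite)
next
  case False
  then show ?thesis by (simp add: tform_def real_polynomial_function.intros(2))
qed

lemma real_polynomial_function_wedge:
  assumes "\<And>xs. real_polynomial_function (\<lambda>T. \<alpha> T xs)" "\<And>xs. real_polynomial_function (\<lambda>T. \<beta> T xs)"
  shows "real_polynomial_function (\<lambda>T. wedge p q (\<alpha> T) (\<beta> T) xs)"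
proof (cases "length xs = p + q")
  case True
  then show ?thesis unfolding wedge_def
    by (simp only: if_True simp_thms)
       (intro real_polynomial_function_divide real_polynomial_function_sum real_polynomial_function.intros(4)
        real_polynomial_function.intros(2) assms finite_permutations finite_lessThan)
next
  case False
  then show ?thesis by (simp add: wedge_def real_polynomial_function.intros(2))
qed

lemma real_polynomial_function_reduced_7form:
  "real_polynomial_function (\<lambda>T. reduced_7form (tform T) v w xs)"
  unfolding reduced_7form_def interior_product_def
  by (intro real_polynomial_function_wedge real_polynomial_function_tform)

lemma real_polynomial_function_Bf: "real_polynomial_function (\<lambda>T :: 'n::finite tensor. Bf T x y)"
proof (cases "CARD('n) = 7")
  case True
  then show ?thesis by (simp add: Bf_def real_polynomial_function_reduced_7form)
next
  case False
  have S8: "real_polynomial_function (\<lambda>T :: 'n tensor. S8 T u v $ p)" for u v p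
    by (simp add: S8_def) (intro real_polynomial_function.intros(4) real_polynomial_function.intros(2)
        real_polynomial_function_reduced_7form)
  have "real_polynomial_function (\<lambda>T :: 'n tensor. \<Sum>i\<in>UNIV. \<Sum>k\<in>UNIV. S8 T x (axis k 1) $ i * S8 T y (axis i 1) $ k)"
    by (intro real_polynomial_function_sum real_polynomial_function.intros(4) S8 finite)
  with False show ?thesis by (simp add: Bf_def trace_def matrix_matrix_mult_def matrix_def)
qed

subsection \<open>Naturality\<close>

lemma volume_form_omit_Cons:
  assumes m: "m < CARD('n)"
  shows "volume_form (u # map eb (omit CARD('n) m) :: (real ^ 'n::finite) list) = (-1) ^ m * cf m u"
proof -
  let ?l = "map eb (omit CARD('n) m) :: (real ^ 'n) list"
  have "volume_form ([] @ u # ?l) = volume_form ([] @ (\<Sum>i<CARD('n). cf i u *\<^sub>R eb i) # ?l)"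
    using eb_expansion[of u] by simp
  also have "\<dots> = (\<Sum>i<CARD('n). cf i u * volume_form (eb i # ?l))"
    using alt_forms_sum[OF volume_form_alt_forms subspace_UNIV, of "{..<CARD('n)}" "eb :: nat \<Rightarrow> real ^ 'n" "[]" "\<lambda>i. cf i u" ?l]
    by simp
  also have "\<dots> = (\<Sum>i<CARD('n). if i = m then (-1) ^ m * cf m u else 0)"
    using m by (intro sum.cong refl) (auto simp: volume_form_omit)
  finally show ?thesis using m by simp
qed

lemma volume_form_Cons_inject:
  assumes "\<And>xs. volume_form (u # xs) = volume_form (u' # xs)"
  shows "u = (u' :: real ^ 'n::finite)"
proof -
  have "cf (pos p) u = cf (pos p) u'" for p :: 'n
    using volume_form_omit_Cons[of "pos p" u] volume_form_omit_Cons[of "pos p" u']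
      assms[of "map eb (omit CARD('n) (pos p))"] by simp
  then show ?thesis by (simp add: vec_eq_iff cf_def)
qed

text \<open>An increasing list of n - 1 indices omits exactly one index m. On such a list the
  contraction gives the right value because the sign of the m-th component meets the equal sign of
  \<open>volume_form_omit\<close>.\<close>

lemma contraction_volume_form:
  fixes \<omega> :: "(real ^ 'n::finite) list \<Rightarrow> real"
  assumes n: "CARD('n) = Suc k" and \<omega>: "\<omega> \<in> alt_forms k UNIV"
  shows "\<omega> xs = volume_form ((\<chi> p. (-1) ^ pos p * \<omega> (map eb (omit CARD('n) (pos p)))) # xs)"
proof -
  define u :: "real ^ 'n" where "u = (\<chi> p. (-1) ^ pos p * \<omega> (map eb (omit CARD('n) (pos p))))"
  have "volume_form \<in> alt_forms (Suc k) (UNIV :: (real ^ 'n) set)"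
    using volume_form_alt_forms n by metis
  then have u: "u \<rfloor> volume_form \<in> alt_forms k UNIV" by (rule interior_product_alt_forms) simp
  have "\<omega> = u \<rfloor> volume_form"
  proof (rule alt_forms_UNIV_eqI[OF \<omega> u])
    fix l assume l: "sorted_wrt (<) l" "set l \<subseteq> {..<CARD('n)}" "length l = k"
    have "card ({..<CARD('n)} - set l) = 1"
      using l n by (subst card_Diff_subset) (auto simp: distinct_card strict_sorted_iff)
    then obtain m where m: "{..<CARD('n)} - set l = {m}" by (auto simp: card_1_singleton_iff)
    then have "m < CARD('n)" "set l = {..<CARD('n)} - {m}" using l(2) by auto
    then have "l = omit CARD('n) m"
      using l(1) omit_props(1,2)[of "CARD('n)" m]
      by (intro sorted_distinct_set_unique) (auto simp: strict_sorted_iff)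
    then show "\<omega> (map eb l) = (u \<rfloor> volume_form) (map eb l)"
      using volume_form_omit_Cons[OF \<open>m < CARD('n)\<close>, of u] \<open>m < CARD('n)\<close>
      by (simp add: interior_product_def u_def cf_def power_mult_distrib[symmetric] flip: mult.assoc)
  qed
  then have "\<omega> xs = (u \<rfloor> volume_form) xs" by (rule fun_cong)
  then show ?thesis by (simp add: interior_product_def u_def)
qed

lemma volume_form_S8:
  fixes T :: "'n::finite tensor"
  assumes "CARD('n) = 8" "alternating T"
  shows "volume_form (S8 T x y # xs) = reduced_7form (tform T) x y xs"
  unfolding S8_def
  using contraction_volume_form[of 7 "reduced_7form (tform T) x y" xs]
    reduced_7form_alt_forms[OF alternating_imp_alt_forms[OF assms(2)] subspace_UNIV] assms(1) by simp

lemma reduced_7form_pb: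
  assumes "alternating T"
  shows "reduced_7form (tform (pb g T)) x y xs = reduced_7form (tform T) (g *v x) (g *v y) (map ((*v) g) xs)"
proof -
  have "tform (pb g T) = (\<lambda>ys. tform T (map ((*v) g) ys))" using tform_pb[OF assms] by auto
  then show ?thesis by (simp add: reduced_7form_map)
qed

text \<open>Both vectors are tested as first argument of \<open>volume_form\<close>, which
  determines a vector. Moving g through the volume form costs the factor \<open>det g\<close>, while
  the 7-form is natural.\<close>

lemma S8_pb:
  fixes T :: "'n::finite tensor"
  assumes n: "CARD('n) = 8" and T: "alternating T" and g: "det g \<noteq> 0"
  shows "g *v S8 (pb g T) x y = det g *\<^sub>R S8 T (g *v x) (g *v y)"
proof (rule volume_form_Cons_inject)
  fix ys :: "(real ^ 'n) list"
  from g obtain h where h: "g ** h = mat 1" by (metis invertible_det_nz invertible_def)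
  define xs where "xs = map ((*v) h) ys"
  have ys: "map ((*v) g) xs = ys"
    by (simp add: xs_def o_def matrix_vector_mul_assoc h)
  have "volume_form (map ((*v) g) (S8 (pb g T) x y # xs)) = det g * volume_form (S8 (pb g T) x y # xs)"
    by (rule volume_form_map)
  also have "volume_form (S8 (pb g T) x y # xs) = volume_form (S8 T (g *v x) (g *v y) # ys)"
    by (simp only: volume_form_S8[OF n T] volume_form_S8[OF n alternating_pb[OF T]] reduced_7form_pb[OF T] ys)
  also have "det g * volume_form (S8 T (g *v x) (g *v y) # ys) =
      volume_form ((det g *\<^sub>R S8 T (g *v x) (g *v y)) # ys)"
    using alt_forms_scale[OF volume_form_alt_forms UNIV_I subspace_UNIV,
        of "[]" "det g" "S8 T (g *v x) (g *v y)" ys] by (simp only: append_Nil)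
  finally show "volume_form ((g *v S8 (pb g T) x y) # ys) = \<dots>" by (simp add: ys)
qed

text \<open>For n = 7 a top form is multiplied by \<open>det g\<close>. For n = 8 the operator
  \<open>S8 (pb g T) x\<close> is \<open>det g\<close> times the conjugate by g of
  \<open>S8 T (g *v x)\<close>, and the trace of a product of two such operators sees only the
  square of the determinant.\<close>

lemma Bf_pb:
  fixes T :: "'n::finite tensor"
  assumes n: "CARD('n) = 7 \<or> CARD('n) = 8" and T: "alternating T" and g: "det g \<noteq> 0"
  shows "Bf (pb g T) x y = det g ^ weight TYPE('n) * Bf T (g *v x) (g *v y)"
proof (cases "CARD('n) = 7")
  case True
  have "reduced_7form (tform T) (g *v x) (g *v y) \<in> alt_forms CARD('n) UNIV"
    using reduced_7form_alt_forms[OF alternating_imp_alt_forms[OF T] subspace_UNIV] True by simp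
  note h = top_form_eq_volume_form[OF this, of "map ((*v) g) (map eb [0..<CARD('n)])",
      unfolded volume_form_map volume_form_basis]
  show ?thesis
    unfolding Bf_def weight_def if_P[OF True] reduced_7form_pb[OF T] h
    by (simp only: power_one_right mult_1_right mult.commute)
next
  case False
  with n have n8: "CARD('n) = 8" by simp
  from g obtain h where h: "g ** h = mat 1" "h ** g = mat 1" by (metis invertible_det_nz invertible_def)
  note MS = fun_cong[OF matrix_vector_mul(2)[OF linear_S8(1)]]
  have M: "matrix (S8 (pb g T) v) = det g *\<^sub>R (h ** matrix (S8 T (g *v v)) ** g)" for v
  proof -
    have "matrix (S8 (pb g T) v) *v z = (det g *\<^sub>R (h ** matrix (S8 T (g *v v)) ** g)) *v z" for z
    proof -
      have "S8 (pb g T) v z = h *v (g *v S8 (pb g T) v z)" by (simp add: matrix_vector_mul_assoc h)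
      also have "\<dots> = det g *\<^sub>R (h *v (matrix (S8 T (g *v v)) *v (g *v z)))"
        by (simp add: S8_pb[OF n8 T g] matrix_vector_mult_scaleR MS)
      finally show ?thesis
        by (simp add: MS matrix_vector_mul_assoc scaleR_matrix_vector_assoc matrix_mul_assoc)
    qed
    then show ?thesis by (simp add: matrix_eq)
  qed
  have "(det g *\<^sub>R (h ** P ** g)) ** (det g *\<^sub>R (h ** Q ** g)) = (det g)\<^sup>2 *\<^sub>R (h ** (P ** Q ** g))" for P Q :: "real ^ 'n ^ 'n"
  proof -
    have "(det g *\<^sub>R (h ** P ** g)) ** (det g *\<^sub>R (h ** Q ** g)) = (det g)\<^sup>2 *\<^sub>R ((h ** P ** g) ** (h ** Q ** g))"
      by (simp add: matrix_matrix_mult_def[of "_ *\<^sub>R _"] matrix_matrix_mult_def[of "h ** P ** g"] vec_eq_iff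
          sum_distrib_left power2_eq_square mult_ac)
    also have "(h ** P ** g) ** (h ** Q ** g) = h ** P ** (g ** h) ** Q ** g" by (simp add: matrix_mul_assoc)
    finally show ?thesis by (simp add: h matrix_mul_assoc)
  qed
  moreover have "trace (c *\<^sub>R (h ** (P ** g))) = c * trace P" for c and P :: "real ^ 'n ^ 'n"
    using trace_linear[of c "h ** (P ** g)" 0] trace_mul_sym[of h "P ** g"]
    by (simp add: h matrix_mul_assoc[symmetric]) (simp add: trace_def)
  ultimately show ?thesis using False by (simp add: Bf_def weight_def M)
qed

section \<open>Model forms\<close>

text \<open>For n = 7, index 0 spans a line while 1, 2, 3 and 4, 5, 6 span isotropic 3-spaces that
  \<open>Bf\<close> puts in duality, as in Zorn's vector matrices. For n = 8, the indices 0, 1 span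
  a Cartan subalgebra, 2, 3, 4 are root vectors for three roots with sum zero, and 5, 6, 7 belong to
  the opposite roots in the same order.\<close>

definition model_terms :: "nat \<Rightarrow> (int \<times> nat list) list" where
  "model_terms n = (if n = 7 then [(1, [0, 1, 4]), (1, [0, 2, 5]), (1, [0, 3, 6]), (1, [1, 2, 3]), (1, [4, 5, 6])]
     else [(1, [0, 2, 5]), (1, [1, 3, 6]), (-1, [0, 4, 7]), (-1, [1, 4, 7]), (1, [2, 3, 4]), (1, [5, 6, 7])])"

definition model :: "'n::finite tensor" where
  "model = tensor_of (form_of cf (model_terms CARD('n)))"

lemma monomial_form_alt_forms:
  fixes \<alpha> \<beta> \<gamma> :: "'v::real_vector \<Rightarrow> real"
  assumes "linear \<alpha>" "linear \<beta>" "linear \<gamma>"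
  shows "monomial_form [\<alpha>, \<beta>, \<gamma>] \<in> alt_forms 3 UNIV"
  unfolding alt_forms_def mem_Collect_eq
proof (intro conjI allI impI)
  fix xs :: "'v list" assume "length xs \<noteq> 3 \<or> \<not> set xs \<subseteq> UNIV"
  then show "monomial_form [\<alpha>, \<beta>, \<gamma>] xs = 0" by (auto simp: monomial_form_def)
next
  note l = assms[THEN linear_add] assms[THEN linear_scale]
  fix xs :: "'v list" and i :: nat and x y :: 'v and a :: real
  assume *: "length xs = 3 \<and> set xs \<subseteq> UNIV \<and> i < 3 \<and> x \<in> UNIV \<and> y \<in> UNIV"
  then obtain u v w where "xs = [u, v, w]" using length_3E by blast
  moreover have "i = 0 \<or> i = 1 \<or> i = 2" using * by auto
  ultimately show "monomial_form [\<alpha>, \<beta>, \<gamma>] (xs[i := a *\<^sub>R x + y]) =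
      a * monomial_form [\<alpha>, \<beta>, \<gamma>] (xs[i := x]) + monomial_form [\<alpha>, \<beta>, \<gamma>] (xs[i := y])"
    by (elim disjE) (simp_all add: monomial_form_3 l algebra_simps)
next
  fix xs :: "'v list" and i j :: nat
  assume *: "length xs = 3 \<and> i < j \<and> j < 3 \<and> xs ! i = xs ! j"
  then obtain u v w where xs: "xs = [u, v, w]" using length_3E by blast
  have "i = 0 \<and> j = 1 \<or> i = 0 \<and> j = 2 \<or> i = 1 \<and> j = 2" using * by auto
  then show "monomial_form [\<alpha>, \<beta>, \<gamma>] xs = 0" using * by (elim disjE) (simp_all add: xs monomial_form_3 algebra_simps)
qed

lemma linear_cf: "linear (cf i :: real ^ 'n \<Rightarrow> real)"
  by (rule linearI) (simp_all add: cf_def)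

lemma form_of_alt_forms:
  assumes "\<forall>(a, l)\<in>set T. length l = 3"
  shows "form_of (cf :: nat \<Rightarrow> real ^ 'n \<Rightarrow> real) T \<in> alt_forms 3 UNIV"
  using assms
proof (induction T)
  case Nil
  then show ?case by (simp add: form_of_simps alt_forms_def)
next
  case (Cons t T)
  obtain a l where al: "t = (a, l)" by force
  with Cons.prems have "length l = 3" by simp
  then obtain x y z where t: "t = (a, [x, y, z])" using al length_3E by blast
  have "monomial_form (map (cf :: nat \<Rightarrow> real ^ 'n \<Rightarrow> real) [x, y, z]) \<in> alt_forms 3 UNIV"
    by (simp add: monomial_form_alt_forms linear_cf)
  then have "(\<lambda>xs. of_int a * monomial_form (map (cf :: nat \<Rightarrow> real ^ 'n \<Rightarrow> real) [x, y, z]) xs + 1 * form_of cf T xs) \<in> alt_forms 3 UNIV"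
    using Cons by (intro alt_forms_comb) auto
  then show ?case by (simp add: t form_of_simps)
qed

lemma model_terms_props: "\<forall>(a, l)\<in>set (model_terms n). length l = 3"
  "n = 7 \<or> n = 8 \<Longrightarrow> \<forall>(a, l)\<in>set (model_terms n). length l = 3 \<and> set l \<subseteq> {..<n}"
  by (auto simp: model_terms_def)

lemma
  shows alternating_model: "alternating (model :: 'n::finite tensor)"
    and tform_model: "tform (model :: 'n tensor) = form_of cf (model_terms CARD('n))"
  using alt_forms_tensor_of[OF form_of_alt_forms[OF model_terms_props(1)]] by (auto simp: model_def)

subsection \<open>The reduced form of the model\<close>

definition model_7form :: "nat \<Rightarrow> nat list \<Rightarrow> nat \<Rightarrow> nat \<Rightarrow> int" where
  "model_7form n c i j = (let T = model_terms n in
     eval_terms c (wedge_terms (wedge_terms (contract_terms i T) (contract_terms j T)) T))"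

lemma reduced_7form_model:
  assumes "CARD('n::finite) = 7 \<or> CARD('n) = 8" "i < CARD('n)" "j < CARD('n)"
    and "sorted_wrt (<) c" "set c \<subseteq> {..<CARD('n)}"
  shows "reduced_7form (tform (model :: 'n tensor)) (eb i) (eb j) (map eb c) = of_int (model_7form CARD('n) c i j)"
  unfolding tform_model model_7form_def Let_def
  by (rule reduced_7form_form_of[OF model_terms_props(2)[OF assms(1)] _ assms(2-)]) (rule cf_eb)

text \<open>Terms with a repeated index contribute nothing at a distinct c. Dropping them before the
  second wedge product, and sorting the survivors once for all c, keeps evaluation by rewriting
  feasible.\<close>

definition prune_terms :: "(int \<times> nat list) list \<Rightarrow> (int \<times> nat list) list" where
  "prune_terms T = filter (\<lambda>(a, l). distinct l) T"

definition norm_terms :: "(int \<times> nat list) list \<Rightarrow> (int \<times> nat list) list" where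
  "norm_terms T = map (\<lambda>(a, l). (a * insertion_sign l, sort l)) (prune_terms T)"

definition lookup :: "nat list \<Rightarrow> (int \<times> nat list) list \<Rightarrow> int" where
  "lookup c T = (\<Sum>(a, l)\<leftarrow>T. if l = c then a else 0)"

definition model_7form_terms :: "nat \<Rightarrow> nat \<Rightarrow> nat \<Rightarrow> (int \<times> nat list) list" where
  "model_7form_terms n i j = (let T = model_terms n in
     norm_terms (wedge_terms (prune_terms (wedge_terms (contract_terms i T) (contract_terms j T))) T))"

lemma eval_terms_norm: "distinct c \<Longrightarrow> eval_terms c T = lookup c (norm_terms T)"
  by (induction T) (auto simp: eval_terms_def lookup_def norm_terms_def prune_terms_def)

lemma eval_terms_append: "eval_terms c (S @ T) = eval_terms c S + eval_terms c T"
  by (simp add: eval_terms_def)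

lemma eval_terms_prune:
  assumes "distinct c"
  shows "eval_terms c (wedge_terms (prune_terms S) T) = eval_terms c (wedge_terms S T)"
proof (induction S)
  case (Cons s S)
  obtain a l where s: "s = (a, l)" by force
  have "eval_terms c (map (\<lambda>(b, m). (a * b, l @ m)) T) = 0" if "\<not> distinct l"
    using that assms by (induction T) (auto simp: eval_terms_def)
  then show ?case using Cons by (simp add: s prune_terms_def wedge_terms_def eval_terms_append)
qed (simp add: prune_terms_def)

lemma model_7form_lookup: "distinct c \<Longrightarrow> model_7form n c i j = lookup c (model_7form_terms n i j)"
  by (simp add: model_7form_def model_7form_terms_def Let_def eval_terms_prune eval_terms_norm[symmetric])

lemma model_7form_table:
  "map (\<lambda>i. map (\<lambda>j. lookup [0..<7] (model_7form_terms 7 i j)) [0..<7]) [0..<7] =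
    [[-6, 0, 0, 0, 0, 0, 0], [0, 0, 0, 0, 3, 0, 0], [0, 0, 0, 0, 0, 3, 0], [0, 0, 0, 0, 0, 0, 3], [0, 3, 0, 0, 0, 0, 0], [0, 0, 3, 0, 0, 0, 0], [0, 0, 0, 3, 0, 0, 0]]"
  by code_simp

text \<open>The entry at i, j, m is the coordinate m of \<open>S8 model (eb i) (eb j)\<close>;
  \<open>model_8_table\<close> computes it from the term lists.\<close>

definition table8 :: "int list list list" where
  "table8 = [[[2, 0, 0, 0, 0, 0, 0, 0], [2, -2, 0, 0, 0, 0, 0, 0], [0, 0, 1, 0, 0, 0, 0, 0], [0, 0, 0, -2, 0, 0, 0, 0], [0, 0, 0, 0, 1, 0, 0, 0], [0, 0, 0, 0, 0, 1, 0, 0], [0, 0, 0, 0, 0, 0, -2, 0], [0, 0, 0, 0, 0, 0, 0, 1]],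
    [[2, -2, 0, 0, 0, 0, 0, 0], [0, -2, 0, 0, 0, 0, 0, 0], [0, 0, 2, 0, 0, 0, 0, 0], [0, 0, 0, -1, 0, 0, 0, 0], [0, 0, 0, 0, -1, 0, 0, 0], [0, 0, 0, 0, 0, 2, 0, 0], [0, 0, 0, 0, 0, 0, -1, 0], [0, 0, 0, 0, 0, 0, 0, -1]],
    [[0, 0, 1, 0, 0, 0, 0, 0], [0, 0, 2, 0, 0, 0, 0, 0], [0, 0, 0, 0, 0, 0, 0, 0], [0, 0, 0, 0, 0, 0, 0, 3], [0, 0, 0, 0, 0, 0, 3, 0], [0, -3, 0, 0, 0, 0, 0, 0], [0, 0, 0, 0, 0, 0, 0, 0], [0, 0, 0, 0, 0, 0, 0, 0]],
    [[0, 0, 0, -2, 0, 0, 0, 0], [0, 0, 0, -1, 0, 0, 0, 0], [0, 0, 0, 0, 0, 0, 0, 3], [0, 0, 0, 0, 0, 0, 0, 0], [0, 0, 0, 0, 0, 3, 0, 0], [0, 0, 0, 0, 0, 0, 0, 0], [3, 0, 0, 0, 0, 0, 0, 0], [0, 0, 0, 0, 0, 0, 0, 0]],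
    [[0, 0, 0, 0, 1, 0, 0, 0], [0, 0, 0, 0, -1, 0, 0, 0], [0, 0, 0, 0, 0, 0, 3, 0], [0, 0, 0, 0, 0, 3, 0, 0], [0, 0, 0, 0, 0, 0, 0, 0], [0, 0, 0, 0, 0, 0, 0, 0], [0, 0, 0, 0, 0, 0, 0, 0], [-3, 3, 0, 0, 0, 0, 0, 0]],
    [[0, 0, 0, 0, 0, 1, 0, 0], [0, 0, 0, 0, 0, 2, 0, 0], [0, -3, 0, 0, 0, 0, 0, 0], [0, 0, 0, 0, 0, 0, 0, 0], [0, 0, 0, 0, 0, 0, 0, 0], [0, 0, 0, 0, 0, 0, 0, 0], [0, 0, 0, 0, -3, 0, 0, 0], [0, 0, 0, -3, 0, 0, 0, 0]],
    [[0, 0, 0, 0, 0, 0, -2, 0], [0, 0, 0, 0, 0, 0, -1, 0], [0, 0, 0, 0, 0, 0, 0, 0], [3, 0, 0, 0, 0, 0, 0, 0], [0, 0, 0, 0, 0, 0, 0, 0], [0, 0, 0, 0, -3, 0, 0, 0], [0, 0, 0, 0, 0, 0, 0, 0], [0, 0, -3, 0, 0, 0, 0, 0]],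
    [[0, 0, 0, 0, 0, 0, 0, 1], [0, 0, 0, 0, 0, 0, 0, -1], [0, 0, 0, 0, 0, 0, 0, 0], [0, 0, 0, 0, 0, 0, 0, 0], [-3, 3, 0, 0, 0, 0, 0, 0], [0, 0, 0, -3, 0, 0, 0, 0], [0, 0, -3, 0, 0, 0, 0, 0], [0, 0, 0, 0, 0, 0, 0, 0]]]"

lemma model_8_table:
  "map (\<lambda>i. map (\<lambda>j. let F = model_7form_terms 8 i j in map (\<lambda>m. (-1) ^ m * lookup (omit 8 m) F) [0..<8]) [0..<8]) [0..<8] =
    table8"
  by code_simp

lemma map_upt_nth: "map f [0..<n] = ys \<Longrightarrow> i < n \<Longrightarrow> f i = ys ! i" for n :: nat
  by auto

lemma Bf_model_7:
  assumes n: "CARD('n::finite) = 7" and ij: "i < 7" "j < 7"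
  shows "Bf (model :: 'n tensor) (eb i) (eb j) = of_int ([[-6, 0, 0, 0, 0, 0, 0], [0, 0, 0, 0, 3, 0, 0], [0, 0, 0, 0, 0, 3, 0], [0, 0, 0, 0, 0, 0, 3], [0, 3, 0, 0, 0, 0, 0], [0, 0, 3, 0, 0, 0, 0], [0, 0, 0, 3, 0, 0, 0]] ! i ! j)"
proof -
  have "model_7form 7 [0..<7] i j = [[-6, 0, 0, 0, 0, 0, 0], [0, 0, 0, 0, 3, 0, 0], [0, 0, 0, 0, 0, 3, 0], [0, 0, 0, 0, 0, 0, 3], [0, 3, 0, 0, 0, 0, 0], [0, 0, 3, 0, 0, 0, 0], [0, 0, 0, 3, 0, 0, 0]] ! i ! j"
    using map_upt_nth[OF map_upt_nth[OF model_7form_table ij(1)] ij(2)] by (simp add: model_7form_lookup)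
  then show ?thesis using reduced_7form_model[where 'n = 'n, of i j "[0..<7]"] n ij by (simp add: Bf_def atLeast0LessThan)
qed

lemma S8_model:
  assumes n: "CARD('n::finite) = 8" and ijm: "i < 8" "j < 8" "m < 8"
  shows "S8 (model :: 'n tensor) (eb i) (eb j) $ idx m = of_int (table8 ! i ! j ! m)"
proof -
  have "reduced_7form (tform (model :: 'n tensor)) (eb i) (eb j) (map eb (omit 8 m)) = of_int (model_7form 8 (omit 8 m) i j)"
    using reduced_7form_model[where 'n = 'n, of i j "omit 8 m"] n ijm omit_props[of 8 m] by auto
  moreover have eq: "(-1) ^ m * model_7form 8 (omit 8 m) i j = table8 ! i ! j ! m"
    using map_upt_nth[OF map_upt_nth[OF map_upt_nth[OF model_8_table ijm(1)] ijm(2), unfolded Let_def] ijm(3)]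
      omit_props(1)[of 8 m] by (simp add: model_7form_lookup strict_sorted_iff)
  ultimately show ?thesis using n ijm by (simp add: S8_def flip: eq)
qed

lemma trace_table:
  "map (\<lambda>i. map (\<lambda>j. \<Sum>b\<leftarrow>[0..<8]. \<Sum>a\<leftarrow>[0..<8]. table8 ! i ! a ! b * table8 ! j ! b ! a) [0..<8]) [0..<8] =
    [[20, 10, 0, 0, 0, 0, 0, 0], [10, 20, 0, 0, 0, 0, 0, 0], [0, 0, 0, 0, 0, -30, 0, 0], [0, 0, 0, 0, 0, 0, -30, 0], [0, 0, 0, 0, 0, 0, 0, -30], [0, 0, -30, 0, 0, 0, 0, 0], [0, 0, 0, -30, 0, 0, 0, 0], [0, 0, 0, 0, -30, 0, 0, 0]]"
  by code_simp

lemma Bf_model_8: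
  assumes n: "CARD('n::finite) = 8" and ij: "i < 8" "j < 8"
  shows "Bf (model :: 'n tensor) (eb i) (eb j) = of_int ([[20, 10, 0, 0, 0, 0, 0, 0], [10, 20, 0, 0, 0, 0, 0, 0], [0, 0, 0, 0, 0, -30, 0, 0], [0, 0, 0, 0, 0, 0, -30, 0], [0, 0, 0, 0, 0, 0, 0, -30], [0, 0, -30, 0, 0, 0, 0, 0], [0, 0, 0, -30, 0, 0, 0, 0], [0, 0, 0, 0, -30, 0, 0, 0]] ! i ! j)"
proof -
  have "Bf (model :: 'n tensor) (eb i) (eb j) =
      (\<Sum>k\<in>UNIV. \<Sum>l\<in>UNIV. S8 (model :: 'n tensor) (eb i) (axis l 1) $ k * S8 (model :: 'n tensor) (eb j) (axis k 1) $ l)"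
    using n by (simp add: Bf_def trace_def matrix_matrix_mult_def matrix_def)
  also have "\<dots> = (\<Sum>b<8. \<Sum>a<8. S8 (model :: 'n tensor) (eb i) (eb a) $ idx b * S8 (model :: 'n tensor) (eb j) (eb b) $ idx a)"
    unfolding sum_UNIV_idx n by (simp add: eb_def)
  also have "\<dots> = (\<Sum>b<8. \<Sum>a<8. of_int (table8 ! i ! a ! b) * of_int (table8 ! j ! b ! a))"
    by (intro sum.cong refl) (use n ij in \<open>simp add: S8_model\<close>)
  also have "\<dots> = of_int (\<Sum>b\<leftarrow>[0..<8]. \<Sum>a\<leftarrow>[0..<8]. table8 ! i ! a ! b * table8 ! j ! b ! a)"
    by (simp only: interv_sum_list_conv_sum_set_nat atLeast0LessThan of_int_sum of_int_mult set_upt)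
  also have "(\<Sum>b\<leftarrow>[0..<8]. \<Sum>a\<leftarrow>[0..<8]. table8 ! i ! a ! b * table8 ! j ! b ! a) = [[20, 10, 0, 0, 0, 0, 0, 0], [10, 20, 0, 0, 0, 0, 0, 0], [0, 0, 0, 0, 0, -30, 0, 0], [0, 0, 0, 0, 0, 0, -30, 0], [0, 0, 0, 0, 0, 0, 0, -30], [0, 0, -30, 0, 0, 0, 0, 0], [0, 0, 0, -30, 0, 0, 0, 0], [0, 0, 0, 0, -30, 0, 0, 0]] ! i ! j"
    by (rule map_upt_nth[OF map_upt_nth[OF trace_table ij(1)] ij(2)])
  finally show ?thesis .
qed

subsection \<open>The model algebra\<close>

definition nondegenerate :: "'n::finite tensor \<Rightarrow> bool" where
  "nondegenerate T \<longleftrightarrow> (\<forall>u. (\<forall>z. Bf T u z = 0) \<longrightarrow> u = 0)"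

definition product_of :: "'n::finite tensor \<Rightarrow> (real ^ 'n \<Rightarrow> real ^ 'n \<Rightarrow> real ^ 'n) \<Rightarrow> bool" where
  "product_of T m \<longleftrightarrow> (\<forall>x y z. Bf T (m x y) z = tform T [x, y, z])"

definition malcev_identity :: "('v::real_vector \<Rightarrow> 'v \<Rightarrow> 'v) \<Rightarrow> bool" where
  "malcev_identity m \<longleftrightarrow> (\<forall>x y z. m (m x y) (m x z) =
     m (m (m x y) z) x + m (m (m y z) x) x + m (m (m z x) x) y)"

lemma Bf_eb_expansion:
  "Bf (T :: 'n::finite tensor) u (eb k) = (\<Sum>i<CARD('n). cf i u * Bf T (eb i) (eb k))"
proof -
  have "Bf T (\<Sum>i<CARD('n). cf i u *\<^sub>R eb i) (eb k) = (\<Sum>i<CARD('n). cf i u * Bf T (eb i) (eb k))"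
    by (simp add: linear_sum[OF linear_Bf(2)] linear_scale[OF linear_Bf(2)])
  then show ?thesis using eb_expansion[of u] by simp
qed

lemma lessThan_7: "{..<7 :: nat} = {0, 1, 2, 3, 4, 5, 6}" and lessThan_8: "{..<8 :: nat} = {0, 1, 2, 3, 4, 5, 6, 7}"
  by auto

lemma cf_eqI: "(\<And>k. k < CARD('n) \<Longrightarrow> cf k x = cf k y) \<Longrightarrow> x = (y :: real ^ 'n::finite)"
proof -
  assume *: "\<And>k. k < CARD('n) \<Longrightarrow> cf k x = cf k y"
  have "x $ p = y $ p" for p using *[of "pos p"] by (simp add: cf_def)
  then show "x = y" by (simp add: vec_eq_iff)
qed

lemma Bf_model_7_eb:
  fixes u :: "real ^ 'n::finite"
  assumes "CARD('n) = 7"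
  shows "Bf model u (eb 0) = -6 * cf 0 u"
    "Bf model u (eb 1) = 3 * cf 4 u"
    "Bf model u (eb 2) = 3 * cf 5 u"
    "Bf model u (eb 3) = 3 * cf 6 u"
    "Bf model u (eb 4) = 3 * cf 1 u"
    "Bf model u (eb 5) = 3 * cf 2 u"
    "Bf model u (eb 6) = 3 * cf 3 u"
  by (simp_all add: Bf_eb_expansion[of model u] assms Bf_model_7 lessThan_7)

lemma tform_model_7_eb:
  fixes x y :: "real ^ 'n::finite"
  assumes "CARD('n) = 7"
  shows "tform model [x, y, eb 0] = (cf 1 x * cf 4 y - cf 4 x * cf 1 y) + (cf 2 x * cf 5 y - cf 5 x * cf 2 y) + (cf 3 x * cf 6 y - cf 6 x * cf 3 y)"
    "tform model [x, y, eb 1] = - (cf 0 x * cf 4 y - cf 4 x * cf 0 y) + (cf 2 x * cf 3 y - cf 3 x * cf 2 y)"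
    "tform model [x, y, eb 2] = - (cf 0 x * cf 5 y - cf 5 x * cf 0 y) - (cf 1 x * cf 3 y - cf 3 x * cf 1 y)"
    "tform model [x, y, eb 3] = - (cf 0 x * cf 6 y - cf 6 x * cf 0 y) + (cf 1 x * cf 2 y - cf 2 x * cf 1 y)"
    "tform model [x, y, eb 4] = (cf 0 x * cf 1 y - cf 1 x * cf 0 y) + (cf 5 x * cf 6 y - cf 6 x * cf 5 y)"
    "tform model [x, y, eb 5] = (cf 0 x * cf 2 y - cf 2 x * cf 0 y) - (cf 4 x * cf 6 y - cf 6 x * cf 4 y)"
    "tform model [x, y, eb 6] = (cf 0 x * cf 3 y - cf 3 x * cf 0 y) + (cf 4 x * cf 5 y - cf 5 x * cf 4 y)"
  by (simp_all add: tform_model assms model_terms_def form_of_def monomial_form_3 cf_eb)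

text \<open>The Gram matrix pairs index 0 with itself, with entry -6, and k with k + 3, with entry
  3. Inverting it produces the factors -1/6 and 1/3.\<close>

lemma product_of_model_7:
  fixes x y :: "real ^ 'n::finite"
  assumes n: "CARD('n) = 7" and m: "product_of model m"
  shows "cf 0 (m x y) = (-1 / 6) * ((cf 1 x * cf 4 y - cf 4 x * cf 1 y) + (cf 2 x * cf 5 y - cf 5 x * cf 2 y) + (cf 3 x * cf 6 y - cf 6 x * cf 3 y))"
    "cf 1 (m x y) = (1 / 3) * ((cf 0 x * cf 1 y - cf 1 x * cf 0 y) + (cf 5 x * cf 6 y - cf 6 x * cf 5 y))"
    "cf 2 (m x y) = (1 / 3) * ((cf 0 x * cf 2 y - cf 2 x * cf 0 y) - (cf 4 x * cf 6 y - cf 6 x * cf 4 y))"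
    "cf 3 (m x y) = (1 / 3) * ((cf 0 x * cf 3 y - cf 3 x * cf 0 y) + (cf 4 x * cf 5 y - cf 5 x * cf 4 y))"
    "cf 4 (m x y) = (1 / 3) * (- (cf 0 x * cf 4 y - cf 4 x * cf 0 y) + (cf 2 x * cf 3 y - cf 3 x * cf 2 y))"
    "cf 5 (m x y) = (1 / 3) * (- (cf 0 x * cf 5 y - cf 5 x * cf 0 y) - (cf 1 x * cf 3 y - cf 3 x * cf 1 y))"
    "cf 6 (m x y) = (1 / 3) * (- (cf 0 x * cf 6 y - cf 6 x * cf 0 y) + (cf 1 x * cf 2 y - cf 2 x * cf 1 y))"
proof -
  have "Bf model (m x y) (eb k) = tform model [x, y, eb k]" for k
    using m by (simp add: product_of_def)
  note this[of 0] this[of 1] this[of 2] this[of 3] this[of 4] this[of 5] this[of 6]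
  note e = this[unfolded Bf_model_7_eb[OF n] tform_model_7_eb[OF n]]
  show "cf 0 (m x y) = (-1 / 6) * ((cf 1 x * cf 4 y - cf 4 x * cf 1 y) + (cf 2 x * cf 5 y - cf 5 x * cf 2 y) + (cf 3 x * cf 6 y - cf 6 x * cf 3 y))"
    "cf 1 (m x y) = (1 / 3) * ((cf 0 x * cf 1 y - cf 1 x * cf 0 y) + (cf 5 x * cf 6 y - cf 6 x * cf 5 y))"
    "cf 2 (m x y) = (1 / 3) * ((cf 0 x * cf 2 y - cf 2 x * cf 0 y) - (cf 4 x * cf 6 y - cf 6 x * cf 4 y))"
    "cf 3 (m x y) = (1 / 3) * ((cf 0 x * cf 3 y - cf 3 x * cf 0 y) + (cf 4 x * cf 5 y - cf 5 x * cf 4 y))"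
    "cf 4 (m x y) = (1 / 3) * (- (cf 0 x * cf 4 y - cf 4 x * cf 0 y) + (cf 2 x * cf 3 y - cf 3 x * cf 2 y))"
    "cf 5 (m x y) = (1 / 3) * (- (cf 0 x * cf 5 y - cf 5 x * cf 0 y) - (cf 1 x * cf 3 y - cf 3 x * cf 1 y))"
    "cf 6 (m x y) = (1 / 3) * (- (cf 0 x * cf 6 y - cf 6 x * cf 0 y) + (cf 1 x * cf 2 y - cf 2 x * cf 1 y))"
    using e by (simp_all add: field_simps)
qed

lemma nondegenerate_model_7:
  assumes n: "CARD('n::finite) = 7"
  shows "nondegenerate (model :: 'n tensor)"
  unfolding nondegenerate_def
proof (intro allI impI)
  fix u :: "real ^ 'n" assume "\<forall>z. Bf model u z = 0"
  then have "Bf model u (eb k) = 0" for k by simp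
  note this[of 0] this[of 1] this[of 2] this[of 3] this[of 4] this[of 5] this[of 6]
  note e = this[unfolded Bf_model_7_eb[OF n]]
  have "cf k u = 0" if "k < 7" for k
  proof -
    from that have "k \<in> {..<7}" by simp
    then show ?thesis using e unfolding lessThan_7 by auto
  qed
  then show "u = 0" by (intro cf_eqI) (simp add: n cf_def)
qed

lemma Bf_model_8_eb:
  fixes u :: "real ^ 'n::finite"
  assumes "CARD('n) = 8"
  shows "Bf model u (eb 0) = 20 * cf 0 u + 10 * cf 1 u"
    "Bf model u (eb 1) = 10 * cf 0 u + 20 * cf 1 u"
    "Bf model u (eb 2) = -30 * cf 5 u"
    "Bf model u (eb 3) = -30 * cf 6 u"
    "Bf model u (eb 4) = -30 * cf 7 u"
    "Bf model u (eb 5) = -30 * cf 2 u"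
    "Bf model u (eb 6) = -30 * cf 3 u"
    "Bf model u (eb 7) = -30 * cf 4 u"
  by (simp_all add: Bf_eb_expansion[of model u] assms Bf_model_8 lessThan_8)

lemma tform_model_8_eb:
  fixes x y :: "real ^ 'n::finite"
  assumes "CARD('n) = 8"
  shows "tform model [x, y, eb 0] = (cf 2 x * cf 5 y - cf 5 x * cf 2 y) - (cf 4 x * cf 7 y - cf 7 x * cf 4 y)"
    "tform model [x, y, eb 1] = (cf 3 x * cf 6 y - cf 6 x * cf 3 y) - (cf 4 x * cf 7 y - cf 7 x * cf 4 y)"
    "tform model [x, y, eb 2] = - (cf 0 x * cf 5 y - cf 5 x * cf 0 y) + (cf 3 x * cf 4 y - cf 4 x * cf 3 y)"
    "tform model [x, y, eb 3] = - (cf 1 x * cf 6 y - cf 6 x * cf 1 y) - (cf 2 x * cf 4 y - cf 4 x * cf 2 y)"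
    "tform model [x, y, eb 4] = (cf 0 x * cf 7 y - cf 7 x * cf 0 y) + (cf 1 x * cf 7 y - cf 7 x * cf 1 y) + (cf 2 x * cf 3 y - cf 3 x * cf 2 y)"
    "tform model [x, y, eb 5] = (cf 0 x * cf 2 y - cf 2 x * cf 0 y) + (cf 6 x * cf 7 y - cf 7 x * cf 6 y)"
    "tform model [x, y, eb 6] = (cf 1 x * cf 3 y - cf 3 x * cf 1 y) - (cf 5 x * cf 7 y - cf 7 x * cf 5 y)"
    "tform model [x, y, eb 7] = - (cf 0 x * cf 4 y - cf 4 x * cf 0 y) - (cf 1 x * cf 4 y - cf 4 x * cf 1 y) + (cf 5 x * cf 6 y - cf 6 x * cf 5 y)"
  by (simp_all add: tform_model assms model_terms_def form_of_def monomial_form_3 cf_eb)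

text \<open>On the Cartan indices 0, 1 the Gram block has 20 on and 10 off the diagonal, with
  inverse entries 1/15 and -1/30. The root indices k and k + 3 are paired with entry -30.\<close>

lemma product_of_model_8:
  fixes x y :: "real ^ 'n::finite"
  assumes n: "CARD('n) = 8" and m: "product_of model m"
  shows "cf 0 (m x y) = (1 / 15) * ((cf 2 x * cf 5 y - cf 5 x * cf 2 y) - (cf 4 x * cf 7 y - cf 7 x * cf 4 y)) + (-1 / 30) * ((cf 3 x * cf 6 y - cf 6 x * cf 3 y) - (cf 4 x * cf 7 y - cf 7 x * cf 4 y))"
    "cf 1 (m x y) = (1 / 15) * ((cf 3 x * cf 6 y - cf 6 x * cf 3 y) - (cf 4 x * cf 7 y - cf 7 x * cf 4 y)) + (-1 / 30) * ((cf 2 x * cf 5 y - cf 5 x * cf 2 y) - (cf 4 x * cf 7 y - cf 7 x * cf 4 y))"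
    "cf 2 (m x y) = (-1 / 30) * ((cf 0 x * cf 2 y - cf 2 x * cf 0 y) + (cf 6 x * cf 7 y - cf 7 x * cf 6 y))"
    "cf 3 (m x y) = (-1 / 30) * ((cf 1 x * cf 3 y - cf 3 x * cf 1 y) - (cf 5 x * cf 7 y - cf 7 x * cf 5 y))"
    "cf 4 (m x y) = (-1 / 30) * (- (cf 0 x * cf 4 y - cf 4 x * cf 0 y) - (cf 1 x * cf 4 y - cf 4 x * cf 1 y) + (cf 5 x * cf 6 y - cf 6 x * cf 5 y))"
    "cf 5 (m x y) = (-1 / 30) * (- (cf 0 x * cf 5 y - cf 5 x * cf 0 y) + (cf 3 x * cf 4 y - cf 4 x * cf 3 y))"
    "cf 6 (m x y) = (-1 / 30) * (- (cf 1 x * cf 6 y - cf 6 x * cf 1 y) - (cf 2 x * cf 4 y - cf 4 x * cf 2 y))"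
    "cf 7 (m x y) = (-1 / 30) * ((cf 0 x * cf 7 y - cf 7 x * cf 0 y) + (cf 1 x * cf 7 y - cf 7 x * cf 1 y) + (cf 2 x * cf 3 y - cf 3 x * cf 2 y))"
proof -
  have "Bf model (m x y) (eb k) = tform model [x, y, eb k]" for k
    using m by (simp add: product_of_def)
  note this[of 0] this[of 1] this[of 2] this[of 3] this[of 4] this[of 5] this[of 6] this[of 7]
  note e = this[unfolded Bf_model_8_eb[OF n] tform_model_8_eb[OF n]]
  show "cf 0 (m x y) = (1 / 15) * ((cf 2 x * cf 5 y - cf 5 x * cf 2 y) - (cf 4 x * cf 7 y - cf 7 x * cf 4 y)) + (-1 / 30) * ((cf 3 x * cf 6 y - cf 6 x * cf 3 y) - (cf 4 x * cf 7 y - cf 7 x * cf 4 y))"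
    "cf 1 (m x y) = (1 / 15) * ((cf 3 x * cf 6 y - cf 6 x * cf 3 y) - (cf 4 x * cf 7 y - cf 7 x * cf 4 y)) + (-1 / 30) * ((cf 2 x * cf 5 y - cf 5 x * cf 2 y) - (cf 4 x * cf 7 y - cf 7 x * cf 4 y))"
    "cf 2 (m x y) = (-1 / 30) * ((cf 0 x * cf 2 y - cf 2 x * cf 0 y) + (cf 6 x * cf 7 y - cf 7 x * cf 6 y))"
    "cf 3 (m x y) = (-1 / 30) * ((cf 1 x * cf 3 y - cf 3 x * cf 1 y) - (cf 5 x * cf 7 y - cf 7 x * cf 5 y))"
    "cf 4 (m x y) = (-1 / 30) * (- (cf 0 x * cf 4 y - cf 4 x * cf 0 y) - (cf 1 x * cf 4 y - cf 4 x * cf 1 y) + (cf 5 x * cf 6 y - cf 6 x * cf 5 y))"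
    "cf 5 (m x y) = (-1 / 30) * (- (cf 0 x * cf 5 y - cf 5 x * cf 0 y) + (cf 3 x * cf 4 y - cf 4 x * cf 3 y))"
    "cf 6 (m x y) = (-1 / 30) * (- (cf 1 x * cf 6 y - cf 6 x * cf 1 y) - (cf 2 x * cf 4 y - cf 4 x * cf 2 y))"
    "cf 7 (m x y) = (-1 / 30) * ((cf 0 x * cf 7 y - cf 7 x * cf 0 y) + (cf 1 x * cf 7 y - cf 7 x * cf 1 y) + (cf 2 x * cf 3 y - cf 3 x * cf 2 y))"
    using e by (simp_all add: field_simps)
qed

lemma nondegenerate_model_8:
  assumes n: "CARD('n::finite) = 8"
  shows "nondegenerate (model :: 'n tensor)"
  unfolding nondegenerate_def
proof (intro allI impI)
  fix u :: "real ^ 'n" assume "\<forall>z. Bf model u z = 0"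
  then have "Bf model u (eb k) = 0" for k by simp
  note this[of 0] this[of 1] this[of 2] this[of 3] this[of 4] this[of 5] this[of 6] this[of 7]
  note e = this[unfolded Bf_model_8_eb[OF n]]
  have "cf k u = 0" if "k < 8" for k
  proof -
    from that have "k \<in> {..<8}" by simp
    then show ?thesis using e unfolding lessThan_8 by auto
  qed
  then show "u = 0" by (intro cf_eqI) (simp add: n cf_def)
qed

text \<open>Imaginary octonions do not form a Lie algebra, so the Jacobi identity is no help: each
  coordinate of the Malcev identity is verified as a polynomial identity.\<close>

lemma malcev_model_7:
  fixes m :: "real ^ 'n \<Rightarrow> real ^ 'n \<Rightarrow> real ^ 'n::finite"
  assumes n: "CARD('n) = 7" and m: "product_of model m"
  shows "malcev_identity m"
  unfolding malcev_identity_def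
proof (intro allI cf_eqI)
  note c = product_of_model_7[OF n m]
  have add: "cf i (u + v) = cf i u + cf i v" for i and u v :: "real ^ 'n" by (simp add: cf_def)
  fix x y z :: "real ^ 'n" and k assume "k < CARD('n)"
  then have "k \<in> {..<7}" using n by simp
  then have k: "k \<in> {0, 1, 2, 3, 4, 5, 6}" unfolding lessThan_7 .
  have h0: "cf 0 (m (m x y) (m x z)) =
      cf 0 (m (m (m x y) z) x + m (m (m y z) x) x + m (m (m z x) x) y)"
    by (simp only: add c) algebra
  have h1: "cf 1 (m (m x y) (m x z)) =
      cf 1 (m (m (m x y) z) x + m (m (m y z) x) x + m (m (m z x) x) y)"
    by (simp only: add c) algebra
  have h2: "cf 2 (m (m x y) (m x z)) =
      cf 2 (m (m (m x y) z) x + m (m (m y z) x) x + m (m (m z x) x) y)"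
    by (simp only: add c) algebra
  have h3: "cf 3 (m (m x y) (m x z)) =
      cf 3 (m (m (m x y) z) x + m (m (m y z) x) x + m (m (m z x) x) y)"
    by (simp only: add c) algebra
  have h4: "cf 4 (m (m x y) (m x z)) =
      cf 4 (m (m (m x y) z) x + m (m (m y z) x) x + m (m (m z x) x) y)"
    by (simp only: add c) algebra
  have h5: "cf 5 (m (m x y) (m x z)) =
      cf 5 (m (m (m x y) z) x + m (m (m y z) x) x + m (m (m z x) x) y)"
    by (simp only: add c) algebra
  have h6: "cf 6 (m (m x y) (m x z)) =
      cf 6 (m (m (m x y) z) x + m (m (m y z) x) x + m (m (m z x) x) y)"
    by (simp only: add c) algebra
  from k show "cf k (m (m x y) (m x z)) =
      cf k (m (m (m x y) z) x + m (m (m y z) x) x + m (m (m z x) x) y)"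
    by (elim insertE emptyE) (simp_all only: h0 h1 h2 h3 h4 h5 h6)
qed

text \<open>The Jacobi identity for x, y and the product of x and z expresses the left side, and the
  one for x, y, z multiplied by x supplies the rest. The common term
  \<open>m (m (m z x) y) x\<close> is eliminated.\<close>

lemma jacobi_imp_malcev_identity:
  fixes m :: "'v::real_vector \<Rightarrow> 'v \<Rightarrow> 'v"
  assumes add: "\<And>a b c. m (a + b) c = m a c + m b c" and anti: "\<And>a b. m a b = - m b a"
    and jac: "\<And>a b c. m (m a b) c + m (m b c) a + m (m c a) b = 0"
  shows "malcev_identity m"
  unfolding malcev_identity_def
proof (intro allI)
  fix x y z
  have zero: "m 0 a = 0" for a using add[of 0 0 a] by simp
  have minus: "m (- a) b = - m a b" for a b
    using add[of a "- a" b] by (simp add: zero add_eq_0_iff)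
  have "m (m (m x y) z + m (m y z) x + m (m z x) y) x = 0" by (simp only: jac zero)
  then have 1: "m (m (m x y) z) x + m (m (m y z) x) x + m (m (m z x) y) x = 0" by (simp only: add)
  have "m (m x y) (m x z) + m (m y (m x z)) x + m (m (m x z) x) y = 0" by (rule jac)
  moreover have "m y (m x z) = m (m z x) y" using anti[of y "m x z"] anti[of x z] by (simp add: minus)
  moreover have "m (m (m x z) x) y = - m (m (m z x) x) y" using anti[of x z] by (simp add: minus)
  ultimately have "m (m x y) (m x z) + m (m (m z x) y) x = m (m (m z x) x) y" by simp
  then have e1: "m (m x y) (m x z) = m (m (m z x) x) y - m (m (m z x) y) x"
    by (simp only: eq_diff_eq)
  have e2: "m (m (m z x) y) x = - (m (m (m x y) z) x + m (m (m y z) x) x)"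
    using 1 by (simp only: eq_neg_iff_add_eq_0 add.commute)
  show "m (m x y) (m x z) = m (m (m x y) z) x + m (m (m y z) x) x + m (m (m z x) x) y"
    unfolding e1 e2 diff_minus_eq_add by (rule add.commute)
qed

lemma malcev_model_8:
  fixes m :: "real ^ 'n \<Rightarrow> real ^ 'n \<Rightarrow> real ^ 'n::finite"
  assumes n: "CARD('n) = 8" and m: "product_of model m"
  shows "malcev_identity m"
proof (rule jacobi_imp_malcev_identity)
  note c = product_of_model_8[OF n m]
  have add: "cf i (u + v) = cf i u + cf i v" "cf i (- u) = - cf i u" "cf i 0 = 0" for i and u v :: "real ^ 'n"
    by (simp_all add: cf_def)
  have dom: "k \<in> {0, 1, 2, 3, 4, 5, 6, 7}" if "k < CARD('n)" for k
    using that n unfolding lessThan_8[symmetric] by simp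
  fix x y z :: "real ^ 'n"
  have a0: "cf 0 (m (x + y) z) = cf 0 (m x z + m y z)"
    by (simp only: add c) algebra
  have a1: "cf 1 (m (x + y) z) = cf 1 (m x z + m y z)"
    by (simp only: add c) algebra
  have a2: "cf 2 (m (x + y) z) = cf 2 (m x z + m y z)"
    by (simp only: add c) algebra
  have a3: "cf 3 (m (x + y) z) = cf 3 (m x z + m y z)"
    by (simp only: add c) algebra
  have a4: "cf 4 (m (x + y) z) = cf 4 (m x z + m y z)"
    by (simp only: add c) algebra
  have a5: "cf 5 (m (x + y) z) = cf 5 (m x z + m y z)"
    by (simp only: add c) algebra
  have a6: "cf 6 (m (x + y) z) = cf 6 (m x z + m y z)"
    by (simp only: add c) algebra
  have a7: "cf 7 (m (x + y) z) = cf 7 (m x z + m y z)"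
    by (simp only: add c) algebra
  show "m (x + y) z = m x z + m y z"
    by (rule cf_eqI, drule dom, elim insertE emptyE) (simp_all only: a0 a1 a2 a3 a4 a5 a6 a7)
  have b0: "cf 0 (m x y) = cf 0 (- m y x)"
    by (simp only: add c) algebra
  have b1: "cf 1 (m x y) = cf 1 (- m y x)"
    by (simp only: add c) algebra
  have b2: "cf 2 (m x y) = cf 2 (- m y x)"
    by (simp only: add c) algebra
  have b3: "cf 3 (m x y) = cf 3 (- m y x)"
    by (simp only: add c) algebra
  have b4: "cf 4 (m x y) = cf 4 (- m y x)"
    by (simp only: add c) algebra
  have b5: "cf 5 (m x y) = cf 5 (- m y x)"
    by (simp only: add c) algebra
  have b6: "cf 6 (m x y) = cf 6 (- m y x)"
    by (simp only: add c) algebra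
  have b7: "cf 7 (m x y) = cf 7 (- m y x)"
    by (simp only: add c) algebra
  show "m x y = - m y x"
    by (rule cf_eqI, drule dom, elim insertE emptyE) (simp_all only: b0 b1 b2 b3 b4 b5 b6 b7)
  have j0: "cf 0 (m (m x y) z + m (m y z) x + m (m z x) y) = cf 0 (0)"
    by (simp only: add c) algebra
  have j1: "cf 1 (m (m x y) z + m (m y z) x + m (m z x) y) = cf 1 (0)"
    by (simp only: add c) algebra
  have j2: "cf 2 (m (m x y) z + m (m y z) x + m (m z x) y) = cf 2 (0)"
    by (simp only: add c) algebra
  have j3: "cf 3 (m (m x y) z + m (m y z) x + m (m z x) y) = cf 3 (0)"
    by (simp only: add c) algebra
  have j4: "cf 4 (m (m x y) z + m (m y z) x + m (m z x) y) = cf 4 (0)"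
    by (simp only: add c) algebra
  have j5: "cf 5 (m (m x y) z + m (m y z) x + m (m z x) y) = cf 5 (0)"
    by (simp only: add c) algebra
  have j6: "cf 6 (m (m x y) z + m (m y z) x + m (m z x) y) = cf 6 (0)"
    by (simp only: add c) algebra
  have j7: "cf 7 (m (m x y) z + m (m y z) x + m (m z x) y) = cf 7 (0)"
    by (simp only: add c) algebra
  show "m (m x y) z + m (m y z) x + m (m z x) y = 0"
    by (rule cf_eqI, drule dom, elim insertE emptyE) (simp_all only: j0 j1 j2 j3 j4 j5 j6 j7)
qed

subsection \<open>The orbit of the model\<close>

text \<open>The Leibniz expansion of the derivative of \<open>g \<mapsto> pb g T\<close> at the
  identity in direction A.\<close>

definition act_form :: "real ^ 'n ^ 'n \<Rightarrow> 'n tensor \<Rightarrow> (real ^ 'n) list \<Rightarrow> real" where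
  "act_form A T xs = (if length xs = 3 then tform T [A *v xs ! 0, xs ! 1, xs ! 2] +
     tform T [xs ! 0, A *v xs ! 1, xs ! 2] + tform T [xs ! 0, xs ! 1, A *v xs ! 2] else 0)"

definition act :: "real ^ 'n ^ 'n \<Rightarrow> 'n tensor \<Rightarrow> 'n::finite tensor" where
  "act A T = tensor_of (act_form A T)"

text \<open>The differential of the orbit map at the identity is onto the alternating tensors: the
  infinitesimal version of an open orbit.\<close>

definition submersive :: "'n::finite tensor \<Rightarrow> bool" where
  "submersive T \<longleftrightarrow> (\<forall>S. alternating S \<longrightarrow> (\<exists>A. act A T = S))"

lemma act_form_alt_forms:
  assumes "alternating T"
  shows "act_form A T \<in> alt_forms 3 UNIV"
  unfolding alt_forms_def mem_Collect_eq
proof (intro conjI allI impI)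
  fix xs :: "(real ^ 'a) list" assume "length xs \<noteq> 3 \<or> \<not> set xs \<subseteq> UNIV"
  then show "act_form A T xs = 0" by (simp add: act_form_def)
next
  fix xs :: "(real ^ 'a) list" and i :: nat and x y :: "real ^ 'a" and a :: real
  assume *: "length xs = 3 \<and> set xs \<subseteq> UNIV \<and> i < 3 \<and> x \<in> UNIV \<and> y \<in> UNIV"
  then obtain u v w where "xs = [u, v, w]" using length_3E by blast
  moreover have "i = 0 \<or> i = 1 \<or> i = 2" using * by auto
  moreover have "A *v (a *\<^sub>R x + y) = a *\<^sub>R (A *v x) + A *v y"
    by (simp add: matrix_vector_right_distrib matrix_vector_mult_scaleR)
  ultimately show "act_form A T (xs[i := a *\<^sub>R x + y]) = a * act_form A T (xs[i := x]) + act_form A T (xs[i := y])"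
    by (elim disjE) (simp_all add: act_form_def tform_linear1 tform_linear2 tform_linear3 distrib_left)
next
  fix xs :: "(real ^ 'a) list" and i j :: nat
  assume *: "length xs = 3 \<and> i < j \<and> j < 3 \<and> xs ! i = xs ! j"
  then obtain u v w where xs: "xs = [u, v, w]" using length_3E by blast
  note s = alternating_tform[OF assms]
  have "act_form A T [u, u, w] = 0" "act_form A T [u, v, v] = 0" "act_form A T [u, v, u] = 0" for u v w
    using s(1)[of u "A *v u" w] s(1)[of u u "A *v w"] s(2)[of "A *v u" v v] s(2)[of u v "A *v v"]
      s(1)[of u v "A *v u"] s(2)[of v u "A *v u"] s(1)[of v "A *v u" u] s(2)[of u "A *v v" u] s(1)[of u u "A *v v"]
    by (simp_all add: act_form_def)
  moreover have "i = 0 \<and> j = 1 \<or> i = 0 \<and> j = 2 \<or> i = 1 \<and> j = 2" using * by auto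
  ultimately show "act_form A T xs = 0" using * by (elim disjE) (simp_all add: xs)
qed

lemma
  assumes "alternating T"
  shows alternating_act: "alternating (act A T)"
    and tform_act: "tform (act A T) = act_form A T"
  using alt_forms_tensor_of[OF act_form_alt_forms[OF assms]] by (auto simp: act_def)

section \<open>Verified certificates for the submersivity of the models\<close>

fun coef3 :: "(int \<times> nat list) list \<Rightarrow> nat \<Rightarrow> nat \<Rightarrow> nat \<Rightarrow> int" where
  "coef3 ((a, [x, y, z]) # T) i j k =
     (if x = i then (if y = j then (if z = k then a else 0) else if y = k then (if z = j then - a else 0) else 0)
      else if x = j then (if y = i then (if z = k then - a else 0) else if y = k then (if z = i then a else 0) else 0)
      else if x = k then (if y = i then (if z = j then a else 0) else if y = j then (if z = i then - a else 0) else 0)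
      else 0) + coef3 T i j k"
| "coef3 (t # T) i j k = coef3 T i j k"
| "coef3 [] i j k = 0"

lemma form_of_eb:
  assumes "\<forall>(a, l)\<in>set T. length l = 3 \<and> set l \<subseteq> {..<CARD('n)} \<and> distinct l"
    and "i < CARD('n)" "j < CARD('n)" "k < CARD('n::finite)"
  shows "form_of cf T [eb i, eb j, eb k :: real ^ 'n] = of_int (coef3 T i j k)"
  using assms(1)
proof (induction T)
  case Nil
  then show ?case by (simp add: form_of_simps)
next
  case (Cons t T)
  obtain a l where al: "t = (a, l)" by force
  with Cons.prems have "length l = 3" by simp
  then obtain x y z where t: "t = (a, [x, y, z])" using al length_3E by blast
  have "x < CARD('n)" "y < CARD('n)" "z < CARD('n)" "x \<noteq> y" "x \<noteq> z" "y \<noteq> z" using Cons.prems t by auto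
  then show ?case using Cons assms(2-) by (simp add: t form_of_simps monomial_form_3 cf_eb)
qed

text \<open>A certificate lists the entries \<open>6 A\<^sub>a\<^sub>b\<close> of a matrix \<open>A\<close> with \<open>A \<cdot> model = S\<close>, as integer
  combinations of the components of \<open>S\<close>.\<close>

type_synonym certificate = "((nat \<times> nat) \<times> (int \<times> nat \<times> nat \<times> nat) list) list"

text \<open>The formal expansion of six times the value of \<open>act A T\<close> on the basis
  vectors i, j, k. The entry of A at a, b contributes once for each argument equal to b, which it
  replaces by a.\<close>

definition cert_sum :: "(int \<times> nat list) list \<Rightarrow> certificate \<Rightarrow> nat \<Rightarrow> nat \<Rightarrow> nat \<Rightarrow> (int \<times> nat \<times> nat \<times> nat) list" where
  "cert_sum T tab i j k = concat (map (\<lambda>((a, b), cs).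
     let w = (if b = i then coef3 T a j k else 0) + (if b = j then coef3 T i a k else 0) + (if b = k then coef3 T i j a else 0)
     in if w = 0 then [] else map (\<lambda>(c, t). (w * c, t)) cs) tab)"

definition total :: "(int \<times> 'a) list \<Rightarrow> 'a \<Rightarrow> int" where
  "total L t = (\<Sum>(c, u)\<leftarrow>L. if u = t then c else 0)"

text \<open>For i < j < k the expansion has to collapse to six times the component of S at i, j, k,
  all other coefficients cancelling.\<close>

definition cert_check :: "nat \<Rightarrow> (int \<times> nat list) list \<Rightarrow> certificate \<Rightarrow> bool" where
  "cert_check n T tab \<longleftrightarrow> list_all (\<lambda>((a, b), cs). a < n) tab \<and>
     list_all (\<lambda>i. list_all (\<lambda>j. list_all (\<lambda>k. i < j \<longrightarrow> j < k \<longrightarrow>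
       (let L = cert_sum T tab i j k in total L (i, j, k) = 6 \<and>
         list_all (\<lambda>(c, t). t = (i, j, k) \<or> total L t = 0) L)) [0..<n]) [0..<n]) [0..<n]"

text \<open>There are 49 unknown entries of A and 35 equations. As many entries as equations are
  listed and the other 14, the dimension of the G2 stabilizer, are taken to be 0. In
  \<open>cert8\<close> the same holds with 64 unknowns, 56 equations and the 8-dimensional
  stabilizer.\<close>

definition cert7 :: certificate where
  "cert7 = [((0, 0), [(2, (0, 1, 4)), (2, (0, 2, 5)), (2, (0, 3, 6)), (-2, (1, 2, 3)), (-2, (4, 5, 6))]),
  ((0, 1), [(-3, (0, 5, 6)), (3, (1, 2, 5)), (3, (1, 3, 6))]),
  ((0, 2), [(3, (0, 4, 6)), (-3, (1, 2, 4)), (3, (2, 3, 6))]),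
  ((0, 3), [(-3, (0, 4, 5)), (-3, (1, 3, 4)), (-3, (2, 3, 5))]),
  ((0, 4), [(-6, (2, 4, 5))]),
  ((0, 5), [(6, (1, 4, 5))]),
  ((0, 6), [(6, (1, 4, 6))]),
  ((1, 0), [(6, (0, 2, 3)), (-6, (2, 4, 5)), (6, (3, 4, 6))]),
  ((1, 1), [(4, (0, 1, 4)), (-2, (0, 2, 5)), (-2, (0, 3, 6)), (2, (1, 2, 3)), (-4, (4, 5, 6))]),
  ((1, 2), [(6, (0, 2, 4))]),
  ((1, 3), [(6, (0, 3, 4))]),
  ((1, 4), [(6, (2, 3, 4))]),
  ((1, 5), [(-3, (0, 4, 5)), (-3, (1, 3, 4)), (3, (2, 3, 5))]),
  ((1, 6), [(-3, (0, 4, 6)), (3, (1, 2, 4)), (3, (2, 3, 6))]),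
  ((2, 0), [(-6, (0, 1, 3)), (6, (1, 4, 5)), (6, (3, 5, 6))]),
  ((2, 1), [(6, (0, 1, 5))]),
  ((2, 2), [(-2, (0, 1, 4)), (4, (0, 2, 5)), (-2, (0, 3, 6)), (2, (1, 2, 3)), (2, (4, 5, 6))]),
  ((2, 3), [(6, (0, 3, 5))]),
  ((2, 4), [(3, (0, 4, 5)), (-3, (1, 3, 4)), (3, (2, 3, 5))]),
  ((2, 5), [(-6, (1, 3, 5))]),
  ((2, 6), [(-3, (0, 5, 6)), (3, (1, 2, 5)), (-3, (1, 3, 6))]),
  ((3, 0), [(6, (0, 1, 2)), (6, (1, 4, 6)), (-6, (2, 5, 6))]),
  ((3, 1), [(6, (0, 1, 6))]),
  ((3, 2), [(6, (0, 2, 6))]),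
  ((3, 3), [(-2, (0, 1, 4)), (-2, (0, 2, 5)), (4, (0, 3, 6)), (2, (1, 2, 3)), (2, (4, 5, 6))]),
  ((3, 4), [(3, (0, 4, 6)), (3, (1, 2, 4)), (3, (2, 3, 6))]),
  ((3, 5), [(3, (0, 5, 6)), (3, (1, 2, 5)), (-3, (1, 3, 6))]),
  ((3, 6), [(6, (1, 2, 6))]),
  ((4, 1), [(6, (1, 5, 6))]),
  ((4, 2), [(-6, (1, 4, 6)), (6, (2, 5, 6))]),
  ((4, 3), [(6, (1, 4, 5)), (6, (3, 5, 6))]),
  ((4, 4), [(6, (4, 5, 6))]),
  ((5, 2), [(-6, (2, 4, 6))]),
  ((5, 3), [(6, (2, 4, 5)), (-6, (3, 4, 6))]),
  ((6, 3), [(6, (3, 4, 5))])]"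

definition cert8 :: certificate where
  "cert8 = [((0, 0), [(2, (0, 2, 5)), (-4, (0, 3, 6)), (-4, (0, 4, 7)), (2, (1, 2, 5)), (2, (1, 3, 6)), (2, (1, 4, 7)), (-2, (2, 3, 4)), (-2, (5, 6, 7))]),
  ((0, 1), [(6, (1, 2, 5))]),
  ((0, 2), [(6, (0, 1, 2)), (-12, (0, 6, 7)), (6, (1, 6, 7)), (-6, (2, 3, 6)), (-6, (2, 4, 7))]),
  ((0, 3), [(-6, (1, 5, 7)), (-6, (2, 3, 5))]),
  ((0, 4), [(-6, (1, 5, 6)), (-6, (2, 4, 5))]),
  ((0, 5), [(-6, (0, 1, 5)), (6, (1, 3, 4)), (6, (3, 5, 6)), (6, (4, 5, 7))]),
  ((0, 6), [(6, (2, 5, 6))]),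
  ((0, 7), [(6, (2, 5, 7))]),
  ((1, 0), [(6, (0, 3, 6))]),
  ((1, 1), [(2, (0, 2, 5)), (2, (0, 3, 6)), (2, (0, 4, 7)), (-4, (1, 2, 5)), (2, (1, 3, 6)), (-4, (1, 4, 7)), (-2, (2, 3, 4)), (-2, (5, 6, 7))]),
  ((1, 2), [(6, (0, 6, 7)), (6, (2, 3, 6))]),
  ((1, 3), [(-6, (0, 1, 3)), (-6, (0, 5, 7)), (12, (1, 5, 7)), (6, (2, 3, 5)), (-6, (3, 4, 7))]),
  ((1, 4), [(-6, (0, 1, 4)), (-6, (0, 5, 6)), (-6, (3, 4, 6))]),
  ((1, 5), [(-6, (3, 5, 6))]),
  ((1, 6), [(6, (0, 1, 6)), (-6, (0, 2, 4)), (-6, (2, 5, 6)), (6, (4, 6, 7))]),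
  ((1, 7), [(6, (0, 1, 7)), (-6, (0, 2, 3)), (6, (1, 2, 3)), (6, (3, 6, 7))]),
  ((2, 0), [(6, (0, 3, 4))]),
  ((2, 1), [(6, (0, 1, 5))]),
  ((2, 2), [(4, (0, 2, 5)), (4, (0, 3, 6)), (4, (0, 4, 7)), (-2, (1, 2, 5)), (-2, (1, 3, 6)), (-2, (1, 4, 7)), (2, (2, 3, 4)), (-4, (5, 6, 7))]),
  ((2, 3), [(6, (0, 3, 5))]),
  ((2, 4), [(6, (0, 4, 5)), (-6, (1, 4, 5))]),
  ((2, 5), [(6, (3, 4, 5))]),
  ((2, 6), [(-6, (0, 1, 4)), (-6, (0, 5, 6))]),
  ((2, 7), [(-6, (0, 1, 3)), (-6, (0, 5, 7)), (6, (1, 5, 7))]),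
  ((3, 0), [(-6, (0, 1, 6))]),
  ((3, 1), [(-6, (1, 2, 4))]),
  ((3, 2), [(6, (1, 2, 6))]),
  ((3, 3), [(-2, (0, 2, 5)), (-2, (0, 3, 6)), (-2, (0, 4, 7)), (4, (1, 2, 5)), (4, (1, 3, 6)), (4, (1, 4, 7)), (2, (2, 3, 4)), (2, (5, 6, 7))]),
  ((3, 4), [(-6, (0, 4, 6)), (6, (1, 4, 6))]),
  ((3, 5), [(6, (1, 5, 6))]),
  ((3, 6), [(-6, (2, 4, 6))]),
  ((3, 7), [(-6, (0, 1, 2)), (6, (0, 6, 7)), (-6, (1, 6, 7))]),
  ((4, 0), [(6, (0, 1, 7)), (6, (1, 2, 3))]),
  ((4, 1), [(6, (1, 2, 3))]),
  ((4, 2), [(-6, (1, 2, 7))]),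
  ((4, 3), [(-6, (0, 3, 7))]),
  ((4, 4), [(-2, (0, 2, 5)), (-2, (0, 3, 6)), (-2, (0, 4, 7)), (-2, (1, 2, 5)), (-2, (1, 3, 6)), (-2, (1, 4, 7)), (2, (2, 3, 4)), (2, (5, 6, 7))]),
  ((4, 5), [(-6, (1, 5, 7))]),
  ((4, 6), [(-6, (0, 6, 7))]),
  ((4, 7), [(6, (2, 3, 7))]),
  ((5, 1), [(-6, (0, 1, 2))]),
  ((5, 2), [(6, (2, 6, 7))]),
  ((5, 3), [(-6, (0, 1, 7)), (6, (0, 2, 3)), (-6, (1, 2, 3))]),
  ((5, 4), [(-6, (0, 1, 6)), (6, (0, 2, 4))]),
  ((5, 5), [(6, (5, 6, 7))]),
  ((5, 6), [(6, (0, 2, 6))]),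
  ((5, 7), [(6, (0, 2, 7)), (-6, (1, 2, 7))]),
  ((6, 0), [(6, (0, 1, 3))]),
  ((6, 3), [(-6, (3, 5, 7))]),
  ((6, 4), [(-6, (0, 1, 5)), (6, (1, 3, 4))]),
  ((6, 5), [(6, (1, 3, 5))]),
  ((6, 7), [(-6, (0, 3, 7)), (6, (1, 3, 7))]),
  ((7, 0), [(-6, (0, 1, 4))]),
  ((7, 4), [(6, (4, 5, 6))]),
  ((7, 5), [(-6, (1, 4, 5))]),
  ((7, 6), [(-6, (0, 4, 6))])]"

lemma cert_check_7: "cert_check 7 (model_terms 7) cert7"
  by code_simp

lemma cert_check_8: "cert_check 8 (model_terms 8) cert8"
  by code_simp

lemma sum_list_total:
  assumes "finite D" "snd ` set L \<subseteq> D"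
  shows "(\<Sum>(c, t)\<leftarrow>L. of_int c * s t) = (\<Sum>t\<in>D. of_int (total L t) * (s t :: real))"
  using assms(2)
proof (induction L)
  case Nil
  then show ?case by (simp add: total_def)
next
  case (Cons p L)
  obtain c t where p: "p = (c, t)" by force
  have "t \<in> D" using Cons.prems p by simp
  have "(\<Sum>u\<in>D. of_int (total (p # L) u) * s u) = (\<Sum>u\<in>D. (if u = t then of_int c * s u else 0) + of_int (total L u) * s u)"
    by (intro sum.cong refl) (simp add: p total_def algebra_simps)
  also have "\<dots> = of_int c * s t + (\<Sum>u\<in>D. of_int (total L u) * s u)"
    using \<open>t \<in> D\<close> assms(1) by (simp add: sum.distrib)
  finally show ?case using Cons by (simp add: p)
qed

lemma submersive_of_cert_check:
  fixes T :: "'n::finite tensor"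
  assumes T: "tform T = form_of cf L" "alternating T"
    and L: "\<forall>(a, l)\<in>set L. length l = 3 \<and> set l \<subseteq> {..<CARD('n)} \<and> distinct l"
    and check: "cert_check CARD('n) L tab"
  shows "submersive T"
  unfolding submersive_def
proof (intro allI impI)
  fix S :: "'n tensor" assume S: "alternating S"
  define s where "s = (\<lambda>(i, j, k). tform S [eb i, eb j, eb k])"
  define v where "v cs = (\<Sum>(c, t)\<leftarrow>cs. of_int c * s t)" for cs :: "(int \<times> nat \<times> nat \<times> nat) list"
  \<comment> \<open>The certificate stores integers, hence the division by 6; a pair a, b that is
    not listed gives the entry 0.\<close>
  define M where "M a b = (\<Sum>((a', b'), cs)\<leftarrow>tab. if a' = a \<and> b' = b then v cs else 0) / 6" for a b
  define A :: "real ^ 'n ^ 'n" where "A = (\<chi> p q. M (pos p) (pos q))"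
  have tab: "a < CARD('n)" if "((a, b), cs) \<in> set tab" for a b cs
    using check that by (fastforce simp: cert_check_def list_all_iff)
  have Aeb: "A *v eb i = (\<Sum>a<CARD('n). M a i *\<^sub>R eb a)" if "i < CARD('n)" for i
  proof (rule cf_eqI)
    fix k assume k: "k < CARD('n)"
    have "cf k (A *v eb i) = M k i"
      using k that by (simp add: cf_def A_def eb_def matrix_vector_mult_def axis_def
          if_distrib[where f = "\<lambda>x. _ * x"] cong: if_cong)
    also have "\<dots> = (\<Sum>a<CARD('n). M a i * cf k (eb a :: real ^ 'n))"
      using k by (simp add: cf_eb if_distrib[where f = "\<lambda>x. _ * x"] cong: if_cong)
    finally show "cf k (A *v eb i) = cf k (\<Sum>a<CARD('n). M a i *\<^sub>R (eb a :: real ^ 'n))"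
      by (simp add: linear_sum[OF linear_cf] linear_scale[OF linear_cf])
  qed
  have sum_M: "(\<Sum>a<CARD('n). M a i * of_int (f a)) =
      (\<Sum>((a, b), cs)\<leftarrow>tab. of_int (if b = i then f a else 0) * v cs) / 6" for i and f :: "nat \<Rightarrow> int"
  proof -
    have "(\<Sum>a<CARD('n). (\<Sum>((a', b'), cs)\<leftarrow>tb. if a' = a \<and> b' = i then v cs else 0) * of_int (f a)) =
      (\<Sum>((a, b), cs)\<leftarrow>tb. of_int (if b = i then f a else 0) * v cs)" if "set tb \<subseteq> set tab" for tb
      using that
    proof (induction tb)
      case (Cons e tb)
      obtain a b cs where e: "e = ((a, b), cs)" by (metis prod.exhaust)
      have "a < CARD('n)" using Cons.prems e tab by auto
      then have "(\<Sum>a'<CARD('n). (if a = a' \<and> b = i then v cs else 0) * of_int (f a')) = of_int (if b = i then f a else 0) * v cs"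
        by (cases "b = i") (simp_all add: if_distrib[where f = "\<lambda>x. x * _"] cong: if_cong)
      then show ?case using Cons by (simp add: e distrib_right sum.distrib)
    qed simp
    from this[of tab] show ?thesis by (simp add: M_def sum_divide_distrib[symmetric])
  qed
  have t0: "tform T [eb i, eb j, eb k] = of_int (coef3 L i j k)" if "i < CARD('n)" "j < CARD('n)" "k < CARD('n)" for i j k
    unfolding T by (rule form_of_eb[OF L that])
  have "tform (act A T) = tform S"
  proof (rule alt_forms_UNIV_eqI[OF alternating_imp_alt_forms[OF alternating_act[OF T(2)]] alternating_imp_alt_forms[OF S]])
    fix l :: "nat list" assume l: "sorted_wrt (<) l" "set l \<subseteq> {..<CARD('n)}" "length l = 3"
    then obtain i j k where ijk: "l = [i, j, k]" using length_3E by blast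
    with l have lt: "i < CARD('n)" "j < CARD('n)" "k < CARD('n)" "i < j" "j < k" by auto
    let ?C = "cert_sum L tab i j k"
    have "tform (act A T) (map eb l) = (\<Sum>a<CARD('n). M a i * of_int (coef3 L a j k)) +
        (\<Sum>a<CARD('n). M a j * of_int (coef3 L i a k)) + (\<Sum>a<CARD('n). M a k * of_int (coef3 L i j a))"
      using lt by (simp add: ijk tform_act[OF T(2)] act_form_def Aeb linear_sum[OF linear_tform(1)]
          linear_sum[OF linear_tform(2)] linear_sum[OF linear_tform(3)] linear_scale[OF linear_tform(1)]
          linear_scale[OF linear_tform(2)] linear_scale[OF linear_tform(3)] t0)
    also have "\<dots> = (\<Sum>(c, t)\<leftarrow>?C. of_int c * s t) / 6"
    proof -
      have "(\<Sum>(c, t)\<leftarrow>map (\<lambda>(c, t). (w * c, t)) cs. of_int c * s t) = of_int w * v cs" for w cs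
        by (induction cs) (auto simp: v_def algebra_simps)
      then have "(\<Sum>(c, t)\<leftarrow>cert_sum L tb i j k. of_int c * s t) =
          (\<Sum>((a, b), cs)\<leftarrow>tb. of_int (if b = i then coef3 L a j k else 0) * v cs) +
          (\<Sum>((a, b), cs)\<leftarrow>tb. of_int (if b = j then coef3 L i a k else 0) * v cs) +
          (\<Sum>((a, b), cs)\<leftarrow>tb. of_int (if b = k then coef3 L i j a else 0) * v cs)" for tb
      proof (induction tb)
        case Nil
        then show ?case by (simp add: cert_sum_def)
      next
        case (Cons e tb)
        obtain a b cs where e: "e = ((a, b), cs)" by (metis prod.exhaust)
        define w where "w = (if b = i then coef3 L a j k else 0) + (if b = j then coef3 L i a k else 0) + (if b = k then coef3 L i j a else 0)"
        have "cert_sum L (e # tb) i j k = (if w = 0 then [] else map (\<lambda>(c, t). (w * c, t)) cs) @ cert_sum L tb i j k"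
          by (simp add: e cert_sum_def w_def Let_def)
        moreover have "(\<Sum>(c, t)\<leftarrow>(if w = 0 then [] else map (\<lambda>(c, t). (w * c, t)) cs). of_int c * s t) = of_int w * v cs"
          using Cons.prems by simp
        ultimately have "(\<Sum>(c, t)\<leftarrow>cert_sum L (e # tb) i j k. of_int c * s t) = of_int w * v cs + (\<Sum>(c, t)\<leftarrow>cert_sum L tb i j k. of_int c * s t)"
          by simp
        then show ?case using Cons by (simp add: e w_def algebra_simps)
      qed
      then show ?thesis by (simp add: sum_M add_divide_distrib)
    qed
    also have "(\<Sum>(c, t)\<leftarrow>?C. of_int c * s t) = (\<Sum>t\<in>insert (i, j, k) (snd ` set ?C). of_int (total ?C t) * s t)"
      by (rule sum_list_total) auto
    also have "\<dots> = (\<Sum>t\<in>insert (i, j, k) (snd ` set ?C). if t = (i, j, k) then 6 * s t else 0)"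
    proof (intro sum.cong refl)
      fix t assume t: "t \<in> insert (i, j, k) (snd ` set ?C)"
      have "total ?C (i, j, k) = 6 \<and> list_all (\<lambda>(c, t). t = (i, j, k) \<or> total ?C t = 0) ?C"
        using check lt unfolding cert_check_def Let_def list_all_iff[of _ "[0..<_]"] by simp
      then show "of_int (total ?C t) * s t = (if t = (i, j, k) then 6 * s t else 0)"
        using t by (auto simp: list_all_iff)
    qed
    also have "\<dots> / 6 = tform S (map eb l)" by (simp add: s_def ijk)
    finally show "tform (act A T) (map eb l) = tform S (map eb l)" .
  qed
  then have "act A T = S" by (metis tensor_of_tform)
  then show "\<exists>A. act A T = S" ..
qed

lemma submersive_model:
  assumes "CARD('n::finite) = 7 \<or> CARD('n) = 8"
  shows "submersive (model :: 'n tensor)"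
  using assms
proof
  assume n: "CARD('n) = 7"
  show ?thesis
    by (rule submersive_of_cert_check[OF tform_model alternating_model])
       (use n cert_check_7 in \<open>auto simp: model_terms_def\<close>)
next
  assume n: "CARD('n) = 8"
  show ?thesis
    by (rule submersive_of_cert_check[OF tform_model alternating_model])
       (use n cert_check_8 in \<open>auto simp: model_terms_def\<close>)
qed

section \<open>Local sections of the orbit map\<close>

lemma Ck_on_vecI:
  fixes f :: "'a::euclidean_space \<Rightarrow> real ^ 'k"
  assumes "open S" "\<And>i. Ck_on k S (\<lambda>x. f x $ i)"
  shows "Ck_on k S f"
proof -
  have "Ck_on k S (\<lambda>x. \<Sum>i\<in>UNIV. f x $ i *\<^sub>R (axis i 1 :: real ^ 'k))"
    by (intro Ck_on_sum Ck_on_bilinear[OF _ bounded_bilinear_scaleR] Ck_on_const assms) auto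
  moreover have "(\<Sum>i\<in>UNIV. f x $ i *\<^sub>R (axis i 1 :: real ^ 'k)) = f x" for x
    by (simp add: basis_expansion scalar_mult_eq_scaleR[symmetric])
  then have "(\<lambda>x. \<Sum>i\<in>UNIV. f x $ i *\<^sub>R (axis i 1 :: real ^ 'k)) = f" by (rule ext)
  ultimately show ?thesis by (simp only:)
qed

lemma Ck_on_prod:
  fixes f :: "'i \<Rightarrow> 'a::euclidean_space \<Rightarrow> real"
  assumes S: "open S"
  shows "finite I \<Longrightarrow> (\<And>i. i \<in> I \<Longrightarrow> Ck_on k S (f i)) \<Longrightarrow> Ck_on k S (\<lambda>x. \<Prod>i\<in>I. f i x)"
proof (induction I rule: finite_induct)
  case empty
  then show ?case using Ck_on_const[OF S, of k 1] by simp
next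
  case (insert i I)
  then show ?case
    using Ck_on_bilinear[OF S bounded_bilinear_mult, of k "f i" "\<lambda>x. \<Prod>i\<in>I. f i x"] by simp
qed

lemma Ck_on_det:
  fixes f :: "'a::euclidean_space \<Rightarrow> real ^ 'k ^ 'k"
  assumes "open S" "\<And>i j. Ck_on k S (\<lambda>x. f x $ i $ j)"
  shows "Ck_on k S (\<lambda>x. det (f x))"
  unfolding det_def
  by (intro Ck_on_sum Ck_on_bilinear[OF _ bounded_bilinear_mult] Ck_on_prod Ck_on_const assms) auto

text \<open>Cramer's rule writes u, which is known only through an equation, as a quotient of
  determinants in the entries of M.\<close>

lemma Ck_on_linear_solve:
  fixes M :: "'a::euclidean_space \<Rightarrow> real ^ 'k ^ 'k"
  assumes S: "open S" and M: "\<And>i j. Ck_on k S (\<lambda>x. M x $ i $ j)"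
    and det: "\<And>x. x \<in> S \<Longrightarrow> det (M x) \<noteq> 0" and eq: "\<And>x. x \<in> S \<Longrightarrow> M x *v u x = r"
  shows "Ck_on k S u"
proof -
  define c where "c x = (\<chi> l. det (\<chi> i j. if j = l then r $ i else M x $ i $ j) * inverse (det (M x)))" for x
  have u: "u x = c x" if "x \<in> S" for x
    using cramer[OF det[OF that], of "u x" r] eq[OF that] by (simp add: c_def divide_inverse)
  have "Ck_on k S c"
  proof (rule Ck_on_vecI[OF S])
    fix l
    have "Ck_on k S (\<lambda>x. (\<chi> i j. if j = l then r $ i else M x $ i $ j) $ i $ j)" for i j
      by (cases "j = l") (auto simp: Ck_on_const[OF S] M)
    then have "Ck_on k S (\<lambda>x. det (\<chi> i j. if j = l then r $ i else M x $ i $ j))"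
      by (rule Ck_on_det[OF S])
    moreover have "Ck_on k S (\<lambda>x. inverse (det (M x)))"
      by (rule Ck_on_inverse[OF S det Ck_on_det[OF S M]])
    ultimately have "Ck_on k S (\<lambda>x. det (\<chi> i j. if j = l then r $ i else M x $ i $ j) * inverse (det (M x)))"
      by (rule Ck_on_bilinear[OF S bounded_bilinear_mult])
    then show "Ck_on k S (\<lambda>x. c x $ l)" by (simp add: c_def)
  qed
  then show ?thesis using Ck_on_cong[OF S, of u c k] u by simp
qed

text \<open>The inverse is smooth by bootstrapping: its directional derivatives solve a linear system whose
  matrix is a smooth function of the inverse itself.\<close>

lemma smooth_local_inverse:
  fixes F :: "real ^ 'k \<Rightarrow> real ^ 'k"
  assumes F: "smooth_on UNIV F" and id: "(F has_derivative (\<lambda>v. v)) (at x0)"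
  obtains V G where "open V" "F x0 \<in> V" "G (F x0) = x0" "smooth_on V G" "\<And>y. y \<in> V \<Longrightarrow> F (G y) = y"
proof -
  let ?F' = "\<lambda>x. frechet_derivative F (at x)"
  have F': "(F has_derivative ?F' x) (at x)" for x
    using smooth_on_has_derivative[OF F] by simp
  define f' where "f' x = Blinfun (?F' x)" for x
  have f': "blinfun_apply (f' x) = ?F' x" for x
    unfolding f'_def by (rule bounded_linear_Blinfun_apply) (use F' has_derivative_bounded_linear in blast)
  have cont: "continuous_on UNIV f'"
    by (rule continuous_on_blinfun_componentwise)
       (simp add: f' smooth_on_imp_continuous_on[OF smooth_on_frechet_derivative[OF F]])
  have id': "?F' x0 = (\<lambda>v. v)" using frechet_derivative_at[OF id] by simp
  have inv: "id_blinfun o\<^sub>L f' x0 = id_blinfun" by (rule blinfun_eqI) (simp add: f' id')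
  obtain U V G g' where UV: "open U" "x0 \<in> U" "open V" "F x0 \<in> V" "homeomorphism U V F G"
    and G': "\<And>y. y \<in> V \<Longrightarrow> (G has_derivative (g' y)) (at y)"
    and g': "\<And>y. y \<in> V \<Longrightarrow> g' y = inv (blinfun_apply (f' (G y)))"
    and bij: "\<And>y. y \<in> V \<Longrightarrow> bij (blinfun_apply (f' (G y)))"
    by (rule inverse_function_theorem[where U = UNIV and f = F and f' = f' and ?x0.0 = x0 and invf = id_blinfun])
       (use F' f' cont inv in auto)
  have FG: "F (G y) = y" if "y \<in> V" for y using UV(5) that unfolding homeomorphism_def by blast
  have GF: "G (F x0) = x0" using UV(2,5) unfolding homeomorphism_def by blast
  define M where "M y = matrix (?F' (G y))" for y
  have lin: "linear (?F' x)" for x using F' has_derivative_linear by blast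
  have Mv: "M y *v v = ?F' (G y) v" for y v
    unfolding M_def using fun_cong[OF matrix_vector_mul(2)[OF lin]] .
  have solve: "M y *v g' y v = v" if "y \<in> V" for y v
    using bij[OF that] unfolding Mv g'[OF that] f' by (simp add: bij_is_surj surj_f_inv_f)
  have det: "det (M y) \<noteq> 0" if "y \<in> V" for y
    by (metis solve[OF that] matrix_right_invertible_surjective invertible_def matrix_left_right_inverse
        invertible_det_nz surjI)
  have "Ck_on k V G" for k
  proof (induction k)
    case 0
    show ?case
      by (simp, rule continuous_at_imp_continuous_on) (use G' has_derivative_continuous in blast)
  next
    case (Suc k)
    have M: "Ck_on k V (\<lambda>y. M y $ i $ j)" for i j
    proof -
      have "Ck_on k UNIV (\<lambda>x. ?F' x (axis j 1))"
        using smooth_on_frechet_derivative[OF F] unfolding smooth_on_def by (rule spec)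
      from Ck_on_bounded_linear[OF open_UNIV bounded_linear_vec_nth this, of i]
      have "Ck_on k V (\<lambda>y. ?F' (G y) (axis j 1) $ i)"
        by (rule Ck_on_compose[OF UV(3) open_UNIV _ Suc.IH subset_UNIV])
      then show ?thesis by (simp add: M_def matrix_def)
    qed
    show ?case
      by (rule Ck_on_SucI[OF UV(3) G']) (assumption, rule Ck_on_linear_solve[OF UV(3) M det solve])
  qed
  then show thesis using that UV FG GF by (simp add: smooth_on_def)
qed

lemma has_derivative_tform:
  fixes T :: "'n::finite tensor" and u v w :: "'a::real_normed_vector \<Rightarrow> real ^ 'n"
  assumes "(u has_derivative u') (at x)" "(v has_derivative v') (at x)" "(w has_derivative w') (at x)"
  shows "((\<lambda>x. tform T [u x, v x, w x]) has_derivative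
    (\<lambda>h. tform T [u' h, v x, w x] + tform T [u x, v' h, w x] + tform T [u x, v x, w' h])) (at x)"
proof -
  have nth: "((\<lambda>x. f x $ i) has_derivative (\<lambda>h. f' h $ i)) (at x)" if "(f has_derivative f') (at x)"
    for f :: "'a \<Rightarrow> real ^ 'n" and f' i
    by (rule bounded_linear.has_derivative[OF bounded_linear_vec_nth that])
  have "((\<lambda>x. \<Sum>i\<in>UNIV. \<Sum>j\<in>UNIV. \<Sum>k\<in>UNIV. T $ (i, j, k) * u x $ i * v x $ j * w x $ k) has_derivative
     (\<lambda>h. \<Sum>i\<in>UNIV. \<Sum>j\<in>UNIV. \<Sum>k\<in>UNIV. T $ (i, j, k) * u x $ i * v x $ j * w' h $ k +
       (T $ (i, j, k) * u x $ i * v' h $ j + T $ (i, j, k) * u' h $ i * v x $ j) * w x $ k)) (at x)"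
    by (intro has_derivative_sum has_derivative_mult has_derivative_mult_right nth assms)
  then show ?thesis
    by (simp add: tform_def sum.distrib algebra_simps)
qed

definition alternate :: "'n::finite tensor \<Rightarrow> 'n tensor" where
  "alternate T = (\<chi> p. case p of (i, j, k) \<Rightarrow>
     (T $ (i, j, k) + T $ (j, k, i) + T $ (k, i, j) - T $ (j, i, k) - T $ (i, k, j) - T $ (k, j, i)) / 6)"

lemma alternating_alternate: "alternating (alternate T)"
  by (simp add: alternating_def alternate_def add_divide_distrib diff_divide_distrib)

lemma alternate_alternating:
  assumes "alternating T"
  shows "alternate T = T"
proof -
  have s: "T $ (j, i, k) = - T $ (i, j, k)" "T $ (i, k, j) = - T $ (i, j, k)" for i j k
    using assms unfolding alternating_def by blast+
  have "alternate T $ (i, j, k) = T $ (i, j, k)" for i j k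
    using s(1)[of j i k] s(2)[of i k j] s(1)[of k i j] s(2)[of j k i] s(1)[of j k i] s(2)[of k j i]
    by (simp add: alternate_def)
  then show ?thesis by (simp add: vec_eq_iff split_paired_all)
qed

lemma linear_alternate: "linear alternate"
  by (rule linearI) (simp_all add: vec_eq_iff split_paired_all alternate_def algebra_simps add_divide_distrib diff_divide_distrib)

lemma alternatingD:
  assumes "alternating T"
  shows "T $ (j, i, k) = - T $ (i, j, k)" "T $ (i, k, j) = - T $ (i, j, k)"
  using assms unfolding alternating_def by blast+

lemma alternating_linear:
  assumes S: "alternating S" and T: "alternating T"
  shows "alternating (a *\<^sub>R S + T)"
  unfolding alternating_def
proof (intro allI conjI)
  fix i j k
  show "(a *\<^sub>R S + T) $ (j, i, k) = - (a *\<^sub>R S + T) $ (i, j, k)"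
    using alternatingD(1)[OF S, of j i k] alternatingD(1)[OF T, of j i k] by simp
  show "(a *\<^sub>R S + T) $ (i, k, j) = - (a *\<^sub>R S + T) $ (i, j, k)"
    using alternatingD(2)[OF S, of i k j] alternatingD(2)[OF T, of i k j] by simp
qed

lemma act_nth: "act A T $ (i, j, k) = tform T [A *v axis i 1, axis j 1, axis k 1] +
    tform T [axis i 1, A *v axis j 1, axis k 1] + tform T [axis i 1, axis j 1, A *v axis k 1]"
  by (simp add: act_def act_form_def)

lemma linear_act: "linear (\<lambda>A. act A T)"
proof (rule linearI_combination)
  fix a and A B :: "real ^ 'a ^ 'a"
  have "(a *\<^sub>R A + B) *v x = a *\<^sub>R (A *v x) + B *v x" for x
    by (simp add: matrix_vector_mult_add_rdistrib scaleR_matrix_vector_assoc)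
  then have "act (a *\<^sub>R A + B) T $ (i, j, k) = (a *\<^sub>R act A T + act B T) $ (i, j, k)" for i j k
    by (simp add: act_nth tform_linear1 tform_linear2 tform_linear3 distrib_left)
  then show "act (a *\<^sub>R A + B) T = a *\<^sub>R act A T + act B T"
    by (simp add: vec_eq_iff split_paired_all)
qed

text \<open>Adding the non-alternating part of a second variable makes the map from pairs onto the
  space of all tensors, so linear algebra on whole types provides a right inverse. Applying
  \<open>alternate\<close> afterwards removes the added part.\<close>

lemma submersive_right_inverse:
  assumes "submersive T" "alternating T"
  obtains R where "linear R" "\<And>S. act (R S) T = alternate S"
proof -
  define \<Phi> where "\<Phi> = (\<lambda>(A, S). act A T + (S - alternate S))"
  have "linear \<Phi>"
    unfolding \<Phi>_def case_prod_beta
    by (intro linear_compose_add linear_compose_sub linear_compose[OF linear_fst linear_act, unfolded o_def]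
        linear_snd linear_compose[OF linear_snd linear_alternate, unfolded o_def])
  moreover have "surj \<Phi>"
  proof -
    have "\<exists>p. \<Phi> p = S" for S
    proof -
      obtain A where "act A T = alternate S"
        using assms(1) alternating_alternate unfolding submersive_def by blast
      then have "\<Phi> (A, S) = S" by (simp add: \<Phi>_def)
      then show ?thesis ..
    qed
    then show ?thesis by (metis surjI)
  qed
  ultimately obtain G where G: "linear G" "\<Phi> \<circ> G = id"
    using linear_surjective_right_inverse by blast
  have "act (fst (G S)) T = alternate S" for S
  proof -
    have "act (fst (G S)) T + (snd (G S) - alternate (snd (G S))) = S"
      using fun_cong[OF G(2), of S] by (simp add: \<Phi>_def case_prod_beta)
    then have "alternate (act (fst (G S)) T + (snd (G S) - alternate (snd (G S)))) = alternate S" by simp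
    then show ?thesis
      by (simp add: linear_add[OF linear_alternate] linear_diff[OF linear_alternate]
          alternate_alternating[OF alternating_alternate] alternate_alternating[OF alternating_act[OF assms(2)]])
  qed
  moreover have "linear (\<lambda>S. fst (G S))"
    using linear_compose[OF G(1) linear_fst] by (simp add: o_def)
  ultimately show thesis by (rule that[rotated])
qed

lemma smooth_on_tform:
  fixes T :: "'n::finite tensor" and u v w :: "'a::euclidean_space \<Rightarrow> real ^ 'n"
  assumes "open X" "smooth_on X u" "smooth_on X v" "smooth_on X w"
  shows "smooth_on X (\<lambda>x. tform T [u x, v x, w x])"
proof -
  have nth: "smooth_on X (\<lambda>x. f x $ i)" if "smooth_on X f" for f :: "'a \<Rightarrow> real ^ 'n" and i
    using that smooth_on_vec_iff[OF assms(1), of f] by simp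
  have "smooth_on X (\<lambda>x. \<Sum>i\<in>UNIV. \<Sum>j\<in>UNIV. \<Sum>k\<in>UNIV. T $ (i, j, k) * u x $ i * v x $ j * w x $ k)"
    by (intro smooth_on_sum smooth_on_mult smooth_on_const nth assms finite)
  then show ?thesis by (simp add: tform_def)
qed

text \<open>The correction \<open>S - alternate S\<close> extends the orbit map, defined on the slice \<open>1 + R S\<close>, to a local
  diffeomorphism of the space of all tensors.\<close>

lemma orbit_local_section:
  fixes T :: "'n::finite tensor"
  assumes T: "alternating T" "submersive T"
  obtains V G where "open V" "T \<in> V" "\<And>i j. smooth_on V (\<lambda>S. G S $ i $ j)"
    "\<And>S. S \<in> V \<Longrightarrow> det (G S) \<noteq> 0" "\<And>S. S \<in> V \<Longrightarrow> alternating S \<Longrightarrow> pb (G S) T = S"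
proof -
  obtain R where R: "linear R" "\<And>S. act (R S) T = alternate S"
    using submersive_right_inverse[OF T(2,1)] by blast
  define W where "W S = mat 1 + R S" for S
  define F where "F S = pb (W S) T + (S - alternate S)" for S
  have bl: "bounded_linear (\<lambda>S. R S *v x)" for x
    using linear_compose[OF R(1) linearI_combination[of "\<lambda>A :: real ^ 'n ^ 'n. A *v x"]]
    by (simp add: o_def matrix_vector_mult_add_rdistrib scaleR_matrix_vector_assoc linear_conv_bounded_linear)
  have bla: "bounded_linear (alternate :: 'n tensor \<Rightarrow> _)"
    using linear_alternate by (simp add: linear_conv_bounded_linear)
  have Wv: "W S *v x = x + R S *v x" for S x by (simp add: W_def matrix_vector_mult_add_rdistrib)
  have smid: "smooth_on UNIV (\<lambda>S :: 'n tensor. S)"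
  proof -
    have "Ck_on k UNIV (\<lambda>S :: 'n tensor. S)" for k
    proof (cases k)
      case (Suc l)
      show ?thesis unfolding Suc by (rule Ck_on_SucI[OF open_UNIV has_derivative_ident]) (rule Ck_on_const[OF open_UNIV])
    qed simp
    then show ?thesis by (simp add: smooth_on_def)
  qed
  have smW: "smooth_on UNIV (\<lambda>S. W S *v x)" for x
    unfolding Wv by (intro smooth_on_add smooth_on_const open_UNIV smooth_on_bounded_linear[OF open_UNIV bl smid])
  have smF: "smooth_on UNIV F"
    unfolding smooth_on_vec_iff[OF open_UNIV]
  proof
    fix p :: "'n \<times> 'n \<times> 'n"
    obtain i j k where p: "p = (i, j, k)" by (metis prod.exhaust)
    have "smooth_on UNIV (\<lambda>S :: 'n tensor. S + (- 1) *\<^sub>R alternate S)"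
      by (intro smooth_on_add smid smooth_on_scaleR smooth_on_const open_UNIV smooth_on_bounded_linear[OF open_UNIV bla smid])
    then have "smooth_on UNIV (\<lambda>S :: 'n tensor. (S + (- 1) *\<^sub>R alternate S) $ p)"
      unfolding smooth_on_vec_iff[OF open_UNIV] by (rule spec)
    then have "smooth_on UNIV (\<lambda>S. tform T [W S *v axis i 1, W S *v axis j 1, W S *v axis k 1] + (S + (- 1) *\<^sub>R alternate S) $ p)"
      by (intro smooth_on_add open_UNIV smooth_on_tform smW)
    then show "smooth_on UNIV (\<lambda>S. F S $ p)" by (simp add: F_def p pb_def)
  qed
  have R0: "R 0 = 0" using R(1) by (rule linear_0)
  have W0: "W 0 = mat 1" by (simp add: W_def R0)
  have F0: "F 0 = T" by (simp add: F_def W0 pb_mat_1 linear_0[OF linear_alternate])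
  have dW: "((\<lambda>S. W S *v x) has_derivative (\<lambda>S. R S *v x)) (at 0)" for x
    unfolding Wv using has_derivative_add[OF has_derivative_const bounded_linear_imp_has_derivative[OF bl]] by simp
  have dF: "(F has_derivative (\<lambda>S. S)) (at 0)"
    unfolding has_derivative_componentwise_within[of F]
  proof
    fix b :: "'n tensor" assume "b \<in> Basis"
    then obtain p where b: "b = axis p 1" by (auto simp: Basis_vec_def)
    obtain i j k where p: "p = (i, j, k)" by (metis prod.exhaust)
    have d: "((\<lambda>S. tform T [W S *v axis i 1, W S *v axis j 1, W S *v axis k 1] + (S - alternate S) $ p) has_derivative
       (\<lambda>S. (tform T [R S *v axis i 1, W 0 *v axis j 1, W 0 *v axis k 1] +
          tform T [W 0 *v axis i 1, R S *v axis j 1, W 0 *v axis k 1] +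
          tform T [W 0 *v axis i 1, W 0 *v axis j 1, R S *v axis k 1]) + (S - alternate S) $ p)) (at 0)"
      by (intro has_derivative_add has_derivative_tform dW bounded_linear_imp_has_derivative
          bounded_linear_compose[OF bounded_linear_vec_nth] bounded_linear_sub bounded_linear_ident bla)
    have e: "(tform T [R S *v axis i 1, W 0 *v axis j 1, W 0 *v axis k 1] +
          tform T [W 0 *v axis i 1, R S *v axis j 1, W 0 *v axis k 1] +
          tform T [W 0 *v axis i 1, W 0 *v axis j 1, R S *v axis k 1]) + (S - alternate S) $ p = S $ p" for S
      using R(2)[of S] act_nth[of "R S" T i j k] by (simp add: W0 p)
    have "(\<lambda>S. F S \<bullet> b) = (\<lambda>S. tform T [W S *v axis i 1, W S *v axis j 1, W S *v axis k 1] + (S - alternate S) $ p)"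
      "(\<lambda>S. S \<bullet> b) = (\<lambda>S. S $ p)"
      by (simp_all add: b F_def p pb_def inner_axis)
    then show "((\<lambda>S. F S \<bullet> b) has_derivative (\<lambda>S. S \<bullet> b)) (at 0)"
      using has_derivative_eq_rhs[OF d ext[OF e]] by (simp only:)
  qed
  obtain V H where V: "open V" "F 0 \<in> V" "H (F 0) = 0" "smooth_on V H" "\<And>S. S \<in> V \<Longrightarrow> F (H S) = S"
    using smooth_local_inverse[OF smF dF] by blast
  define G where "G S = W (H S)" for S
  have smG: "smooth_on V (\<lambda>S. G S $ i $ j)" for i j
  proof -
    have "smooth_on V (\<lambda>S. W (H S) *v axis j 1)"
      by (rule smooth_on_compose[OF V(1) open_UNIV smW V(4) subset_UNIV])
    then have "smooth_on V (\<lambda>S. (W (H S) *v axis j 1) $ i)"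
      unfolding smooth_on_vec_iff[OF V(1)] by (rule spec)
    then show ?thesis by (simp add: G_def matrix_vector_mult_basis column_def)
  qed
  define U where "U = V \<inter> (\<lambda>S. det (G S)) -` (- {0})"
  \<comment> \<open>\<open>G T\<close> is the identity matrix, so the determinant stays nonzero on a
    neighbourhood of T.\<close>
  have "open U" unfolding U_def
    by (rule continuous_open_preimage[OF smooth_on_imp_continuous_on[OF smooth_on_det[OF V(1) smG]] V(1)]) auto
  moreover have "T \<in> U" using V(2,3) by (simp add: U_def F0 G_def W0)
  moreover have "smooth_on U (\<lambda>S. G S $ i $ j)" for i j
    by (rule smooth_on_subset[OF smG]) (simp add: U_def)
  moreover have "det (G S) \<noteq> 0" if "S \<in> U" for S using that by (simp add: U_def)
  moreover have "pb (G S) T = S" if "S \<in> U" "alternating S" for S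
  proof -
    have "F (H S) = S" using that V(5) by (simp add: U_def)
    then have eq: "pb (G S) T + (H S - alternate (H S)) = S" by (simp add: F_def G_def)
    \<comment> \<open>Both S and the pullback are alternating, so projecting with
      \<open>alternate\<close> fixes them and kills the correction term.\<close>
    then have "alternate (pb (G S) T + (H S - alternate (H S))) = alternate S" by simp
    then show ?thesis
      by (simp add: linear_add[OF linear_alternate] linear_diff[OF linear_alternate] that
          alternate_alternating[OF alternating_alternate] alternate_alternating[OF alternating_pb[OF T(1)]]
          alternate_alternating)
  qed
  ultimately show thesis by (rule that)
qed

section \<open>Stable forms\<close>

text \<open>Openness of the orbit relative to the alternating tensors, stated in metric form at the
  single point T.\<close>

definition stable_tensor :: "'n::finite tensor \<Rightarrow> bool" where
  "stable_tensor T \<longleftrightarrow> alternating T \<and>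
     (\<exists>e>0. \<forall>S. alternating S \<and> dist S T < e \<longrightarrow> (\<exists>g. det g \<noteq> 0 \<and> S = pb g T))"

text \<open>The index order makes \<open>gram T *v u\<close> the list of values of
  \<open>Bf T u\<close> on the standard basis.\<close>

definition gram :: "'n::finite tensor \<Rightarrow> real ^ 'n ^ 'n" where
  "gram T = (\<chi> i j. Bf T (axis j 1) (axis i 1))"

lemma linear_axis_expansion:
  fixes f :: "real ^ 'n::finite \<Rightarrow> 'b::real_vector"
  assumes "linear f"
  shows "f u = (\<Sum>j\<in>UNIV. u $ j *\<^sub>R f (axis j 1))"
proof -
  have "u = (\<Sum>j\<in>UNIV. u $ j *\<^sub>R axis j 1)"
    by (simp add: basis_expansion scalar_mult_eq_scaleR[symmetric])
  then have "f u = f (\<Sum>j\<in>UNIV. u $ j *\<^sub>R axis j 1)" by (rule arg_cong)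
  then show ?thesis by (simp add: linear_sum[OF assms] linear_scale[OF assms])
qed

lemma gram_mult: "(gram T *v u) $ i = Bf T u (axis i 1)"
  using linear_axis_expansion[OF linear_Bf(2)[of T "axis i 1"], of u]
  by (simp add: gram_def matrix_vector_mult_def mult.commute)

lemma Bf_eq_inner: "Bf T u z = (gram T *v u) \<bullet> z"
  using linear_axis_expansion[OF linear_Bf(1)[of T u], of z]
  by (simp add: gram_mult inner_vec_def mult.commute)

lemma nondegenerate_iff: "nondegenerate T \<longleftrightarrow> det (gram T) \<noteq> 0"
proof -
  have "(\<forall>z. Bf T u z = 0) \<longleftrightarrow> gram T *v u = 0" for u
    unfolding Bf_eq_inner by (metis inner_eq_zero_iff inner_zero_left)
  then have "nondegenerate T \<longleftrightarrow> (\<exists>B. B ** gram T = mat 1)"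
    by (simp add: nondegenerate_def matrix_left_invertible_ker)
  also have "\<dots> \<longleftrightarrow> det (gram T) \<noteq> 0"
    by (metis invertible_det_nz invertible_def matrix_left_right_inverse)
  finally show ?thesis .
qed

lemma real_polynomial_function_det:
  assumes "\<And>i j. real_polynomial_function (\<lambda>T. M T $ i $ j)"
  shows "real_polynomial_function (\<lambda>T. det (M T :: real ^ 'k ^ 'k))"
  unfolding det_def
  by (intro real_polynomial_function_sum real_polynomial_function.intros(2,4) real_polynomial_function_prod
      assms finite_permutations finite)

lemma real_polynomial_function_gram: "real_polynomial_function (\<lambda>T. gram T $ i $ j)"
  by (simp add: gram_def real_polynomial_function_Bf)

lemma real_polynomial_function_on_line:
  assumes "real_polynomial_function P"
  shows "real_polynomial_function (\<lambda>t :: real. P (S + t *\<^sub>R D))"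
proof -
  have "polynomial_function (\<lambda>t :: real. S + t *\<^sub>R D)"
    by (intro polynomial_function_add polynomial_function_const polynomial_function_bounded_linear
        bounded_linear_scaleR_left)
  from real_polynomial_function_compose[OF this assms] show ?thesis by (simp add: o_def)
qed

lemma real_polynomial_function_finite_zeros:
  fixes p :: "real \<Rightarrow> real"
  assumes "real_polynomial_function p" "p s \<noteq> 0"
  shows "finite {t. p t = 0}"
proof -
  obtain a n where p: "p = (\<lambda>x. \<Sum>i\<le>n. a i * x ^ i)"
    using assms(1) real_polynomial_function_iff_sum by blast
  then have "\<exists>i\<le>n. a i \<noteq> 0" using assms(2) by (metis (no_types, lifting) mult_zero_left sum.neutral atMost_iff)
  then show ?thesis unfolding p by (simp add: polyfun_finite_roots)
qed

lemma alternating_segment: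
  assumes "alternating S" "alternating T"
  shows "alternating (S + t *\<^sub>R (T - S))"
proof -
  have "S + t *\<^sub>R (T - S) = t *\<^sub>R T + ((1 - t) *\<^sub>R S + 0)" by (simp add: algebra_simps)
  moreover have "alternating 0" by (simp add: alternating_def)
  ultimately show ?thesis using alternating_linear assms by metis
qed

text \<open>An open orbit meets the complement of every proper algebraic subset. This transfers open conditions
  from the model to stable forms, which need not be equivalent to the model over the reals.\<close>

lemma stable_tensor_generic:
  fixes T :: "'n::finite tensor"
  assumes T: "stable_tensor T" and P: "real_polynomial_function P" and S: "alternating S" "P S \<noteq> 0"
  obtains g where "det g \<noteq> 0" "P (pb g T) \<noteq> 0"
proof -
  obtain e where e: "e > 0" "\<And>S. alternating S \<Longrightarrow> dist S T < e \<Longrightarrow> \<exists>g. det g \<noteq> 0 \<and> S = pb g T"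
    using T unfolding stable_tensor_def by blast
  \<comment> \<open>For 0 < t < d the point T + t (S - T) stays within e of T, hence in the orbit;
    adding 1 avoids a division by zero when S = T.\<close>
  define d where "d = e / (norm (S - T) + 1)"
  have d: "d > 0" using e(1) by (simp add: d_def add_nonneg_pos)
  have "finite {t. P (T + t *\<^sub>R (S - T)) = 0}"
    by (rule real_polynomial_function_finite_zeros[where p = "\<lambda>t. P (T + t *\<^sub>R (S - T))" and s = 1])
       (use S real_polynomial_function_on_line[OF P] in simp_all)
  moreover have "infinite {0<..<d}" using d by simp
  ultimately have "\<not> {0<..<d} \<subseteq> {t. P (T + t *\<^sub>R (S - T)) = 0}"
    by (metis infinite_super)
  then obtain t where t: "t \<in> {0<..<d}" "P (T + t *\<^sub>R (S - T)) \<noteq> 0"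
    by (auto simp only: subset_iff mem_Collect_eq)
  have "t * norm (S - T) \<le> t * (norm (S - T) + 1)" using t by simp
  also have "\<dots> < d * (norm (S - T) + 1)" using t by (intro mult_strict_right_mono) (auto simp: add_nonneg_pos)
  also have "\<dots> = e" by (simp add: d_def add_nonneg_eq_0_iff)
  finally have "dist (T + t *\<^sub>R (S - T)) T < e" using t by (simp add: dist_norm)
  moreover have "alternating (T + t *\<^sub>R (S - T))"
    using T alternating_segment[OF _ S(1), of T t] by (simp add: stable_tensor_def)
  ultimately show thesis using e(2) t that by metis
qed

lemma nondegenerate_pb:
  fixes T :: "'n::finite tensor"
  assumes n: "CARD('n) = 7 \<or> CARD('n) = 8" and T: "alternating T" and g: "det g \<noteq> 0"
  shows "nondegenerate (pb g T) \<longleftrightarrow> nondegenerate T"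
proof -
  from g obtain h where h: "g ** h = mat 1" "h ** g = mat 1" by (metis invertible_det_nz invertible_def)
  have gh: "g *v (h *v u) = u" "h *v (g *v u) = u" for u by (simp_all add: matrix_vector_mul_assoc h)
  have B: "Bf (pb g T) x y = 0 \<longleftrightarrow> Bf T (g *v x) (g *v y) = 0" for x y
    using g by (simp add: Bf_pb[OF n T g])
  have "(\<forall>z. Bf (pb g T) u z = 0) \<longleftrightarrow> (\<forall>z. Bf T (g *v u) z = 0)" for u
    unfolding B by (metis gh(1))
  then show ?thesis unfolding nondegenerate_def by (metis gh matrix_vector_mult_0_right)
qed

text \<open>Equivariance of the infinitesimal action: pulling back by g conjugates A.\<close>

lemma act_pb:
  assumes T: "alternating T" and h: "g ** h = mat 1" "h ** g = mat 1"
  shows "act A (pb g T) = pb g (act (g ** A ** h) T)"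
proof (rule tform_eqI)
  have hg: "h *v (g *v x) = x" for x by (simp add: matrix_vector_mul_assoc h)
  show "tform (act A (pb g T)) [x, y, z] = tform (pb g (act (g ** A ** h) T)) [x, y, z]" for x y z
    by (simp add: tform_act[OF alternating_pb[OF T]] tform_pb[OF alternating_act[OF T]] tform_act[OF T]
        act_form_def tform_pb[OF T] matrix_vector_mul_assoc[symmetric] hg)
qed

lemma submersive_pb:
  assumes T: "alternating T" and g: "det g \<noteq> 0" and sub: "submersive (pb g T)"
  shows "submersive T"
  unfolding submersive_def
proof (intro allI impI)
  from g obtain h where h: "g ** h = mat 1" "h ** g = mat 1" by (metis invertible_det_nz invertible_def)
  fix S :: "'a tensor" assume S: "alternating S"
  from sub obtain A where A: "act A (pb g T) = pb g S"
    using alternating_pb[OF S] unfolding submersive_def by blast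
  have "pb h (pb g (act (g ** A ** h) T)) = pb h (pb g S)"
    using A by (simp add: act_pb[OF T h])
  then have "act (g ** A ** h) T = S"
    by (simp add: pb_pb alternating_act[OF T] S h pb_mat_1)
  then show "\<exists>A. act A T = S" ..
qed

lemma stable_nondegenerate:
  fixes T :: "'n::finite tensor"
  assumes n: "CARD('n) = 7 \<or> CARD('n) = 8" and T: "stable_tensor T"
  shows "nondegenerate T"
proof -
  have "real_polynomial_function (\<lambda>T :: 'n tensor. det (gram T))"
    by (rule real_polynomial_function_det[OF real_polynomial_function_gram])
  moreover have "det (gram (model :: 'n tensor)) \<noteq> 0"
    using n nondegenerate_model_7 nondegenerate_model_8 nondegenerate_iff by blast
  ultimately obtain g where "det g \<noteq> 0" "det (gram (pb g T)) \<noteq> 0"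
    using stable_tensor_generic[OF T _ alternating_model] by metis
  then show ?thesis
    using nondegenerate_pb[OF n, of T g] nondegenerate_iff T unfolding stable_tensor_def by blast
qed

text \<open>A rank condition becomes one polynomial. With R a right inverse for the model,
  \<open>N S\<close> is an endomorphism of all tensors that depends linearly on S and is the
  identity at the model. Its determinant is then nonzero somewhere on the orbit of T; there
  \<open>N\<close> is invertible, so \<open>act\<close> is onto the alternating tensors, and this is
  carried back to T by \<open>submersive_pb\<close>.\<close>

lemma stable_submersive:
  fixes T :: "'n::finite tensor"
  assumes n: "CARD('n) = 7 \<or> CARD('n) = 8" and T: "stable_tensor T"
  shows "submersive T"
proof -
  obtain R where R: "linear R" "\<And>S. act (R S) (model :: 'n tensor) = alternate S"
    using submersive_right_inverse[OF submersive_model[OF n] alternating_model] by blast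
  define N where "N S U = act (R U) S + (U - alternate U)" for S U :: "'n tensor"
  have linN: "linear (N S)" for S
    unfolding N_def
    by (intro linear_compose_add linear_compose_sub linear_compose[OF R(1) linear_act, unfolded o_def]
        linear_ident linear_alternate)
  have "real_polynomial_function (\<lambda>S. matrix (N S) $ p $ q)" for p q
  proof -
    obtain i j k where p: "p = (i, j, k)" by (metis prod.exhaust)
    show ?thesis
      unfolding matrix_def N_def p
      by (simp add: act_nth)
         (intro real_polynomial_function.intros(2,3) real_polynomial_function_diff real_polynomial_function_tform)
  qed
  then have "real_polynomial_function (\<lambda>S. det (matrix (N S)))"
    by (rule real_polynomial_function_det)
  moreover have "N model = (\<lambda>U. U)" by (simp add: fun_eq_iff N_def R(2))
  then have "matrix (N model) = mat 1" by (simp add: matrix_def mat_def axis_def vec_eq_iff)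
  ultimately obtain g where g: "det g \<noteq> 0" "det (matrix (N (pb g T))) \<noteq> 0"
    using stable_tensor_generic[OF T, of "\<lambda>S. det (matrix (N S))" model] alternating_model
    by (metis det_I zero_neq_one)
  have alt: "alternating T" using T by (simp add: stable_tensor_def)
  have "submersive (pb g T)"
    unfolding submersive_def
  proof (intro allI impI)
    fix S :: "'n tensor" assume S: "alternating S"
    obtain B where "matrix (N (pb g T)) ** B = mat 1" using g(2) by (metis invertible_det_nz invertible_def)
    then have "matrix (N (pb g T)) *v (B *v S) = S" by (simp add: matrix_vector_mul_assoc)
    then have "N (pb g T) (B *v S) = S" using fun_cong[OF matrix_vector_mul(2)[OF linN]] by metis
    then have "alternate (N (pb g T) (B *v S)) = alternate S" by simp
    then have "act (R (B *v S)) (pb g T) = S"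
      by (simp add: N_def linear_add[OF linear_alternate] linear_diff[OF linear_alternate]
          alternate_alternating[OF alternating_alternate] alternate_alternating[OF S]
          alternate_alternating[OF alternating_act[OF alternating_pb[OF alt]]])
    then show "\<exists>A. act A (pb g T) = S" ..
  qed
  then show ?thesis using submersive_pb[OF alt g(1)] by blast
qed

subsection \<open>The product\<close>

lemma Bf_eqI: "nondegenerate T \<Longrightarrow> (\<And>z. Bf T u z = Bf T v z) \<Longrightarrow> u = v"
proof -
  assume *: "nondegenerate T" "\<And>z. Bf T u z = Bf T v z"
  have "Bf T (u - v) z = 0" for z using *(2)[of z] linear_diff[OF linear_Bf(2)[of T z], of u v] by simp
  then have "u - v = 0" using *(1) unfolding nondegenerate_def by blast
  then show "u = v" by simp
qed

lemma product_of_unique: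
  assumes "nondegenerate T" "product_of T m" "\<And>z. Bf T u z = tform T [x, y, z]"
  shows "u = m x y"
proof (rule Bf_eqI[OF assms(1)])
  show "Bf T u z = Bf T (m x y) z" for z
    using assms(2) assms(3)[of z] unfolding product_of_def by metis
qed

lemma product_of_exists:
  assumes "nondegenerate T"
  obtains m where "product_of T m"
proof -
  obtain B where B: "gram T ** B = mat 1"
    using assms nondegenerate_iff by (metis invertible_det_nz invertible_def)
  define m where "m x y = B *v (\<chi> i. tform T [x, y, axis i 1])" for x y
  have "Bf T (m x y) z = tform T [x, y, z]" for x y z
  proof -
    have "gram T *v m x y = (\<chi> i. tform T [x, y, axis i 1])"
      by (simp add: m_def matrix_vector_mul_assoc B)
    then show ?thesis
      using linear_axis_expansion[OF linear_tform(3)[of T x y], of z]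
      by (simp add: Bf_eq_inner inner_vec_def mult.commute)
  qed
  then have "product_of T m" by (simp add: product_of_def)
  then show thesis by (rule that)
qed

lemma product_of_linear:
  assumes "nondegenerate T" "product_of T m"
  shows "linear (m x)" "linear (\<lambda>x. m x y)"
proof -
  have m: "Bf T (m x y) z = tform T [x, y, z]" for x y z using assms(2) by (simp add: product_of_def)
  have B: "Bf T (a *\<^sub>R u + v) z = a * Bf T u z + Bf T v z" for a u v z
    by (simp add: linear_add[OF linear_Bf(2)] linear_scale[OF linear_Bf(2)])
  show "linear (m x)" "linear (\<lambda>x. m x y)"
    by (rule linearI_combination, rule Bf_eqI[OF assms(1)], simp add: B m tform_linear1 tform_linear2)+
qed

text \<open>Under pullback the bilinear form picks up a power of \<open>det g\<close> and the 3-form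
  does not, so g intertwines the two products up to the inverse of that power.\<close>

lemma product_of_pb:
  fixes T :: "'n::finite tensor"
  assumes n: "CARD('n) = 7 \<or> CARD('n) = 8" and T: "alternating T" and g: "det g \<noteq> 0"
    and nd: "nondegenerate T" and m: "product_of T m" and m': "product_of (pb g T) m'"
  shows "g *v m' x y = inverse (det g ^ weight TYPE('n)) *\<^sub>R m (g *v x) (g *v y)"
proof -
  from g obtain h where h: "g ** h = mat 1" "h ** g = mat 1" by (metis invertible_det_nz invertible_def)
  let ?c = "inverse (det g ^ weight TYPE('n))"
  have gh: "g *v (h *v u) = u" for u by (simp add: matrix_vector_mul_assoc h)
  have "h *v (?c *\<^sub>R m (g *v x) (g *v y)) = m' x y"
  proof (rule product_of_unique[OF _ m'])
    show "nondegenerate (pb g T)" using nd nondegenerate_pb[OF n T g] by simp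
    show "Bf (pb g T) (h *v (?c *\<^sub>R m (g *v x) (g *v y))) z = tform (pb g T) [x, y, z]" for z
      using m g by (simp add: Bf_pb[OF n T g] gh linear_scale[OF linear_Bf(2)] product_of_def tform_pb[OF T])
  qed
  then show ?thesis by (metis gh)
qed

text \<open>Both sides of the Malcev identity are cubic in the product, so the factor c enters each
  of them as its cube.\<close>

lemma malcev_identity_scaled_iso:
  fixes m m' :: "'v::real_vector \<Rightarrow> 'v \<Rightarrow> 'v"
  assumes m: "malcev_identity m" "\<And>x. linear (m x)" "\<And>y. linear (\<lambda>x. m x y)"
    and f: "linear f" "inj f" and eq: "\<And>x y. f (m' x y) = c *\<^sub>R m (f x) (f y)"
  shows "malcev_identity m'"
  unfolding malcev_identity_def
proof (intro allI)
  fix x y z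
  have l: "m (a *\<^sub>R u) v = a *\<^sub>R m u v" "m u (a *\<^sub>R v) = a *\<^sub>R m u v" for a u v
    using linear_scale[OF m(2)] linear_scale[OF m(3)] by blast+
  have "f (m' (m' x y) (m' x z)) = (c * (c * c)) *\<^sub>R m (m (f x) (f y)) (m (f x) (f z))"
    by (simp add: eq l)
  also have "m (m (f x) (f y)) (m (f x) (f z)) = m (m (m (f x) (f y)) (f z)) (f x) +
      m (m (m (f y) (f z)) (f x)) (f x) + m (m (m (f z) (f x)) (f x)) (f y)"
    using m(1) unfolding malcev_identity_def by blast
  also have "(c * (c * c)) *\<^sub>R \<dots> =
      f (m' (m' (m' x y) z) x + m' (m' (m' y z) x) x + m' (m' (m' z x) x) y)"
    by (simp add: linear_add[OF f(1)] eq l scaleR_add_right)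
  finally show "m' (m' x y) (m' x z) = m' (m' (m' x y) z) x + m' (m' (m' y z) x) x + m' (m' (m' z x) x) y"
    using f(2) by (simp add: inj_def)
qed

text \<open>By Cramer's rule, \<open>det (gram T)\<close> times the product depends polynomially on \<open>T\<close>.\<close>

definition cramer_product :: "'n::finite tensor \<Rightarrow> real ^ 'n \<Rightarrow> real ^ 'n \<Rightarrow> real ^ 'n" where
  "cramer_product T u v = (\<Sum>a\<in>UNIV. \<Sum>b\<in>UNIV. (u $ a * v $ b) *\<^sub>R
     (\<chi> k. det (\<chi> i j. if j = k then tform T [axis a 1, axis b 1, axis i 1] else gram T $ i $ j)))"

lemma cramer_product:
  assumes nd: "nondegenerate T" and m: "product_of T m"
  shows "cramer_product T u v = det (gram T) *\<^sub>R m u v"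
proof -
  have basis: "(\<chi> k. det (\<chi> i j. if j = k then tform T [axis a 1, axis b 1, axis i 1] else gram T $ i $ j)) =
      det (gram T) *\<^sub>R m (axis a 1) (axis b 1)" for a b
  proof -
    have "gram T *v m (axis a 1) (axis b 1) = (\<chi> i. tform T [axis a 1, axis b 1, axis i 1])"
      using m by (simp add: vec_eq_iff gram_mult product_of_def)
    then show ?thesis
      using cramer[of "gram T" "m (axis a 1) (axis b 1)" "\<chi> i. tform T [axis a 1, axis b 1, axis i 1]", unfolded vec_lambda_beta] nd
      by (simp add: nondegenerate_iff vec_eq_iff)
  qed
  have "m u v = (\<Sum>a\<in>UNIV. u $ a *\<^sub>R (\<Sum>b\<in>UNIV. v $ b *\<^sub>R m (axis a 1) (axis b 1)))"
  proof -
    have "m (axis a 1) v = (\<Sum>b\<in>UNIV. v $ b *\<^sub>R m (axis a 1) (axis b 1))" for a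
      by (rule linear_axis_expansion[OF product_of_linear(1)[OF nd m]])
    then show ?thesis
      using linear_axis_expansion[OF product_of_linear(2)[OF nd m, of v], of u] by simp
  qed
  then show ?thesis
    by (simp add: cramer_product_def basis scaleR_sum_right mult_ac)
qed

lemma real_polynomial_function_cramer_product:
  fixes u v :: "'n::finite tensor \<Rightarrow> real ^ 'n"
  assumes "\<And>a. real_polynomial_function (\<lambda>T. u T $ a)" "\<And>b. real_polynomial_function (\<lambda>T. v T $ b)"
  shows "real_polynomial_function (\<lambda>T. cramer_product T (u T) (v T) $ i)"
proof -
  have "real_polynomial_function (\<lambda>T :: 'n tensor.
      det (\<chi> i j. if j = k then tform T [axis a 1, axis b 1, axis i 1] else gram T $ i $ j))" for a b k
  proof (rule real_polynomial_function_det)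
    show "real_polynomial_function (\<lambda>T. (\<chi> i j. if j = k then tform T [axis a 1, axis b 1, axis i 1] else gram T $ i $ j) $ p $ q)" for p q
      by (cases "q = k") (simp_all add: real_polynomial_function_tform real_polynomial_function_gram)
  qed
  then show ?thesis
    unfolding cramer_product_def
    by (simp add: sum_component) (intro real_polynomial_function_sum real_polynomial_function.intros(4) assms finite)
qed

text \<open>With the product replaced by its multiple by \<open>det (gram T)\<close>, the failure of
  the identity is multiplied by the cube of this determinant and becomes polynomial in T.\<close>

definition malcev_defect :: "'n::finite tensor \<Rightarrow> real ^ 'n \<Rightarrow> real ^ 'n \<Rightarrow> real ^ 'n \<Rightarrow> real ^ 'n" where
  "malcev_defect T x y z = (let m = cramer_product T in
     m (m x y) (m x z) - (m (m (m x y) z) x + m (m (m y z) x) x + m (m (m z x) x) y))"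

lemma malcev_defect_eq_0_iff:
  assumes nd: "nondegenerate T" and m: "product_of T m"
  shows "malcev_identity m \<longleftrightarrow> (\<forall>x y z. malcev_defect T x y z = 0)"
proof -
  let ?d = "det (gram T)"
  have l: "m (a *\<^sub>R u) v = a *\<^sub>R m u v" "m u (a *\<^sub>R v) = a *\<^sub>R m u v" for a u v
    using linear_scale[OF product_of_linear(1)[OF nd m]] linear_scale[OF product_of_linear(2)[OF nd m]] by blast+
  have "malcev_defect T x y z = (?d * (?d * ?d)) *\<^sub>R
      (m (m x y) (m x z) - (m (m (m x y) z) x + m (m (m y z) x) x + m (m (m z x) x) y))" for x y z
    by (simp add: malcev_defect_def Let_def cramer_product[OF nd m] l scaleR_diff_right scaleR_add_right)
  then show ?thesis using nd by (simp add: malcev_identity_def nondegenerate_iff)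
qed

lemma real_polynomial_function_malcev_defect:
  "real_polynomial_function (\<lambda>T. malcev_defect T x y z $ i)"
  unfolding malcev_defect_def Let_def vector_minus_component vector_add_component
  by (intro real_polynomial_function_diff real_polynomial_function.intros(3) real_polynomial_function_cramer_product
      real_polynomial_function.intros(2))

text \<open>The local section at the model shows that all alternating tensors near the model lie in
  its orbit, so the defect vanishes there. On the line from the model to T it is a polynomial in t
  with infinitely many zeros, hence also zero at t = 1.\<close>

lemma malcev_product:
  fixes T :: "'n::finite tensor"
  assumes n: "CARD('n) = 7 \<or> CARD('n) = 8" and T: "alternating T" and nd: "nondegenerate T" and m: "product_of T m"
  shows "malcev_identity m"
proof -
  let ?M = "model :: 'n tensor"
  have ndM: "nondegenerate ?M" using n nondegenerate_model_7 nondegenerate_model_8 by blast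
  obtain V G where V: "open V" "?M \<in> V" "\<And>S. S \<in> V \<Longrightarrow> det (G S) \<noteq> 0"
      "\<And>S. S \<in> V \<Longrightarrow> alternating S \<Longrightarrow> pb (G S) ?M = S"
    using orbit_local_section[OF alternating_model submersive_model[OF n]] by metis
  have orbit: "malcev_defect S x y z = 0" if S: "S \<in> V" "alternating S" for S x y z
  proof -
    note g = V(3)[OF S(1)] and eq = V(4)[OF S]
    have nd': "nondegenerate S" using ndM nondegenerate_pb[OF n alternating_model g] eq by simp
    obtain mM where mM: "product_of ?M mM" using product_of_exists[OF ndM] .
    obtain mS where mS: "product_of S mS" using product_of_exists[OF nd'] .
    have "malcev_identity mM" using n malcev_model_7 malcev_model_8 mM by blast
    moreover have "inj ((*v) (G S))"
      using g by (metis inj_matrix_vector_mult invertible_det_nz)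
    ultimately have "malcev_identity mS"
      using product_of_pb[OF n alternating_model g ndM mM] mS eq
      by (intro malcev_identity_scaled_iso[of mM "(*v) (G S)" mS "inverse (det (G S) ^ weight TYPE('n))"])
         (auto simp: product_of_linear[OF ndM mM])
    then show ?thesis using malcev_defect_eq_0_iff[OF nd' mS] by blast
  qed
  have "malcev_defect T x y z $ i = 0" for x y z i
  proof (rule ccontr)
    define p where "p t = malcev_defect (?M + t *\<^sub>R (T - ?M)) x y z $ i" for t
    assume "malcev_defect T x y z $ i \<noteq> 0"
    then have "finite {t. p t = 0}"
      unfolding p_def
      by (intro real_polynomial_function_finite_zeros[where s = 1] real_polynomial_function_on_line
          real_polynomial_function_malcev_defect) simp
    moreover have "open ((\<lambda>t. ?M + t *\<^sub>R (T - ?M)) -` V)"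
      by (rule open_vimage[OF V(1)]) (intro continuous_intros)
    then obtain d where d: "d > 0" "ball 0 d \<subseteq> (\<lambda>t. ?M + t *\<^sub>R (T - ?M)) -` V"
      using V(2) by (metis (mono_tags, lifting) open_contains_ball vimage_eq scaleR_zero_left add_0_right)
    have "p t = 0" if "t \<in> ball 0 d" for t
    proof -
      have "alternating (?M + t *\<^sub>R (T - ?M))"
        by (rule alternating_segment[OF alternating_model T])
      then show ?thesis using orbit that d(2) by (auto simp: p_def)
    qed
    then have "ball 0 d \<subseteq> {t. p t = 0}" by blast
    moreover have "infinite (ball 0 d :: real set)" using d(1) by (simp add: ball_eq_greaterThanLessThan)
    ultimately show False using finite_subset by blast
  qed
  then have "malcev_defect T x y z = 0" for x y z by (simp add: vec_eq_iff)
  then show ?thesis using malcev_defect_eq_0_iff[OF nd m] by blast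
qed

section \<open>Simplicity\<close>

text \<open>Simplicity is read off from the submersivity of the orbit map: an ideal \<open>I\<close> and its orthogonal
  complement \<open>K\<close> satisfy \<open>T(I, K, \<cdot>) = 0\<close>, which confines the infinitesimal orbit to a proper subspace.\<close>

lemma family_dependent:
  fixes f :: "'i \<Rightarrow> 'a::euclidean_space"
  assumes J: "finite J" and f: "f ` J \<subseteq> R" and card: "card J > dim R"
  obtains c where "\<exists>p\<in>J. c p \<noteq> 0" "(\<Sum>p\<in>J. c p *\<^sub>R f p) = 0"
proof (cases "inj_on f J")
  case True
  then have "card (f ` J) > dim R" using card by (simp add: card_image)
  then have "dependent (f ` J)" using independent_card_le_dim[OF f] by fastforce
  then obtain u v where u: "v \<in> f ` J" "u v \<noteq> 0" "(\<Sum>v\<in>f ` J. u v *\<^sub>R v) = 0"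
    using dependent_finite[of "f ` J"] J by auto
  have "(\<Sum>p\<in>J. u (f p) *\<^sub>R f p) = 0" using u(3) by (simp add: sum.reindex[OF True])
  then show thesis using u that[of "\<lambda>p. u (f p)"] by blast
next
  case False
  then obtain p q where pq: "p \<in> J" "q \<in> J" "p \<noteq> q" "f p = f q" by (auto simp: inj_on_def)
  have "(\<Sum>r\<in>J. (if r = p then 1 else if r = q then - 1 else 0) *\<^sub>R f r) =
      (\<Sum>r\<in>J. if r = p then f p else 0) - (\<Sum>r\<in>J. if r = q then f q else 0)"
    unfolding sum_subtractf[symmetric] using pq(3) by (intro sum.cong) auto
  also have "\<dots> = 0" using pq J by simp
  finally show thesis using pq(1) by (intro that[of "\<lambda>r. if r = p then 1 else if r = q then - 1 else 0"]) auto
qed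

lemma dual_functional:
  fixes B :: "'a::real_vector set"
  assumes "independent B"
  obtains g :: "'a \<Rightarrow> real" where "linear g" "\<And>x. x \<in> B \<Longrightarrow> g x = (if x = b then 1 else 0)"
  using linear_independent_extend[OF assms, of "\<lambda>x. if x = b then 1 else 0 :: real"] by blast

lemma tform_cyclic:
  assumes "alternating T"
  shows "tform T [x, y, z] = tform T [y, z, x]"
  using alternating_tform[OF assms, of x y z] alternating_tform[OF assms, of y z x] by simp

lemma submersive_monomial:
  assumes T: "submersive T" "alternating T" and lin: "linear \<alpha>" "linear \<beta>" "linear \<gamma>"
  obtains A where "\<And>x y z. tform T [A *v x, y, z] + tform T [x, A *v y, z] + tform T [x, y, A *v z] =
    monomial_form [\<alpha>, \<beta>, \<gamma>] [x, y, z]"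
proof -
  note m = alt_forms_tensor_of[OF monomial_form_alt_forms[OF lin]]
  obtain A where A: "act A T = tensor_of (monomial_form [\<alpha>, \<beta>, \<gamma>])"
    using T(1) m(1) unfolding submersive_def by blast
  then have *: "act_form A T = monomial_form [\<alpha>, \<beta>, \<gamma>]"
    using tform_act[OF T(2), of A] m(2) by simp
  have "tform T [A *v x, y, z] + tform T [x, A *v y, z] + tform T [x, y, A *v z] =
      monomial_form [\<alpha>, \<beta>, \<gamma>] [x, y, z]" for x y z
    using fun_cong[OF *, of "[x, y, z]"] by (simp add: act_form_def)
  then show thesis by (rule that)
qed

lemma sum_lessThan_id: "2 * (\<Sum>j<e. j) = e * (e - 1)" for e :: nat
proof (induction e)
  case (Suc e)
  then show ?case by (cases e) (simp_all add: algebra_simps)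
qed simp

text \<open>There are more products of pairs from Y than \<open>dim R\<close>, so they satisfy a
  relation with some nonzero coefficient, say at the pair k, l. Submersivity gives A with
  \<open>act A T\<close> equal to the monomial dual to x, \<open>ys ! k\<close>,
  \<open>ys ! l\<close>. Evaluated on x and two elements of Y, every term that keeps x in place
  vanishes, so pairing a product with \<open>A *v x\<close> detects exactly the pair k, l. Pairing
  the relation with \<open>A *v x\<close> makes the chosen coefficient 0.\<close>

lemma submersive_counting:
  fixes T :: "'n::finite tensor"
  assumes T: "submersive T" "alternating T" and m: "product_of T m"
    and PQ: "\<And>p q z. p \<in> P \<Longrightarrow> q \<in> Q \<Longrightarrow> tform T [p, q, z] = 0"
    and x: "x \<in> P" and Y: "Y \<subseteq> Q" "finite Y" "independent (insert x Y)" "x \<notin> Y"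
    and R: "\<And>y y'. y \<in> Y \<Longrightarrow> y' \<in> Y \<Longrightarrow> m y y' \<in> R"
    and card: "2 * dim R < card Y * (card Y - 1)"
  shows False
proof -
  obtain ys where ys: "set ys = Y" "distinct ys" using finite_distinct_list[OF Y(2)] by blast
  define e where "e = length ys"
  have e: "e = card Y" using ys distinct_card by (force simp: e_def)
  define J where "J = (SIGMA j:{..<e}. {..<j})"
  define f where "f p = m (ys ! snd p) (ys ! fst p)" for p
  have "2 * card J = e * (e - 1)" unfolding J_def by (subst card_SigmaI) (simp_all add: sum_lessThan_id)
  then have cJ: "card J > dim R" using card unfolding e[symmetric] by linarith
  have fJ: "f ` J \<subseteq> R" by (auto simp: f_def J_def e_def ys(1)[symmetric] intro!: R)
  have "finite J" by (simp add: J_def)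
  then obtain c where c: "\<exists>p\<in>J. c p \<noteq> 0" "(\<Sum>p\<in>J. c p *\<^sub>R f p) = 0"
    using family_dependent[OF _ fJ cJ] by blast
  then obtain k l where kl: "(l, k) \<in> J" "c (l, k) \<noteq> 0" by auto
  obtain \<alpha> :: "real ^ 'n \<Rightarrow> real" where \<alpha>: "linear \<alpha>" "\<And>v. v \<in> insert x Y \<Longrightarrow> \<alpha> v = (if v = x then 1 else 0)"
    using dual_functional[OF Y(3), where b = x] by blast
  obtain \<beta> :: "real ^ 'n \<Rightarrow> real" where \<beta>: "linear \<beta>" "\<And>v. v \<in> insert x Y \<Longrightarrow> \<beta> v = (if v = ys ! k then 1 else 0)"
    using dual_functional[OF Y(3), where b = "ys ! k"] by blast
  obtain \<gamma> :: "real ^ 'n \<Rightarrow> real" where \<gamma>: "linear \<gamma>" "\<And>v. v \<in> insert x Y \<Longrightarrow> \<gamma> v = (if v = ys ! l then 1 else 0)"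
    using dual_functional[OF Y(3), where b = "ys ! l"] by blast
  obtain A where A: "\<And>x y z. tform T [A *v x, y, z] + tform T [x, A *v y, z] + tform T [x, y, A *v z] =
      monomial_form [\<alpha>, \<beta>, \<gamma>] [x, y, z]"
    using submersive_monomial[OF T \<alpha>(1) \<beta>(1) \<gamma>(1)] by blast
  have val: "Bf T (f p) (A *v x) = (if p = (l, k) then 1 else 0)" if p: "p \<in> J" for p
  proof -
    obtain i j where ij: "p = (j, i)" by force
    with p have lt: "i < j" "j < e" by (auto simp: J_def)
    have lt': "k < l" "l < e" using kl by (auto simp: J_def)
    let ?yi = "ys ! i" and ?yj = "ys ! j"
    have y: "?yi \<in> Y" "?yj \<in> Y" using lt ys by (auto simp: e_def)
    have eq: "?yi = ys ! k \<longleftrightarrow> i = k" "?yj = ys ! k \<longleftrightarrow> j = k" "?yi = ys ! l \<longleftrightarrow> i = l" "?yj = ys ! l \<longleftrightarrow> j = l"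
      using lt lt' ys(2) by (auto simp: e_def nth_eq_iff_index_eq)
    have "tform T [x, A *v ?yi, ?yj] = 0" "tform T [x, ?yi, A *v ?yj] = 0"
      using PQ[OF x] y Y(1) alternating_tform(2)[OF T(2), of x ?yj "A *v ?yi"] by auto
    then have "tform T [A *v x, ?yi, ?yj] = monomial_form [\<alpha>, \<beta>, \<gamma>] [x, ?yi, ?yj]"
      using A[of x ?yi ?yj] by simp
    also have "\<dots> = (if i = k \<and> j = l then 1 else 0)"
      using y Y(4) lt lt' by (auto simp: monomial_form_3 \<alpha>(2) \<beta>(2) \<gamma>(2) eq)
    finally show ?thesis
      using m tform_cyclic[OF T(2), of "A *v x" ?yi ?yj] by (auto simp: f_def ij product_of_def)
  qed
  have "0 = Bf T (\<Sum>p\<in>J. c p *\<^sub>R f p) (A *v x)" unfolding c(2) by (rule linear_0[OF linear_Bf(2), symmetric])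
  also have "\<dots> = (\<Sum>p\<in>J. c p * Bf T (f p) (A *v x))"
    by (simp add: linear_sum[OF linear_Bf(2)] linear_scale[OF linear_Bf(2)])
  also have "\<dots> = (\<Sum>p\<in>J. if p = (l, k) then c p else 0)"
    by (intro sum.cong refl) (simp add: val)
  also have "\<dots> = c (l, k)" using kl(1) \<open>finite J\<close> by simp
  finally show False using kl(2) by simp
qed

text \<open>With y in both P and Q, each term of the infinitesimal action at x, y, z retains one
  argument in P and another in Q. All three vanish, although the monomial dual to x, y, z takes the
  value 1.\<close>

lemma submersive_triple:
  fixes T :: "'n::finite tensor"
  assumes T: "submersive T" "alternating T"
    and PQ: "\<And>p q z. p \<in> P \<Longrightarrow> q \<in> Q \<Longrightarrow> tform T [p, q, z] = 0"
    and xyz: "x \<in> P" "y \<in> P" "y \<in> Q" "z \<in> Q" "independent {x, y, z}" "x \<noteq> y" "x \<noteq> z" "y \<noteq> z"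
  shows False
proof -
  obtain \<alpha> :: "real ^ 'n \<Rightarrow> real" where \<alpha>: "linear \<alpha>" "\<And>v. v \<in> {x, y, z} \<Longrightarrow> \<alpha> v = (if v = x then 1 else 0)"
    using dual_functional[OF xyz(5), where b = x] by blast
  obtain \<beta> :: "real ^ 'n \<Rightarrow> real" where \<beta>: "linear \<beta>" "\<And>v. v \<in> {x, y, z} \<Longrightarrow> \<beta> v = (if v = y then 1 else 0)"
    using dual_functional[OF xyz(5), where b = y] by blast
  obtain \<gamma> :: "real ^ 'n \<Rightarrow> real" where \<gamma>: "linear \<gamma>" "\<And>v. v \<in> {x, y, z} \<Longrightarrow> \<gamma> v = (if v = z then 1 else 0)"
    using dual_functional[OF xyz(5), where b = z] by blast
  obtain A where A: "\<And>x y z. tform T [A *v x, y, z] + tform T [x, A *v y, z] + tform T [x, y, A *v z] =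
      monomial_form [\<alpha>, \<beta>, \<gamma>] [x, y, z]"
    using submersive_monomial[OF T \<alpha>(1) \<beta>(1) \<gamma>(1)] by blast
  have "tform T [A *v x, y, z] = 0" using tform_cyclic[OF T(2), of "A *v x" y z] PQ xyz by simp
  moreover have "tform T [x, A *v y, z] = 0" using alternating_tform(2)[OF T(2), of x z "A *v y"] PQ xyz by simp
  moreover have "tform T [x, y, A *v z] = 0" using PQ xyz by simp
  moreover have "monomial_form [\<alpha>, \<beta>, \<gamma>] [x, y, z] = 1"
    using xyz by (simp add: monomial_form_3 \<alpha>(2) \<beta>(2) \<gamma>(2))
  ultimately show False using A[of x y z] by simp
qed

text \<open>Three situations: an element of P outside Q is counted against a basis of Q; a line P
  inside Q is counted against the rest of a basis of Q; a larger P inside Q contains two independent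
  vectors, which a third one from Q completes to the configuration of
  \<open>submersive_triple\<close>.\<close>

lemma submersive_pair:
  fixes T :: "'n::finite tensor"
  assumes T: "submersive T" "alternating T" and m: "product_of T m"
    and PQ: "\<And>p q z. p \<in> P \<Longrightarrow> q \<in> Q \<Longrightarrow> tform T [p, q, z] = 0"
    and P: "subspace P" "P \<noteq> {0}" and Q: "subspace Q" "4 \<le> dim Q"
    and dims: "7 \<le> dim P + dim Q" "dim R = dim Q" and R: "\<And>y y'. y \<in> Q \<Longrightarrow> y' \<in> Q \<Longrightarrow> m y y' \<in> R"
  shows False
proof (cases "P \<subseteq> Q")
  case False
  then obtain x where x: "x \<in> P" "x \<notin> Q" by blast
  obtain Y where Y: "Y \<subseteq> Q" "independent Y" "Q \<subseteq> span Y" "card Y = dim Q" using basis_exists[of Q] by blast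
  have "x \<notin> span Y" using x(2) Y(1) Q(1) span_minimal by blast
  then have "independent (insert x Y)" "x \<notin> Y" using Y(2) by (auto simp: independent_insert span_base)
  \<comment> \<open>With q = \<open>dim Q\<close> at least 4, q (q - 1) is at least 3 q, which
    exceeds 2 \<open>dim R\<close> = 2 q.\<close>
  moreover have "dim Q * 3 \<le> dim Q * (dim Q - 1)" using Q(2) by (intro mult_le_mono2) simp
  then have "2 * dim R < card Y * (card Y - 1)" using Q(2) dims(2) Y(4) by simp
  ultimately show False
  proof (intro submersive_counting[OF T m, where P = P and Q = Q and x = x and Y = Y and R = R])
    show "tform T [p, q, z] = 0" if "p \<in> P" "q \<in> Q" for p q z by (rule PQ[OF that])
    show "m y y' \<in> R" if "y \<in> Y" "y' \<in> Y" for y y' using R that Y(1) by blast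
  qed (use x Y independent_imp_finite[OF Y(2)] in auto)
next
  case True
  obtain x where x: "x \<in> P" "x \<noteq> 0" using P subspace_0[OF P(1)] by blast
  show False
  proof (cases "dim P = 1")
    case d: True
    have "{x} \<subseteq> Q" "independent {x}" using x True by auto
    then obtain B where B: "{x} \<subseteq> B" "B \<subseteq> Q" "independent B" "Q \<subseteq> span B"
      using maximal_independent_subset_extend by metis
    have cB: "card B = dim Q" using basis_card_eq_dim[OF B(2,4,3)] .
    let ?Y = "B - {x}"
    have fin: "finite B" using B(3) independent_imp_finite by blast
    have c: "card ?Y = dim Q - 1" using B(1) cB fin by simp
    \<comment> \<open>Here q = \<open>dim Q\<close> is at least 6, so (q - 1)(q - 2) is at least 4
      (q - 1), which exceeds 2 q.\<close>
    have "(dim Q - 1) * 4 \<le> (dim Q - 1) * (dim Q - 1 - 1)" using dims(1) d by (intro mult_le_mono2) simp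
    then have "2 * dim R < card ?Y * (card ?Y - 1)" unfolding c dims(2) using dims(1) d by linarith
    moreover have "independent (insert x ?Y)" using B(1,3) by (simp add: insert_absorb)
    ultimately show False
    proof (intro submersive_counting[OF T m, where P = P and Q = Q and x = x and Y = ?Y and R = R])
      show "tform T [p, q, z] = 0" if "p \<in> P" "q \<in> Q" for p q z by (rule PQ[OF that])
      show "m y y' \<in> R" if "y \<in> ?Y" "y' \<in> ?Y" for y y' using R that B(2) by blast
    qed (use x B(2) fin in auto)
  next
    case False
    have "\<not> P \<subseteq> span {x}"
    proof
      assume "P \<subseteq> span {x}"
      then have "dim P \<le> 1" using dim_subset[of P "span {x}"] dim_le_card'[of "{x}"] by simp
      moreover have "dim P \<noteq> 0" using x by (auto simp: dim_eq_0)
      ultimately show False using False by simp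
    qed
    then obtain y where y: "y \<in> P" "y \<notin> span {x}" by blast
    have "\<not> Q \<subseteq> span {x, y}"
    proof
      assume "Q \<subseteq> span {x, y}"
      then have "dim Q \<le> card {x, y}" using dim_subset[of Q "span {x, y}"] dim_le_card'[of "{x, y}"] by simp
      also have "\<dots> \<le> 2" by (simp add: card_insert_if)
      finally show False using Q(2) by simp
    qed
    then obtain z where z: "z \<in> Q" "z \<notin> span {x, y}" by blast
    have ind2: "independent {y, x}" by (intro independent_insertI independent_empty) (use y x in auto)
    have "independent {z, y, x}" by (rule independent_insertI[OF _ ind2]) (use z in \<open>simp add: insert_commute\<close>)
    then have ind: "independent {x, y, z}" by (simp add: insert_commute)
    have "x \<noteq> y" "x \<noteq> z" "y \<noteq> z" using y(2) z(2) by (auto simp: span_base)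
    then show False
    proof (intro submersive_triple[OF T, where P = P and Q = Q and x = x and y = y and z = z])
      show "tform T [p, q, z] = 0" if "p \<in> P" "q \<in> Q" for p q z by (rule PQ[OF that])
    qed (use x y z ind True in auto)
  qed
qed

lemma dim_annihilator:
  fixes M :: "real ^ 'n ^ 'n" and I :: "(real ^ 'n) set"
  assumes "det M \<noteq> 0" "subspace I"
  shows "dim {z. \<forall>w\<in>I. (M *v w) \<bullet> z = 0} + dim I = CARD('n)"
proof -
  have "inj ((*v) M)" using assms(1) by (metis inj_matrix_vector_mult invertible_det_nz)
  then have "dim ((*v) M ` I) = dim I"
    by (intro dim_image_eq) (auto intro: inj_on_subset)
  moreover have "dim {z \<in> UNIV. \<forall>w\<in>(*v) M ` I. orthogonal w z} + dim ((*v) M ` I) = dim (UNIV :: (real ^ 'n) set)"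
    by (rule dim_subspace_orthogonal_to_vectors)
       (auto intro: linear_subspace_image[OF matrix_vector_mul_linear assms(2)])
  ultimately show ?thesis by (simp add: orthogonal_def)
qed

text \<open>Dimensions of an ideal and its complement add up to at least 7, so one of them is at
  least 4 and plays the part of Q in \<open>submersive_pair\<close>.\<close>

lemma ideal_of_product:
  fixes T :: "'n::finite tensor"
  assumes n: "7 \<le> CARD('n)" and nd: "nondegenerate T" and T: "submersive T" "alternating T" and m: "product_of T m"
    and I: "algebra_ideal UNIV m I"
  shows "I = {0} \<or> I = UNIV"
proof (rule ccontr)
  assume "\<not> (I = {0} \<or> I = UNIV)"
  then have I0: "I \<noteq> {0}" and I1: "I \<noteq> UNIV" by auto
  have sub: "subspace I" and mI: "\<And>x y. x \<in> I \<Longrightarrow> m x y \<in> I" "\<And>x y. x \<in> I \<Longrightarrow> m y x \<in> I"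
    using I by (auto simp: algebra_ideal_def)
  \<comment> \<open>K and K' are the right and left orthogonal complements, kept apart because
    symmetry of \<open>Bf\<close> has not been established. Products of elements of K lie in K',
    which has the same dimension as K.\<close>
  define K where "K = {z. \<forall>w\<in>I. Bf T w z = 0}"
  define K' where "K' = {z. \<forall>w\<in>I. Bf T z w = 0}"
  have detg: "det (gram T) \<noteq> 0" using nd nondegenerate_iff by blast
  have dK: "dim K + dim I = CARD('n)"
    using dim_annihilator[OF detg sub] by (simp add: K_def Bf_eq_inner)
  have "Bf T z w = (Finite_Cartesian_Product.transpose (gram T) *v w) \<bullet> z" for z w
    unfolding Bf_eq_inner by (metis transpose_matrix_vector dot_lmul_matrix inner_commute)
  then have dK': "dim K' + dim I = CARD('n)"
    using dim_annihilator[of "Finite_Cartesian_Product.transpose (gram T)", OF _ sub] detg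
    by (simp add: K'_def det_transpose)
  have subK: "subspace K"
    unfolding K_def subspace_def
    by (auto simp: linear_0[OF linear_Bf(1)] linear_add[OF linear_Bf(1)] linear_scale[OF linear_Bf(1)])
  have IK: "tform T [w, z, y] = 0" if "w \<in> I" "z \<in> K" for w z y
  proof -
    have "tform T [w, z, y] = tform T [y, w, z]" using tform_cyclic[OF T(2), of y w z] by simp
    also have "\<dots> = Bf T (m y w) z" using m by (simp add: product_of_def)
    also have "\<dots> = 0" using that mI(2) by (auto simp: K_def)
    finally show ?thesis .
  qed
  have KK: "m y y' \<in> K'" if "y \<in> K" "y' \<in> K" for y y'
  proof -
    have "Bf T (m y y') w = 0" if "w \<in> I" for w
      using m IK[OF that \<open>y \<in> K\<close>, of y'] tform_cyclic[OF T(2), of w y y'] by (simp add: product_of_def)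
    then show ?thesis by (simp add: K'_def)
  qed
  show False
  proof (cases "4 \<le> dim K")
    case True
    show False
    proof (rule submersive_pair[OF T m, where P = I and Q = K and R = K'])
      show "tform T [p, q, z] = 0" if "p \<in> I" "q \<in> K" for p q z by (rule IK[OF that])
      show "m y y' \<in> K'" if "y \<in> K" "y' \<in> K" for y y' by (rule KK[OF that])
    qed (use sub I0 subK True dK dK' n in auto)
  next
    case False
    \<comment> \<open>Now \<open>dim K\<close> is at most 3, so \<open>dim I\<close> is at least 4
      and the two spaces exchange their roles; I is closed under products and serves as R.\<close>
    have "K \<noteq> {0}"
    proof
      assume "K = {0}"
      then have "dim I = DIM(real ^ 'n)" using dK by simp
      then show False using I1 sub dim_eq_full by (metis span_eq_iff)
    qed
    then show False
    proof (intro submersive_pair[OF T m, where P = K and Q = I and R = I])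
      show "tform T [z, w, y] = 0" if "z \<in> K" "w \<in> I" for z w y
        using IK[OF that(2,1), of y] alternating_tform(1)[OF T(2), of w z y] by simp
      show "m y y' \<in> I" if "y \<in> I" "y' \<in> I" for y y' by (rule mI(1)[OF that(1)])
    qed (use sub subK False dK n in auto)
  qed
qed

lemma stable_simple:
  fixes T :: "'n::finite tensor"
  assumes n: "CARD('n) = 7 \<or> CARD('n) = 8" and T: "stable_tensor T" and m: "product_of T m"
  shows "simple_malcev_algebra UNIV m"
proof -
  have alt: "alternating T" using T by (simp add: stable_tensor_def)
  note nd = stable_nondegenerate[OF n T] and sub = stable_submersive[OF n T]
  note lin = product_of_linear[OF nd m]
  have anti: "m x y = - m y x" for x y
  proof (rule Bf_eqI[OF nd])
    show "Bf T (m x y) z = Bf T (- m y x) z" for z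
      using m alternating_tform(1)[OF alt, of y x z] linear_neg[OF linear_Bf(2)[of T z], of "m y x"]
      by (simp add: product_of_def)
  qed
  have ident: "m (m x y) (m x z) = m (m (m x y) z) x + m (m (m y z) x) x + m (m (m z x) x) y" for x y z
    using malcev_product[OF n alt nd m] unfolding malcev_identity_def by blast
  have "malcev_algebra UNIV m"
    unfolding malcev_algebra_def linear_map_on_def
    by (intro conjI ballI allI; rule subspace_UNIV UNIV_I linear_add[OF lin(1)] linear_add[OF lin(2)]
        linear_scale[OF lin(1)] linear_scale[OF lin(2)] anti ident)
  moreover have ideal: "I = {0} \<or> I = UNIV" if "algebra_ideal UNIV m I" for I
    by (rule ideal_of_product[OF _ nd sub alt m that]) (use n in auto)
  moreover have "\<exists>x y. m x y \<noteq> 0"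
  proof (rule ccontr)
    assume *: "\<nexists>x y. m x y \<noteq> 0"
    \<comment> \<open>If the product vanished, every line would be an ideal; being nonzero it would
      be the whole space, against dimension 7 or 8.\<close>
    let ?I = "span {axis undefined 1 :: real ^ 'n}"
    have "algebra_ideal UNIV m ?I" using * by (simp add: algebra_ideal_def span_0)
    then have "?I = {0} \<or> ?I = UNIV" by (rule ideal)
    moreover have "axis undefined 1 \<in> ?I" by (simp add: span_base)
    then have "?I \<noteq> {0}" by (metis axis_eq_0_iff singletonD zero_neq_one)
    ultimately have "?I = (UNIV :: (real ^ 'n) set)" by simp
    then have "dim (UNIV :: (real ^ 'n) set) = dim ?I" by (simp only:)
    also have "\<dots> \<le> 1" using dim_le_card'[of "{axis undefined 1 :: real ^ 'n}"] by (simp only: dim_span) simp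
    finally show False using n by auto
  qed
  ultimately show ?thesis by (auto simp: simple_malcev_algebra_def)
qed

section \<open>Transport to a frame\<close>

text \<open>A coordinate system on a subspace of a possibly infinite-dimensional type. The map
  \<sigma> is constrained only on V, as it will be the evaluation of a tangent vector at a chart, so
  its linearity is derived on V.\<close>

locale frame =
  fixes V :: "'v::real_vector set" and \<tau> :: "real ^ 'n::finite \<Rightarrow> 'v" and \<sigma> :: "'v \<Rightarrow> real ^ 'n"
  assumes linear: "linear \<tau>" and range: "range \<tau> = V" and \<sigma>\<tau>: "\<sigma> (\<tau> x) = x"
begin

lemma \<tau>_in [simp]: "\<tau> x \<in> V" using range by blast

lemma \<tau>\<sigma>: "v \<in> V \<Longrightarrow> \<tau> (\<sigma> v) = v" using range \<sigma>\<tau> by force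

lemma map_\<tau>\<sigma>: "set xs \<subseteq> V \<Longrightarrow> map \<tau> (map \<sigma> xs) = xs"
  by (induction xs) (auto simp: \<tau>\<sigma>)

lemma map_\<sigma>\<tau>: "map \<sigma> (map \<tau> xs) = xs"
  by (induction xs) (auto simp: \<sigma>\<tau>)

lemma subspace: "subspace V"
  unfolding range[symmetric] by (rule linear_subspace_image[OF linear subspace_UNIV])

lemma \<sigma>_linear: "v \<in> V \<Longrightarrow> w \<in> V \<Longrightarrow> \<sigma> (a *\<^sub>R v + w) = a *\<^sub>R \<sigma> v + \<sigma> w"
  using \<sigma>\<tau>[of "a *\<^sub>R \<sigma> v + \<sigma> w"] by (simp add: linear_add[OF linear] linear_scale[OF linear] \<tau>\<sigma>)

lemma coordinates_alt_forms:
  assumes "\<omega> \<in> alt_forms k V"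
  shows "(\<lambda>xs. \<omega> (map \<tau> xs)) \<in> alt_forms k UNIV"
  unfolding alt_forms_def mem_Collect_eq
proof (intro conjI allI impI)
  fix xs :: "(real ^ 'n) list" assume "length xs \<noteq> k \<or> \<not> set xs \<subseteq> UNIV"
  then show "\<omega> (map \<tau> xs) = 0" using alt_forms_outside[OF assms, of "map \<tau> xs"] by simp
next
  fix xs :: "(real ^ 'n) list" and i :: nat and x y :: "real ^ 'n" and a :: real
  assume "length xs = k \<and> set xs \<subseteq> UNIV \<and> i < k \<and> x \<in> UNIV \<and> y \<in> UNIV"
  then show "\<omega> (map \<tau> (xs[i := a *\<^sub>R x + y])) = a * \<omega> (map \<tau> (xs[i := x])) + \<omega> (map \<tau> (xs[i := y]))"
    using alt_forms_update[OF assms, of "map \<tau> xs" i "\<tau> x" "\<tau> y" a] \<tau>_in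
    by (auto simp: image_subset_iff map_update linear_add[OF linear] linear_scale[OF linear])
next
  fix xs :: "(real ^ 'n) list" and i j :: nat assume "length xs = k \<and> i < j \<and> j < k \<and> xs ! i = xs ! j"
  then show "\<omega> (map \<tau> xs) = 0" using alt_forms_eq_zero[OF assms, of "map \<tau> xs" i j] by simp
qed

definition extend :: "((real ^ 'n) list \<Rightarrow> real) \<Rightarrow> 'v list \<Rightarrow> real" where
  "extend \<theta> xs = (if set xs \<subseteq> V then \<theta> (map \<sigma> xs) else 0)"

lemma extend_map: "extend \<theta> (map \<tau> xs) = \<theta> xs"
  by (auto simp: extend_def map_\<sigma>\<tau> simp del: map_map)

lemma extend_alt_forms:
  assumes "\<theta> \<in> alt_forms k UNIV"
  shows "extend \<theta> \<in> alt_forms k V"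
  unfolding alt_forms_def mem_Collect_eq
proof (intro conjI allI impI)
  fix xs :: "'v list" assume "length xs \<noteq> k \<or> \<not> set xs \<subseteq> V"
  then show "extend \<theta> xs = 0" using alt_forms_outside[OF assms, of "map \<sigma> xs"] by (auto simp: extend_def)
next
  fix xs :: "'v list" and i :: nat and x y :: 'v and a :: real
  assume *: "length xs = k \<and> set xs \<subseteq> V \<and> i < k \<and> x \<in> V \<and> y \<in> V"
  then have V: "set (xs[i := z]) \<subseteq> V" if "z \<in> V" for z
    using that by (meson set_update_subsetI)
  have "a *\<^sub>R x + y \<in> V" using * subspace by (simp add: subspace_add subspace_scale)
  then show "extend \<theta> (xs[i := a *\<^sub>R x + y]) = a * extend \<theta> (xs[i := x]) + extend \<theta> (xs[i := y])"
    using alt_forms_update[OF assms, of "map \<sigma> xs" i "\<sigma> x" "\<sigma> y" a] * V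
    by (simp add: extend_def map_update \<sigma>_linear)
next
  fix xs :: "'v list" and i j :: nat assume "length xs = k \<and> i < j \<and> j < k \<and> xs ! i = xs ! j"
  then show "extend \<theta> xs = 0" using alt_forms_eq_zero[OF assms, of "map \<sigma> xs" i j] by (simp add: extend_def)
qed

lemma alt_forms_eq_extend:
  assumes "\<omega> \<in> alt_forms k V"
  shows "\<omega> = extend (\<lambda>xs. \<omega> (map \<tau> xs))"
proof
  show "\<omega> xs = extend (\<lambda>xs. \<omega> (map \<tau> xs)) xs" for xs
    using alt_forms_outside[OF assms, of xs] map_\<tau>\<sigma>[of xs] by (auto simp: extend_def simp del: map_map)
qed

definition vol :: "'v list \<Rightarrow> real" where
  "vol = extend volume_form"

lemma vol_alt_forms: "vol \<in> alt_forms CARD('n) V"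
  unfolding vol_def by (rule extend_alt_forms[OF volume_form_alt_forms])

lemma top_form:
  assumes "\<omega> \<in> alt_forms CARD('n) V"
  shows "\<omega> = \<omega> (map \<tau> (map eb [0..<CARD('n)])) *\<^sub>R vol"
proof -
  have "extend (\<lambda>xs. \<omega> (map \<tau> xs)) xs = \<omega> (map \<tau> (map eb [0..<CARD('n)])) * vol xs" for xs
    unfolding vol_def extend_def using top_form_eq_volume_form[OF coordinates_alt_forms[OF assms], of "map \<sigma> xs"]
    by simp
  then have "\<omega> xs = (\<omega> (map \<tau> (map eb [0..<CARD('n)])) *\<^sub>R vol) xs" for xs
    using fun_cong[OF alt_forms_eq_extend[OF assms], of xs] by (simp only: scaleR_fun_def real_scaleR_def)
  then show ?thesis by (rule ext)
qed

lemma multivector_eq: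
  assumes "\<rho> \<in> multivectors CARD('n) V" "\<omega> \<in> alt_forms CARD('n) V"
  shows "\<rho> \<omega> = \<omega> (map \<tau> (map eb [0..<CARD('n)])) * \<rho> vol"
proof -
  have "\<rho> (a *\<^sub>R vol) = a * \<rho> vol" for a
    using assms(1) vol_alt_forms by (simp add: multivectors_def linear_map_on_def)
  then show ?thesis using top_form[OF assms(2)] by metis
qed

definition tensor :: "('v list \<Rightarrow> real) \<Rightarrow> 'n tensor" where
  "tensor \<phi> = tensor_of (\<lambda>xs. \<phi> (map \<tau> xs))"

lemma
  assumes "\<phi> \<in> alt_forms 3 V"
  shows alternating_tensor: "alternating (tensor \<phi>)" and tform_tensor: "tform (tensor \<phi>) = (\<lambda>xs. \<phi> (map \<tau> xs))"
  unfolding tensor_def using alt_forms_tensor_of[OF coordinates_alt_forms[OF assms]] by auto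

text \<open>The basis B in \<open>trace_on\<close> is an arbitrary choice, finite because it is
  independent and lies in the span of n frame vectors. Expanding each element of B in the frame and
  exchanging the sums reassembles the images of the frame vectors from their B-coordinates.\<close>

lemma trace_on_eq:
  assumes f: "linear_map_on V f" "\<And>v. v \<in> V \<Longrightarrow> f v \<in> V"
  shows "trace_on V f = (\<Sum>i\<in>UNIV. \<sigma> (f (\<tau> (axis i 1))) $ i)"
proof -
  define B where "B = (SOME B. B \<subseteq> V \<and> independent B \<and> V \<subseteq> span B)"
  have "\<exists>B. B \<subseteq> V \<and> independent B \<and> V \<subseteq> span B"
    using maximal_independent_subset[of V] by metis
  then have B: "B \<subseteq> V" "independent B" "V \<subseteq> span B"
    unfolding B_def by (metis (mono_tags, lifting) someI_ex)+
  have expand: "v = (\<Sum>i\<in>UNIV. \<sigma> v $ i *\<^sub>R \<tau> (axis i 1))" if "v \<in> V" for v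
    using linear_axis_expansion[OF linear, of "\<sigma> v"] \<tau>\<sigma>[OF that] by simp
  have "B \<subseteq> span (\<tau> ` range (\<lambda>i. axis i 1))"
  proof
    fix v assume "v \<in> B"
    then have "v = (\<Sum>i\<in>UNIV. \<sigma> v $ i *\<^sub>R \<tau> (axis i 1))" using expand B(1) by blast
    also have "\<dots> \<in> span (\<tau> ` range (\<lambda>i. axis i 1))"
      by (intro span_sum span_scale span_base) auto
    finally show "v \<in> span (\<tau> ` range (\<lambda>i. axis i 1))" .
  qed
  from independent_span_bound[OF _ B(2) this] have fin: "finite B" by simp
  have fsum: "f (\<Sum>i\<in>I. c i *\<^sub>R v i) = (\<Sum>i\<in>I. c i *\<^sub>R f (v i))" if "finite I" "\<And>i. v i \<in> V" for I :: "'n set" and c v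
    using that(1)
  proof (induction I rule: finite_induct)
    case empty
    have "\<forall>x\<in>V. f (0 *\<^sub>R x) = 0 *\<^sub>R f x" using f(1) unfolding linear_map_on_def by (elim conjE allE)
    from bspec[OF this \<tau>_in[of 0]] show ?case by simp
  next
    case (insert i I)
    have "(\<Sum>i\<in>I. c i *\<^sub>R v i) \<in> V" "c i *\<^sub>R v i \<in> V"
      using that(2) subspace by (auto intro!: subspace_sum subspace_scale)
    then show ?case using insert f(1) that(2) by (simp add: linear_map_on_def)
  qed
  have \<sigma>sum: "\<sigma> (\<Sum>b\<in>B. c b *\<^sub>R b) = (\<Sum>b\<in>B. c b *\<^sub>R \<sigma> b)" for c
  proof -
    have "(\<Sum>b\<in>B. c b *\<^sub>R b) = (\<Sum>b\<in>B. c b *\<^sub>R \<tau> (\<sigma> b))"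
      using B(1) \<tau>\<sigma> by (intro sum.cong) auto
    also have "\<dots> = \<tau> (\<Sum>b\<in>B. c b *\<^sub>R \<sigma> b)" by (simp add: linear_sum[OF linear] linear_scale[OF linear])
    finally show ?thesis by (simp add: \<sigma>\<tau>)
  qed
  have in_span: "f (\<tau> x) \<in> span B" for x using f(2) B(3) by auto
  have rep: "representation B (f b) b = (\<Sum>i\<in>UNIV. \<sigma> b $ i * representation B (f (\<tau> (axis i 1))) b)" if "b \<in> B" for b
  proof -
    have "f b = (\<Sum>i\<in>UNIV. \<sigma> b $ i *\<^sub>R f (\<tau> (axis i 1)))"
      using expand[of b] fsum[of UNIV "\<lambda>i. \<tau> (axis i 1)" "\<lambda>i. \<sigma> b $ i"] that B(1) by auto
    then show ?thesis
      by (simp add: representation_sum[OF B(2)] representation_scale[OF B(2)] in_span span_scale)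
  qed
  have "trace_on V f = (\<Sum>b\<in>B. \<Sum>i\<in>UNIV. \<sigma> b $ i * representation B (f (\<tau> (axis i 1))) b)"
    unfolding trace_on_def B_def[symmetric] Let_def by (intro sum.cong refl rep)
  also have "\<dots> = (\<Sum>i\<in>UNIV. (\<Sum>b\<in>B. representation B (f (\<tau> (axis i 1))) b *\<^sub>R \<sigma> b) $ i)"
    by (subst sum.swap) (simp add: sum_component mult.commute)
  also have "\<dots> = (\<Sum>i\<in>UNIV. \<sigma> (f (\<tau> (axis i 1))) $ i)"
    unfolding \<sigma>sum[symmetric] by (simp add: sum_representation_eq[OF B(2) in_span fin])
  finally show ?thesis .
qed

text \<open>A decomposition into u and \<theta> is not unique, but \<theta> is a multiple a of
  \<open>vol\<close>, and the contraction determines the vector a u. The tensor depends only on that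
  vector, so the definite description is well posed.\<close>

lemma S_tensor_eq:
  assumes n: "CARD('n) = 8" and \<phi>: "\<phi> \<in> alt_forms 3 V" and \<rho>: "\<rho> \<in> multivectors 8 V"
  shows "S_tensor V \<phi> (\<tau> x) (\<tau> y) \<rho> = \<rho> vol *\<^sub>R \<tau> (S8 (tensor \<phi>) x y)"
proof -
  let ?u = "\<tau> (S8 (tensor \<phi>) x y)" and ?r = "reduced_7form \<phi> (\<tau> x) (\<tau> y)"
  have r7: "?r \<in> alt_forms 7 V" by (rule reduced_7form_alt_forms[OF \<phi> subspace]) auto
  have vol8: "vol \<in> alt_forms 8 V" using vol_alt_forms n by simp
  have vol_eq: "?u \<rfloor> vol = ?r"
  proof
    fix xs
    show "(?u \<rfloor> vol) xs = ?r xs"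
    proof (cases "set xs \<subseteq> V")
      case True
      have "(?u \<rfloor> vol) xs = volume_form (S8 (tensor \<phi>) x y # map \<sigma> xs)"
        using True by (simp add: interior_product_def vol_def extend_def \<sigma>\<tau>)
      also have "\<dots> = reduced_7form (\<lambda>ys. \<phi> (map \<tau> ys)) x y (map \<sigma> xs)"
        by (simp only: volume_form_S8[OF n alternating_tensor[OF \<phi>]] tform_tensor[OF \<phi>])
      also have "\<dots> = ?r xs" by (simp only: reduced_7form_map[symmetric] map_\<tau>\<sigma>[OF True])
      finally show ?thesis .
    next
      case False
      then show ?thesis
        using alt_forms_outside[OF r7, of xs] by (simp add: interior_product_def vol_def extend_def)
    qed
  qed
  have "tensor8 V u \<theta> = tensor8 V ?u vol"
    if u: "u \<in> V" "\<theta> \<in> alt_forms 8 V" "u \<rfloor> \<theta> = ?r" for u \<theta>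
  proof -
    define a where "a = \<theta> (map \<tau> (map eb [0..<CARD('n)]))"
    have \<theta>: "\<theta> = a *\<^sub>R vol" unfolding a_def by (rule top_form) (use u(2) n in simp)
    have "volume_form (a *\<^sub>R \<sigma> u # ys) = volume_form (S8 (tensor \<phi>) x y # ys)" for ys
    proof -
      have "(u \<rfloor> \<theta>) (map \<tau> ys) = (?u \<rfloor> vol) (map \<tau> ys)" using u(3) vol_eq by simp
      then have "a * vol (map \<tau> (\<sigma> u # ys)) = vol (map \<tau> (S8 (tensor \<phi>) x y # ys))"
        using u(1) by (simp add: interior_product_def \<theta> scaleR_fun_def \<tau>\<sigma>)
      then have "a * volume_form (\<sigma> u # ys) = volume_form (S8 (tensor \<phi>) x y # ys)"
        unfolding vol_def extend_map .
      then show ?thesis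
        using alt_forms_scale[OF volume_form_alt_forms UNIV_I subspace_UNIV, of "[]" a "\<sigma> u" ys] by (simp only: append_Nil)
    qed
    then have "a *\<^sub>R \<sigma> u = S8 (tensor \<phi>) x y" by (rule volume_form_Cons_inject)
    then have "?u = a *\<^sub>R u" using \<tau>\<sigma>[OF u(1)] linear_scale[OF linear, of a "\<sigma> u"] by simp
    moreover have "\<rho> (a *\<^sub>R vol) = a * \<rho> vol" if "\<rho> \<in> multivectors 8 V" for \<rho>
      using that vol8 by (simp add: multivectors_def linear_map_on_def)
    ultimately show ?thesis by (simp add: tensor8_def fun_eq_iff \<theta> mult.commute)
  qed
  note tensor_eq = this
  have "S_tensor V \<phi> (\<tau> x) (\<tau> y) = tensor8 V ?u vol"
    unfolding S_tensor_def
  proof (rule the_equality)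
    show "\<exists>u\<in>V. \<exists>\<theta>\<in>alt_forms 8 V. tensor8 V ?u vol = tensor8 V u \<theta> \<and> u \<rfloor> \<theta> = ?r"
      by (rule bexI[OF _ \<tau>_in], rule bexI[OF _ vol8], rule conjI[OF refl vol_eq])
  next
    fix t assume "\<exists>u\<in>V. \<exists>\<theta>\<in>alt_forms 8 V. t = tensor8 V u \<theta> \<and> u \<rfloor> \<theta> = ?r"
    then show "t = tensor8 V ?u vol" by (elim bexE conjE) (simp add: tensor_eq)
  qed
  then show ?thesis using \<rho> by (simp add: tensor8_def)
qed

text \<open>Each use of the top-form factor pairs \<open>\<rho>\<close> with \<open>vol\<close>
  once: one factor for n = 7, and for n = 8 one from each of the two operators under the
  trace.\<close>

lemma reduced_form_eq:
  assumes n: "CARD('n) = 7 \<or> CARD('n) = 8" and \<phi>: "\<phi> \<in> alt_forms 3 V" and \<rho>: "\<rho> \<in> multivectors CARD('n) V"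
  shows "reduced_form CARD('n) V \<phi> \<rho> (\<tau> x) (\<tau> y) = \<rho> vol ^ weight TYPE('n) * Bf (tensor \<phi>) x y"
proof (cases "CARD('n) = 7")
  case True
  have "reduced_7form \<phi> (\<tau> x) (\<tau> y) \<in> alt_forms CARD('n) V"
    using reduced_7form_alt_forms[OF \<phi> subspace \<tau>_in \<tau>_in] True by simp
  from multivector_eq[OF \<rho> this] show ?thesis
    unfolding reduced_form_def Bf_def weight_def if_P[OF True] reduced_7form_map tform_tensor[OF \<phi>]
    by (simp only: power_one_right mult.commute)
next
  case False
  with n have n8: "CARD('n) = 8" by simp
  let ?T = "tensor \<phi>" and ?r = "\<rho> vol"
  have \<rho>8: "\<rho> \<in> multivectors 8 V" using \<rho> n8 by simp
  define f where "f z = S_tensor V \<phi> (\<tau> x) (S_tensor V \<phi> (\<tau> y) z \<rho>) \<rho>" for z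
  have f: "f (\<tau> z) = \<tau> ((?r * ?r) *\<^sub>R S8 ?T x (S8 ?T y z))" for z
  proof -
    have "f (\<tau> z) = S_tensor V \<phi> (\<tau> x) (\<tau> (?r *\<^sub>R S8 ?T y z)) \<rho>"
      unfolding f_def S_tensor_eq[OF n8 \<phi> \<rho>8] linear_scale[OF linear] ..
    then show ?thesis
      unfolding S_tensor_eq[OF n8 \<phi> \<rho>8] linear_scale[OF linear_S8(1)] by (simp add: linear_scale[OF linear])
  qed
  have "linear (\<lambda>z. \<tau> ((?r * ?r) *\<^sub>R S8 ?T x (S8 ?T y z)))"
    by (rule linearI_combination)
       (simp add: linear_add[OF linear] linear_scale[OF linear] linear_add[OF linear_S8(1)] linear_scale[OF linear_S8(1)]
         scaleR_add_right mult.commute)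
  then have l: "linear (\<lambda>z. f (\<tau> z))" unfolding f .
  have "linear_map_on V f"
    unfolding linear_map_on_def
  proof (intro conjI ballI allI)
    fix u v assume "u \<in> V" "v \<in> V"
    then show "f (u + v) = f u + f v"
      using linear_add[OF l, of "\<sigma> u" "\<sigma> v"] by (simp add: linear_add[OF linear] \<tau>\<sigma>)
  next
    fix a u assume "u \<in> V"
    then show "f (a *\<^sub>R u) = a *\<^sub>R f u"
      using linear_scale[OF l, of a "\<sigma> u"] by (simp add: linear_scale[OF linear] \<tau>\<sigma>)
  qed
  moreover have "f v \<in> V" if "v \<in> V" for v using f[of "\<sigma> v"] \<tau>\<sigma>[OF that] by simp
  ultimately have "trace_on V f = (\<Sum>i\<in>UNIV. \<sigma> (f (\<tau> (axis i 1))) $ i)" by (rule trace_on_eq)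
  also have "\<dots> = (?r * ?r) * (\<Sum>i\<in>UNIV. S8 ?T x (S8 ?T y (axis i 1)) $ i)"
    by (simp add: f \<sigma>\<tau> sum_distrib_left)
  also have "(\<Sum>i\<in>UNIV. S8 ?T x (S8 ?T y (axis i 1)) $ i) = trace (matrix (S8 ?T x) ** matrix (S8 ?T y))"
  proof -
    have "matrix (S8 ?T x) ** matrix (S8 ?T y) = matrix (\<lambda>z. S8 ?T x (S8 ?T y z))"
      using matrix_compose[OF linear_S8(1)[of ?T y] linear_S8(1)[of ?T x]] by (simp add: o_def)
    then show ?thesis by (simp add: trace_def matrix_def)
  qed
  finally show ?thesis
    using False by (simp add: reduced_form_def B_tensor_def f_def[abs_def] Bf_def weight_def power2_eq_square)
qed

text \<open>The passage from tensors to forms on V is continuous for pointwise convergence, since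
  each value is a polynomial in the tensor. It thus pulls the open orbit back to a neighbourhood,
  and each linear bijection of V becomes an invertible matrix.\<close>

lemma stable_tensor_of_stable_form:
  assumes "stable_form V \<phi>"
  shows "stable_tensor (tensor \<phi>)"
proof -
  have \<phi>: "\<phi> \<in> alt_forms 3 V" using assms by (simp add: stable_form_def)
  obtain W where W: "open W" "(\<lambda>g. pullback_form V g \<phi>) ` general_linear V = alt_forms 3 V \<inter> W"
    using assms by (auto simp: stable_form_def openin_open)
  define J where "J S = extend (tform S)" for S
  have "continuous_on UNIV J"
  proof (rule continuous_on_coordinatewise_then_product)
    fix xs
    have "continuous_on UNIV (\<lambda>S :: 'n tensor. tform S (map \<sigma> xs))"
      unfolding tform_def by (cases "length xs = 3") (auto intro!: continuous_intros)
    then show "continuous_on UNIV (\<lambda>S. J S xs)"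
      by (cases "set xs \<subseteq> V") (simp_all add: J_def extend_def)
  qed
  then have "open (J -` W)" using W(1) open_vimage by blast
  have J\<phi>: "J (tensor \<phi>) = \<phi>"
    unfolding J_def tform_tensor[OF \<phi>] by (rule alt_forms_eq_extend[OF \<phi>, symmetric])
  have "id \<in> general_linear V" by (simp add: general_linear_def linear_map_on_def)
  moreover have "pullback_form V id \<phi> = \<phi>"
    using alt_forms_outside[OF \<phi>] by (auto simp: pullback_form_def fun_eq_iff)
  ultimately have "\<phi> \<in> W" using W(2) by (metis IntD2 imageI)
  then have "tensor \<phi> \<in> J -` W" using J\<phi> by simp
  then obtain e where e: "e > 0" "ball (tensor \<phi>) e \<subseteq> J -` W"
    using \<open>open (J -` W)\<close> open_contains_ball by blast
  have "\<exists>G. det G \<noteq> 0 \<and> S = pb G (tensor \<phi>)" if S: "alternating S" "dist S (tensor \<phi>) < e" for S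
  proof -
    have "J S \<in> W" using e(2) S(2) by (auto simp: dist_commute)
    moreover have "J S \<in> alt_forms 3 V" unfolding J_def by (rule extend_alt_forms[OF alternating_imp_alt_forms[OF S(1)]])
    ultimately obtain g where g: "g \<in> general_linear V" "J S = pullback_form V g \<phi>" using W(2) by blast
    have gV: "linear_map_on V g" "bij_betw g V V" using g(1) by (auto simp: general_linear_def)
    have gin: "g v \<in> V" if "v \<in> V" for v using gV(2) that by (auto simp: bij_betw_def)
    define h where "h x = \<sigma> (g (\<tau> x))" for x
    have h: "\<tau> (h x) = g (\<tau> x)" for x by (simp add: h_def \<tau>\<sigma> gin)
    have lin: "linear h"
    proof (rule linearI_combination)
      fix a x y
      have "g (\<tau> (a *\<^sub>R x + y)) = a *\<^sub>R g (\<tau> x) + g (\<tau> y)"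
        using gV(1) subspace by (simp add: linear_map_on_def linear_add[OF linear] linear_scale[OF linear] subspace_scale)
      then show "h (a *\<^sub>R x + y) = a *\<^sub>R h x + h y" by (simp add: h_def \<sigma>_linear gin)
    qed
    have "inj h"
    proof (rule injI)
      fix x y assume "h x = h y"
      then have "g (\<tau> x) = g (\<tau> y)" using h by metis
      then have "\<tau> x = \<tau> y" using gV(2) \<tau>_in unfolding bij_betw_def inj_on_def by blast
      then show "x = y" using \<sigma>\<tau> by metis
    qed
    then have "det (matrix h) \<noteq> 0" using lin by (simp add: det_nz_iff_inj)
    moreover have hm: "(*v) (matrix h) = h" by (rule matrix_vector_mul(2)[OF lin])
    have "tform S xs = tform (pb (matrix h) (tensor \<phi>)) xs" for xs
    proof -
      have "map g (map \<tau> xs) = map \<tau> (map h xs)" by (simp add: h)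
      then have "pullback_form V g \<phi> (map \<tau> xs) = \<phi> (map \<tau> (map h xs))"
        by (auto simp: pullback_form_def simp del: map_map)
      then have "J S (map \<tau> xs) = tform (tensor \<phi>) (map h xs)" using g(2) tform_tensor[OF \<phi>] by simp
      then show ?thesis unfolding J_def extend_map tform_pb[OF alternating_tensor[OF \<phi>]] hm .
    qed
    then have "S = pb (matrix h) (tensor \<phi>)" by (intro tform_eqI) simp
    ultimately show ?thesis by blast
  qed
  then show ?thesis using e(1) alternating_tensor[OF \<phi>] unfolding stable_tensor_def by blast
qed

lemma multivector_vol_nonzero:
  assumes "\<rho> \<in> multivectors CARD('n) V" "\<exists>\<omega>\<in>alt_forms CARD('n) V. \<rho> \<omega> \<noteq> 0"
  shows "\<rho> vol \<noteq> 0"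
proof
  assume "\<rho> vol = 0"
  then have "\<rho> \<omega> = 0" if "\<omega> \<in> alt_forms CARD('n) V" for \<omega>
    using multivector_eq[OF assms(1) that] by simp
  then show False using assms(2) by blast
qed

lemma product_in_frame:
  assumes n: "CARD('n) = 7 \<or> CARD('n) = 8" and \<phi>: "\<phi> \<in> alt_forms 3 V" and \<rho>: "\<rho> \<in> multivectors CARD('n) V"
    and r: "\<rho> vol \<noteq> 0" and nd: "nondegenerate (tensor \<phi>)" and m: "product_of (tensor \<phi>) m"
    and x: "x \<in> V" and y: "y \<in> V"
  shows "u \<in> V \<and> (\<forall>z\<in>V. reduced_form CARD('n) V \<phi> \<rho> u z = \<phi> [x, y, z]) \<longleftrightarrow>
    u = \<tau> (inverse (\<rho> vol ^ weight TYPE('n)) *\<^sub>R m (\<sigma> x) (\<sigma> y))"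
proof -
  let ?r = "\<rho> vol ^ weight TYPE('n)"
  have eq: "(\<forall>z\<in>V. reduced_form CARD('n) V \<phi> \<rho> (\<tau> w) z = \<phi> [x, y, z]) \<longleftrightarrow> w = inverse ?r *\<^sub>R m (\<sigma> x) (\<sigma> y)" for w
  proof -
    have "(\<forall>z\<in>V. reduced_form CARD('n) V \<phi> \<rho> (\<tau> w) z = \<phi> [x, y, z]) \<longleftrightarrow>
        (\<forall>z. reduced_form CARD('n) V \<phi> \<rho> (\<tau> w) (\<tau> z) = \<phi> (map \<tau> [\<sigma> x, \<sigma> y, z]))"
      using x y by (auto simp: \<tau>\<sigma>) (metis \<tau>\<sigma>)
    also have "\<dots> \<longleftrightarrow> (\<forall>z. ?r * Bf (tensor \<phi>) w z = tform (tensor \<phi>) [\<sigma> x, \<sigma> y, z])"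
      by (simp only: reduced_form_eq[OF n \<phi> \<rho>] tform_tensor[OF \<phi>])
    also have "\<dots> \<longleftrightarrow> (\<forall>z. Bf (tensor \<phi>) (?r *\<^sub>R w) z = Bf (tensor \<phi>) (m (\<sigma> x) (\<sigma> y)) z)"
      using m by (simp add: product_of_def linear_scale[OF linear_Bf(2)])
    also have "\<dots> \<longleftrightarrow> ?r *\<^sub>R w = m (\<sigma> x) (\<sigma> y)" using Bf_eqI[OF nd] by metis
    also have "\<dots> \<longleftrightarrow> w = inverse ?r *\<^sub>R m (\<sigma> x) (\<sigma> y)"
    proof
      assume eq: "?r *\<^sub>R w = m (\<sigma> x) (\<sigma> y)"
      show "w = inverse ?r *\<^sub>R m (\<sigma> x) (\<sigma> y)"
        by (simp only: eq[symmetric] scaleR_scaleR left_inverse[OF power_not_zero[OF r]] scaleR_one)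
    next
      assume "w = inverse ?r *\<^sub>R m (\<sigma> x) (\<sigma> y)"
      then show "?r *\<^sub>R w = m (\<sigma> x) (\<sigma> y)"
        by (simp only: scaleR_scaleR right_inverse[OF power_not_zero[OF r]] scaleR_one)
    qed
    finally show ?thesis .
  qed
  show ?thesis
  proof (cases "u \<in> V")
    case True
    then show ?thesis using eq[of "\<sigma> u"] \<tau>\<sigma>[OF True] \<sigma>\<tau> by metis
  qed auto
qed

end

section \<open>Transport of a simple Malcev algebra along a linear bijection\<close>

lemma simple_malcev_algebra_iso:
  assumes V: "subspace V" and lin: "linear_map_on V f" and bij: "bij_betw f V (UNIV :: 'w::real_vector set)"
    and m: "\<And>x y. x \<in> V \<Longrightarrow> y \<in> V \<Longrightarrow> m x y \<in> V" "\<And>x y. x \<in> V \<Longrightarrow> y \<in> V \<Longrightarrow> f (m x y) = \<mu> (f x) (f y)"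
    and \<mu>: "simple_malcev_algebra UNIV \<mu>"
  shows "simple_malcev_algebra V m"
proof -
  have inj: "x = y" if "f x = f y" "x \<in> V" "y \<in> V" for x y
    using bij that by (auto simp: bij_betw_def inj_on_def)
  have add: "f (x + y) = f x + f y" if "x \<in> V" "y \<in> V" for x y
    using lin that by (simp add: linear_map_on_def)
  have scale: "f (a *\<^sub>R x) = a *\<^sub>R f x" if "x \<in> V" for a x
    using lin that by (simp add: linear_map_on_def)
  have neg: "f (- x) = - f x" if "x \<in> V" for x using scale[OF that, of "-1"] by simp
  have V': "x \<in> V \<Longrightarrow> y \<in> V \<Longrightarrow> x + y \<in> V" "x \<in> V \<Longrightarrow> a *\<^sub>R x \<in> V" "x \<in> V \<Longrightarrow> - x \<in> V" for a x y
    by (simp_all add: subspace_add[OF V] subspace_scale[OF V] subspace_neg[OF V])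
  have zero: "f 0 = 0" using scale[OF subspace_0[OF V], of 0] by simp
  have mal: "malcev_algebra UNIV \<mu>" and nonzero: "\<exists>x\<in>UNIV. \<exists>y\<in>UNIV. \<mu> x y \<noteq> 0"
    and ideal: "\<forall>I. algebra_ideal UNIV \<mu> I \<longrightarrow> I = {0} \<or> I = UNIV"
    using \<mu> unfolding simple_malcev_algebra_def by - (elim conjE, assumption)+
  have lin1: "\<forall>x\<in>UNIV. linear_map_on UNIV (\<mu> x)" and lin2: "\<forall>y\<in>UNIV. linear_map_on UNIV (\<lambda>x. \<mu> x y)"
    and anti': "\<forall>x\<in>UNIV. \<forall>y\<in>UNIV. \<mu> x y = - \<mu> y x"
    and id': "\<forall>a\<in>UNIV. \<forall>b\<in>UNIV. \<forall>c\<in>UNIV.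
      \<mu> (\<mu> a b) (\<mu> a c) = \<mu> (\<mu> (\<mu> a b) c) a + \<mu> (\<mu> (\<mu> b c) a) a + \<mu> (\<mu> (\<mu> c a) a) b"
    using mal unfolding malcev_algebra_def by - (elim conjE, assumption)+
  have \<mu>lin: "\<mu> a (b + c) = \<mu> a b + \<mu> a c" "\<mu> (b + c) a = \<mu> b a + \<mu> c a" "\<mu> a (t *\<^sub>R b) = t *\<^sub>R \<mu> a b" "\<mu> (t *\<^sub>R b) a = t *\<^sub>R \<mu> b a"
    for a b c t using lin1 lin2 unfolding linear_map_on_def by simp_all
  note anti = anti'[rule_format, OF UNIV_I UNIV_I] and id = id'[rule_format, OF UNIV_I UNIV_I UNIV_I]
  have "malcev_algebra V m"
    unfolding malcev_algebra_def linear_map_on_def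
  proof (intro conjI ballI allI)
    fix x y assume "x \<in> V" "y \<in> V"
    then show "m x y = - m y x"
      by (intro inj) (simp_all add: m neg V' anti[of "f x" "f y"])
  next
    fix x y z assume xyz: "x \<in> V" "y \<in> V" "z \<in> V"
    then show "m (m x y) (m x z) = m (m (m x y) z) x + m (m (m y z) x) x + m (m (m z x) x) y"
      by (intro inj) (simp_all add: m add V' id[of "f x" "f y" "f z"])
  next
    fix x y z assume "x \<in> V" "y \<in> V" "z \<in> V"
    then show "m x (y + z) = m x y + m x z"
      by (intro inj) (simp_all add: m add V' \<mu>lin)
  next
    fix x y z assume "x \<in> V" "y \<in> V" "z \<in> V"
    then show "m (y + z) x = m y x + m z x"
      by (intro inj) (simp_all add: m add V' \<mu>lin)
  next
    fix x a y assume "x \<in> V" "y \<in> V"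
    then show "m x (a *\<^sub>R y) = a *\<^sub>R m x y"
      by (intro inj) (simp_all add: m scale V' \<mu>lin)
  next
    fix x a y assume "x \<in> V" "y \<in> V"
    then show "m (a *\<^sub>R y) x = a *\<^sub>R m y x"
      by (intro inj) (simp_all add: m scale V' \<mu>lin)
  qed (use V m in auto)
  moreover have "\<exists>x\<in>V. \<exists>y\<in>V. m x y \<noteq> 0"
  proof -
    obtain a b where ab: "\<mu> a b \<noteq> 0" using nonzero by blast
    obtain x y where xy: "x \<in> V" "f x = a" "y \<in> V" "f y = b" using bij unfolding bij_betw_def by (metis UNIV_I imageE)
    have "m x y \<noteq> 0" using ab m(2)[OF xy(1,3)] zero xy(2,4) by auto
    then show ?thesis using xy(1,3) by blast
  qed
  moreover have "I = {0} \<or> I = V" if I: "algebra_ideal V m I" for I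
  proof -
    have IV: "I \<subseteq> V" "subspace I" and Im: "\<And>x y. x \<in> I \<Longrightarrow> y \<in> V \<Longrightarrow> m x y \<in> I \<and> m y x \<in> I"
      using I by (auto simp: algebra_ideal_def)
    have "algebra_ideal UNIV \<mu> (f ` I)"
      unfolding algebra_ideal_def
    proof (intro conjI ballI)
      show "subspace (f ` I)"
        unfolding subspace_def
      proof (intro conjI ballI allI)
        show "0 \<in> f ` I" using zero subspace_0[OF IV(2)] by (metis imageI)
      next
        fix a b assume "a \<in> f ` I" "b \<in> f ` I"
        then obtain x y where "x \<in> I" "a = f x" "y \<in> I" "b = f y" by blast
        then show "a + b \<in> f ` I" using add IV subspace_add[OF IV(2)] by (metis imageI subsetD)
      next
        fix t a assume "a \<in> f ` I"
        then obtain x where "x \<in> I" "a = f x" by blast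
        then show "t *\<^sub>R a \<in> f ` I" using scale IV subspace_scale[OF IV(2)] by (metis imageI subsetD)
      qed
    next
      fix a b assume "a \<in> f ` I"
      then obtain x where x: "x \<in> I" "a = f x" by blast
      obtain y where y: "y \<in> V" "b = f y" using bij unfolding bij_betw_def by blast
      show "\<mu> a b \<in> f ` I" "\<mu> b a \<in> f ` I"
        using Im[OF x(1) y(1)] m(2) x y IV(1) by (metis imageI subsetD)+
    qed simp
    then have "f ` I = {0} \<or> f ` I = UNIV" using spec[OF ideal, of "f ` I"] by blast
    then show ?thesis
    proof
      assume *: "f ` I = {0}"
      have "x = 0" if "x \<in> I" for x
      proof (rule inj)
        have "f x \<in> {0}" unfolding *[symmetric] using that by (rule imageI)
        then show "f x = f 0" using zero by simp
        show "x \<in> V" "0 \<in> V" using that IV(1) subspace_0[OF V] by auto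
      qed
      then have "I = {0}" using subspace_0[OF IV(2)] by (intro equalityI subsetI) simp_all
      then show ?thesis ..
    next
      assume *: "f ` I = UNIV"
      have "x \<in> I" if "x \<in> V" for x
      proof -
        have "f x \<in> f ` I" unfolding * by simp
        then obtain y where y: "f x = f y" "y \<in> I" by (rule imageE)
        have "x = y" using y that IV(1) by (intro inj) auto
        then show ?thesis using y(2) by simp
      qed
      then have "I = V" using IV(1) by (intro equalityI subsetI) auto
      then show ?thesis ..
    qed
  qed
  ultimately show ?thesis by (simp add: simple_malcev_algebra_def)
qed

lemma det_scaleR: "det (c *\<^sub>R (M :: real ^ 'k ^ 'k)) = c ^ CARD('k) * det M"
  by (simp add: det_def prod.distrib sum_distrib_left mult.left_commute)

lemma has_derivative_abs:
  fixes a :: real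
  assumes "a \<noteq> 0"
  shows "(abs has_derivative (*) (sgn a)) (at a)"
proof (cases "a > 0")
  case True
  have "(abs has_derivative (\<lambda>v. v)) (at a)"
    by (rule has_derivative_transform_within_open[OF has_derivative_ident open_greaterThan[of 0]]) (use True in auto)
  then show ?thesis by (rule has_derivative_eq_rhs) (use True in \<open>auto simp: fun_eq_iff\<close>)
next
  case False
  have "(abs has_derivative (\<lambda>v. - v)) (at a)"
    by (rule has_derivative_transform_within_open[OF has_derivative_minus[OF has_derivative_ident] open_lessThan[of 0]])
       (use False assms in auto)
  then show ?thesis by (rule has_derivative_eq_rhs) (use False assms in \<open>auto simp: fun_eq_iff\<close>)
qed

section \<open>Charts and tangent spaces\<close>

locale atlas =
  fixes A :: "('m::topological_space, 'n::finite) chart set"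
  assumes smooth_atlas: "smooth_atlas A"
begin

lemma chart: "c \<in> A \<Longrightarrow> is_chart c"
  using smooth_atlas by (simp add: smooth_atlas_def)

lemma chart_around: obtains c where "c \<in> A" "p \<in> chart_dom c"
proof -
  have "p \<in> (\<Union>c\<in>A. chart_dom c)" using smooth_atlas by (simp add: smooth_atlas_def)
  then show thesis using that by blast
qed

lemma chart_inv_map: "c \<in> A \<Longrightarrow> p \<in> chart_dom c \<Longrightarrow> chart_inv c (chart_map c p) = p"
  using chart homeomorphism_apply1 unfolding is_chart_def by metis

lemma open_chart_image:
  assumes c: "c \<in> A" and U: "open U"
  shows "open (chart_map c ` (U \<inter> chart_dom c))"
proof -
  let ?I = "chart_map c ` chart_dom c"
  have "open ?I" "continuous_on ?I (chart_inv c)"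
    using chart[OF c] by (auto simp: is_chart_def homeomorphism_def)
  then have "open (?I \<inter> chart_inv c -` U)" using U continuous_open_preimage by blast
  moreover have "?I \<inter> chart_inv c -` U = chart_map c ` (U \<inter> chart_dom c)"
    using chart_inv_map[OF c] by force
  ultimately show ?thesis by simp
qed

lemma open_chart_dom: "c \<in> A \<Longrightarrow> open (chart_dom c)"
  using chart by (simp add: is_chart_def)

lemma smooth_transition:
  "c \<in> A \<Longrightarrow> d \<in> A \<Longrightarrow> smooth_on (chart_map c ` (chart_dom c \<inter> chart_dom d)) (transition c d)"
  using smooth_atlas by (simp add: smooth_atlas_def)

definition D :: "('m, 'n) chart \<Rightarrow> ('m, 'n) chart \<Rightarrow> 'm \<Rightarrow> real ^ 'n \<Rightarrow> real ^ 'n" where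
  "D c d p = frechet_derivative (transition c d) (at (chart_map c p))"

lemma has_derivative_transition:
  assumes "c \<in> A" "d \<in> A" "p \<in> chart_dom c" "p \<in> chart_dom d"
  shows "(transition c d has_derivative D c d p) (at (chart_map c p))"
  unfolding D_def by (rule smooth_on_has_derivative[OF smooth_transition]) (use assms in auto)

lemma linear_D:
  assumes "c \<in> A" "d \<in> A" "p \<in> chart_dom c" "p \<in> chart_dom d"
  shows "linear (D c d p)"
  using has_derivative_transition[OF assms] has_derivative_linear by blast

lemma D_cocycle:
  assumes c: "c \<in> A" "p \<in> chart_dom c" and d: "d \<in> A" "p \<in> chart_dom d" and e: "e \<in> A" "p \<in> chart_dom e"
  shows "D d e p (D c d p v) = D c e p v"
proof -
  let ?S = "chart_map c ` ((chart_dom d \<inter> chart_dom e) \<inter> chart_dom c)"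
  have S: "open ?S" by (rule open_chart_image[OF c(1)]) (simp add: open_Int open_chart_dom d e)
  have x: "chart_map c p \<in> ?S" using c d e by blast
  have tp: "transition c d (chart_map c p) = chart_map d p"
    by (simp add: transition_def chart_inv_map c)
  have "((\<lambda>x. transition d e (transition c d x)) has_derivative (\<lambda>v. D d e p (D c d p v))) (at (chart_map c p))"
    by (rule has_derivative_compose[OF has_derivative_transition[OF c(1) d(1) c(2) d(2)]])
       (simp add: tp has_derivative_transition[OF d(1) e(1) d(2) e(2)])
  moreover have "transition d e (transition c d x) = transition c e x" if "x \<in> ?S" for x
    using that by (auto simp: transition_def chart_inv_map c(1) d(1))
  ultimately have "(transition c e has_derivative (\<lambda>v. D d e p (D c d p v))) (at (chart_map c p))"
    using has_derivative_transform_within_open[OF _ S x] by blast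
  from frechet_derivative_at[OF this] show ?thesis by (metis D_def)
qed

lemma D_self:
  assumes c: "c \<in> A" "p \<in> chart_dom c"
  shows "D c c p v = v"
proof -
  let ?S = "chart_map c ` (UNIV \<inter> chart_dom c)"
  have S: "open ?S" by (rule open_chart_image[OF c(1) open_UNIV])
  have "(transition c c has_derivative (\<lambda>v. v)) (at (chart_map c p))"
    by (rule has_derivative_transform_within_open[OF has_derivative_ident S])
       (use c in \<open>auto simp: transition_def chart_inv_map\<close>)
  from frechet_derivative_at[OF this] show ?thesis by (metis D_def)
qed

abbreviation "tv \<equiv> tangent_vector A"

abbreviation "TS \<equiv> tangent_space A"

lemma tv_apply: "d \<in> A \<Longrightarrow> p \<in> chart_dom d \<Longrightarrow> tv c p v d = D c d p v"
  by (simp add: tangent_vector_def D_def)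

lemma tv_in_TS:
  assumes c: "c \<in> A" "p \<in> chart_dom c"
  shows "tv c p v \<in> TS p"
proof -
  have eq: "tv c p v e = D d e p (tv c p v d)"
    if "d \<in> A" "e \<in> A" "p \<in> chart_dom d" "p \<in> chart_dom e" for d e
    using D_cocycle[OF c that(1,3,2,4)] that by (simp add: tv_apply)
  show ?thesis
    unfolding tangent_space_def mem_Collect_eq D_def[symmetric]
  proof (intro conjI allI ballI impI)
    show "tv c p v e = 0" if "e \<notin> A \<or> p \<notin> chart_dom e" for e using that by (auto simp: tangent_vector_def)
    show "tv c p v e = D d e p (tv c p v d)"
      if "d \<in> A" "e \<in> A" "p \<in> chart_dom d \<and> p \<in> chart_dom e" for d e
      using that by (intro eq) auto
  qed
qed

lemma TS_eq_tv:
  assumes c: "c \<in> A" "p \<in> chart_dom c" and w: "w \<in> TS p"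
  shows "tv c p (w c) = w"
proof
  fix d
  show "tv c p (w c) d = w d"
  proof (cases "d \<in> A \<and> p \<in> chart_dom d")
    case True
    moreover have "w d = D c d p (w c)" using w c True unfolding tangent_space_def D_def by blast
    ultimately show ?thesis by (simp add: tv_apply)
  next
    case False
    moreover have "w d = 0" using w False unfolding tangent_space_def by blast
    ultimately show ?thesis by (auto simp: tangent_vector_def)
  qed
qed

text \<open>A tangent vector is a family indexed by charts, so reading off its entry at c inverts
  \<open>tv c p\<close>.\<close>

lemma tv_frame:
  assumes c: "c \<in> A" "p \<in> chart_dom c"
  shows "frame (TS p) (tv c p) (\<lambda>w. w c)"
proof (rule frame.intro)
  show "linear (tv c p)"
  proof (rule linearI_combination)
    fix a and x y :: "real ^ 'n"
    show "tv c p (a *\<^sub>R x + y) = a *\<^sub>R tv c p x + tv c p y"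
    proof
      fix d
      show "tv c p (a *\<^sub>R x + y) d = (a *\<^sub>R tv c p x + tv c p y) d"
      proof (cases "d \<in> A \<and> p \<in> chart_dom d")
        case True
        then have "linear (D c d p)" using linear_D c by blast
        then show ?thesis using True by (simp add: tv_apply linear_add linear_scale scaleR_fun_def)
      next
        case False
        then show ?thesis by (auto simp: tangent_vector_def scaleR_fun_def)
      qed
    qed
  qed
  show "range (tv c p) = TS p"
  proof (intro equalityI subsetI)
    show "w \<in> TS p" if "w \<in> range (tv c p)" for w using that tv_in_TS[OF c] by auto
    show "w \<in> range (tv c p)" if "w \<in> TS p" for w
      using rangeI[of "tv c p" "w c"] TS_eq_tv[OF c that] by simp
  qed
  show "tv c p x c = x" for x using c by (simp add: tv_apply D_self)
qed

lemma tv_change: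
  assumes c: "c \<in> A" "p \<in> chart_dom c" and d: "d \<in> A" "p \<in> chart_dom d"
  shows "tv c p v = tv d p (D c d p v)"
  using TS_eq_tv[OF d tv_in_TS[OF c, of v]] d by (simp add: tv_apply)

lemma smooth_D:
  assumes "c \<in> A" "d \<in> A" "open U"
  shows "smooth_on (chart_map c ` (U \<inter> chart_dom d \<inter> chart_dom c)) (\<lambda>x. D c d (chart_inv c x) v)"
proof -
  let ?S = "chart_map c ` (U \<inter> chart_dom d \<inter> chart_dom c)"
  have S: "open ?S" by (rule open_chart_image[OF assms(1) open_Int[OF assms(3) open_chart_dom[OF assms(2)]]])
  have sm: "smooth_on ?S (\<lambda>x. frechet_derivative (transition c d) (at x) v)"
    by (rule smooth_on_subset[OF smooth_on_frechet_derivative[OF smooth_transition[OF assms(1,2)]]]) auto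
  have eq: "D c d (chart_inv c x) v = frechet_derivative (transition c d) (at x) v" if "x \<in> ?S" for x
    using that assms(1) by (auto simp: D_def chart_inv_map)
  show ?thesis by (rule iffD2[OF smooth_on_cong[OF S] sm]) (erule eq)
qed

definition frame_vol :: "('m, 'n) chart \<Rightarrow> 'm \<Rightarrow> (('m, 'n) chart \<Rightarrow> real ^ 'n) list \<Rightarrow> real" where
  "frame_vol c p = frame.vol (TS p) (\<lambda>w. w c)"

text \<open>Seen in a chart d, the coordinate volume form of c is a determinant of derivatives of
  the transition map. It supplies the test form against which the smoothness of an admissible
  \<open>\<rho>\<close> is read off.\<close>

lemma smooth_frame_vol:
  assumes c: "c \<in> A"
  shows "smooth_form_on A CARD('n) (chart_dom c) (frame_vol c)"
  unfolding smooth_form_on_def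
proof (intro conjI ballI allI impI)
  fix p assume "p \<in> chart_dom c"
  then show "frame_vol c p \<in> alt_forms CARD('n) (TS p)"
    unfolding frame_vol_def by (rule frame.vol_alt_forms[OF tv_frame[OF c]])
next
  fix d and es :: "(real ^ 'n) list" assume d: "d \<in> A" and es: "length es = CARD('n)"
  let ?S = "chart_map d ` (chart_dom c \<inter> chart_dom d)"
  have S: "open ?S" by (rule open_chart_image[OF d open_chart_dom[OF c]])
  have eq: "frame_vol c (chart_inv d x) (map (tv d (chart_inv d x)) es) =
      det (\<chi> i. D d c (chart_inv d x) (es ! pos i))" if x: "x \<in> ?S" for x
  proof -
    let ?q = "chart_inv d x"
    have q: "?q \<in> chart_dom c" "?q \<in> chart_dom d" using x by (auto simp: chart_inv_map[OF d])
    have "set (map (tv d ?q) es) \<subseteq> TS ?q" using tv_in_TS[OF d q(2)] by auto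
    then have "frame_vol c ?q (map (tv d ?q) es) = volume_form (map (\<lambda>v. D d c ?q v) es)"
      unfolding frame_vol_def frame.vol_def[OF tv_frame[OF c q(1)]] frame.extend_def[OF tv_frame[OF c q(1)]]
      by (simp add: o_def tv_apply c q)
    then show ?thesis using es by (simp add: volume_form_def)
  qed
  have sm: "smooth_on ?S (\<lambda>x. det (\<chi> i. D d c (chart_inv d x) (es ! pos i)))"
  proof (rule smooth_on_det[OF S])
    fix i j
    have "smooth_on ?S (\<lambda>x. D d c (chart_inv d x) (es ! pos i))"
      using smooth_D[OF d c open_UNIV, of "es ! pos i"] by simp
    then show "smooth_on ?S (\<lambda>x. (\<chi> i. D d c (chart_inv d x) (es ! pos i)) $ i $ j)"
      using smooth_on_vec_iff[OF S, of "\<lambda>x. D d c (chart_inv d x) (es ! pos i)"] by simp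
  qed
  show "smooth_on ?S (\<lambda>x. frame_vol c (chart_inv d x) (map (tv d (chart_inv d x)) es))"
    by (rule iffD2[OF smooth_on_cong[OF S] sm]) (erule eq)
qed

end

section \<open>Smooth stable forms\<close>

locale stable_form_field = atlas A for A :: "('m::topological_space, 'n::finite) chart set" +
  fixes \<phi> :: "'m \<Rightarrow> (('m, 'n) chart \<Rightarrow> real ^ 'n) list \<Rightarrow> real"
  assumes n: "CARD('n) = 7 \<or> CARD('n) = 8"
    and smooth: "smooth_form_on A 3 UNIV \<phi>"
    and stable: "stable_form (tangent_space A p) (\<phi> p)"
begin

lemma \<phi>_alt_forms: "\<phi> p \<in> alt_forms 3 (TS p)"
  using stable by (simp add: stable_form_def)

definition T :: "('m, 'n) chart \<Rightarrow> 'm \<Rightarrow> 'n tensor" where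
  "T c p = frame.tensor (tv c p) (\<phi> p)"

lemma T_def': "c \<in> A \<Longrightarrow> p \<in> chart_dom c \<Longrightarrow> T c p = tensor_of (\<lambda>xs. \<phi> p (map (tv c p) xs))"
  unfolding T_def by (rule frame.tensor_def[OF tv_frame])

lemma
  assumes c: "c \<in> A" "p \<in> chart_dom c"
  shows stable_T: "stable_tensor (T c p)"
    and alternating_T: "alternating (T c p)"
    and tform_T: "tform (T c p) = (\<lambda>xs. \<phi> p (map (tv c p) xs))"
    and nondegenerate_T: "nondegenerate (T c p)"
proof -
  show 1: "stable_tensor (T c p)"
    unfolding T_def by (rule frame.stable_tensor_of_stable_form[OF tv_frame[OF c] stable])
  show "alternating (T c p)" using 1 by (simp add: stable_tensor_def)
  show "tform (T c p) = (\<lambda>xs. \<phi> p (map (tv c p) xs))"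
    unfolding T_def by (rule frame.tform_tensor[OF tv_frame[OF c] \<phi>_alt_forms])
  show "nondegenerate (T c p)" by (rule stable_nondegenerate[OF n 1])
qed

lemma smooth_T:
  assumes c: "c \<in> A"
  shows "smooth_on (chart_map c ` chart_dom c) (\<lambda>x. T c (chart_inv c x))"
proof -
  let ?S = "chart_map c ` chart_dom c"
  have S: "open ?S" using open_chart_image[OF c open_UNIV] by simp
  show ?thesis
    unfolding smooth_on_vec_iff[OF S]
  proof
    fix t :: "'n \<times> 'n \<times> 'n"
    obtain i j k where t: "t = (i, j, k)" by (metis prod.exhaust)
    have *: "T c (chart_inv c x) $ t = \<phi> (chart_inv c x) (map (tv c (chart_inv c x)) [axis i 1, axis j 1, axis k 1])"
      if "x \<in> ?S" for x
      using that c by (auto simp: T_def' chart_inv_map t)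
    have "smooth_on (chart_map c ` (UNIV \<inter> chart_dom c))
        (\<lambda>x. \<phi> (chart_inv c x) (map (tv c (chart_inv c x)) [axis i 1, axis j 1, axis k 1]))"
      using smooth c unfolding smooth_form_on_def by (elim conjE) (drule bspec[OF _ c], drule spec, erule mp, simp)
    then have "smooth_on ?S (\<lambda>x. \<phi> (chart_inv c x) (map (tv c (chart_inv c x)) [axis i 1, axis j 1, axis k 1]))"
      by (simp only: Int_UNIV_left)
    then show "smooth_on ?S (\<lambda>x. T c (chart_inv c x) $ t)"
      by (rule iffD2[OF smooth_on_cong[OF S], rotated]) (erule *)
  qed
qed

lemma T_change:
  assumes c: "c \<in> A" "p \<in> chart_dom c" and d: "d \<in> A" "p \<in> chart_dom d"
  shows "T c p = pb (matrix (D c d p)) (T d p)"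
    and "det (matrix (D c d p)) \<noteq> 0"
proof -
  have lin: "linear (D c d p)" by (rule linear_D[OF c(1) d(1) c(2) d(2)])
  note mv = matrix_vector_mul(2)[OF lin]
  show "T c p = pb (matrix (D c d p)) (T d p)"
    by (rule tform_eqI)
       (simp add: tform_pb[OF alternating_T[OF d]] mv tform_T[OF c] tform_T[OF d] tv_change[OF c d])
  have "inj (D c d p)"
    by (rule inj_on_inverseI[where g = "D d c p"]) (simp add: D_cocycle[OF c d c] D_self[OF c])
  then show "det (matrix (D c d p)) \<noteq> 0" using lin by (simp add: det_nz_iff_inj)
qed

text \<open>The Gram matrix becomes its congruent by g times a scalar. The scalar contributes its
  n-th power to the determinant, and the two copies of g contribute the exponent 2.\<close>

lemma det_gram_pb:
  assumes S: "alternating S" and g: "det g \<noteq> 0"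
  shows "det (gram (pb g S)) = det g ^ (weight TYPE('n) * CARD('n) + 2) * det (gram (S :: 'n tensor))"
proof -
  let ?k = "weight TYPE('n)"
  have "gram (pb g S) $ i $ j = (det g ^ ?k *\<^sub>R (Finite_Cartesian_Product.transpose g ** gram S ** g)) $ i $ j" for i j
  proof -
    have "gram (pb g S) $ i $ j = det g ^ ?k * Bf S (g *v axis j 1) (g *v axis i 1)"
      by (simp add: gram_def Bf_pb[OF n S g])
    also have "Bf S (g *v axis j 1) (g *v axis i 1) = (gram S *v (g *v axis j 1)) \<bullet> (g *v axis i 1)"
      by (rule Bf_eq_inner)
    also have "\<dots> = (Finite_Cartesian_Product.transpose g *v (gram S *v (g *v axis j 1))) \<bullet> axis i 1"
      by (metis transpose_matrix_vector dot_lmul_matrix)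
    also have "\<dots> = ((Finite_Cartesian_Product.transpose g ** gram S ** g) *v axis j 1) $ i"
      by (simp add: matrix_vector_mul_assoc matrix_mul_assoc inner_axis)
    also have "\<dots> = (Finite_Cartesian_Product.transpose g ** gram S ** g) $ i $ j"
      by (simp add: matrix_vector_mult_basis column_def)
    finally show ?thesis by simp
  qed
  then have "gram (pb g S) = det g ^ ?k *\<^sub>R (Finite_Cartesian_Product.transpose g ** gram S ** g)"
    by (simp add: vec_eq_iff)
  then have "det (gram (pb g S)) = (det g ^ ?k) ^ CARD('n) * (det g * det (gram S) * det g)"
    by (simp only: det_scaleR det_mul det_transpose)
  also have "(det g ^ ?k) ^ CARD('n) = det g ^ (?k * CARD('n))" by (rule power_mult[symmetric])
  finally show ?thesis by (simp only: power_add power2_eq_square mult_ac)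
qed

subsection \<open>Existence of an admissible field\<close>

text \<open>The scaling factor is a root of the discriminant of the reduced form, whose weight is \<open>9\<close>
  for \<open>n = 7\<close> and \<open>18\<close> for \<open>n = 8\<close>.\<close>

definition disc_root :: "('m, 'n) chart \<Rightarrow> 'm \<Rightarrow> real" where
  "disc_root c p = inverse (root 9 (det (gram (T c p))))"

text \<open>For n = 8 only products of two values of \<open>\<rho>\<close> must be smooth, so a
  square root is taken, with the absolute value to make it real; a sign is left
  undetermined.\<close>

definition rho_scale :: "('m, 'n) chart \<Rightarrow> 'm \<Rightarrow> real" where
  "rho_scale c p = (if CARD('n) = 7 then disc_root c p else sqrt \<bar>disc_root c p\<bar>)"

definition std_basis :: "(real ^ 'n) list" where
  "std_basis = map eb [0..<CARD('n)]"

text \<open>The chart is chosen separately at each point, without any continuity. By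
  \<open>\<rho>0_eq\<close> the choice cancels, for n = 7 in the values and for n = 8 in products of
  two values.\<close>

definition \<rho>0 :: "'m \<Rightarrow> ((('m, 'n) chart \<Rightarrow> real ^ 'n) list \<Rightarrow> real) \<Rightarrow> real" where
  "\<rho>0 p = (let c = (SOME c. c \<in> A \<and> p \<in> chart_dom c) in (\<lambda>\<omega>. rho_scale c p * \<omega> (map (tv c p) std_basis)))"

lemma smooth_disc_root:
  assumes c: "c \<in> A"
  shows "smooth_on (chart_map c ` chart_dom c) (\<lambda>x. disc_root c (chart_inv c x))"
    and "p \<in> chart_dom c \<Longrightarrow> disc_root c p \<noteq> 0"
proof -
  let ?S = "chart_map c ` chart_dom c" and ?D = "\<lambda>x. det (gram (T c (chart_inv c x)))"
  have S: "open ?S" using open_chart_image[OF c open_UNIV] by simp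
  have nz: "det (gram (T c p)) \<noteq> 0" if "p \<in> chart_dom c" for p
    using nondegenerate_T[OF c that] nondegenerate_iff by blast
  then show "p \<in> chart_dom c \<Longrightarrow> disc_root c p \<noteq> 0" by (simp add: disc_root_def)
  have D: "smooth_on ?S ?D"
    by (rule smooth_on_real_polynomial_function[OF real_polynomial_function_det[OF real_polynomial_function_gram] S smooth_T[OF c]])
  have Dnz: "?D x \<noteq> 0" if "x \<in> ?S" for x using that nz chart_inv_map[OF c] by auto
  show "smooth_on ?S (\<lambda>x. disc_root c (chart_inv c x))"
    unfolding disc_root_def
  \<comment> \<open>The inverse ninth root is the power -1/9 of the determinant up to sign, so its
    logarithmic derivative is -1/9 times that of the determinant.\<close>
  proof (rule smooth_on_logarithmic_derivative[OF S D Dnz, where c = "- 1 / 9"])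
    fix x assume x: "x \<in> ?S"
    let ?r = "root 9 (?D x)"
    have r: "?r \<noteq> 0" "?r ^ 9 = ?D x" using Dnz[OF x] by (simp_all add: odd_real_root_pow)
    have "(root 9 has_real_derivative inverse (real 9 * ?r ^ (9 - Suc 0))) (at (?D x))"
      by (rule DERIV_odd_real_root) (use Dnz[OF x] in auto)
    then have "((\<lambda>z. inverse (root 9 z)) has_real_derivative - (inverse ?r * inverse (real 9 * ?r ^ (9 - Suc 0)) * inverse ?r)) (at (?D x))"
      using r(1) by (rule DERIV_inverse'[where f = "root 9"])
    then have "((\<lambda>z. inverse (root 9 z)) has_derivative (*) (- (inverse ?r * inverse (real 9 * ?r ^ (9 - Suc 0)) * inverse ?r))) (at (?D x))"
      by (simp only: has_field_derivative_def)
    from has_derivative_compose[OF smooth_on_has_derivative[OF D x] this]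
    show "((\<lambda>x. inverse (root 9 (?D x))) has_derivative
        (\<lambda>v. (- 1 / 9) *\<^sub>R (inverse ?r * (frechet_derivative ?D (at x) v * inverse (?D x))))) (at x)"
    proof (rule has_derivative_eq_rhs, intro ext)
      fix v
      have "inverse ?r * inverse (real 9 * ?r ^ (9 - Suc 0)) * inverse ?r = (1 / 9) * (inverse ?r * inverse (?r ^ 9))"
        using r(1) by (simp add: field_simps power_numeral_reduce)
      then have h: "inverse ?r * inverse (real 9 * ?r ^ (9 - Suc 0)) * inverse ?r = (1 / 9) * (inverse ?r * inverse (?D x))"
        unfolding r(2) .
      have *: "(- ((1 / 9) * (a * b))) * v = (- 1 / 9) *\<^sub>R (a * (v * b))" for a b v :: real
        by (simp add: algebra_simps)
      show "(- (inverse ?r * inverse (real 9 * ?r ^ (9 - Suc 0)) * inverse ?r)) * frechet_derivative ?D (at x) v =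
          (- 1 / 9) *\<^sub>R (inverse ?r * (frechet_derivative ?D (at x) v * inverse (?D x)))"
        unfolding h by (rule *)
    qed
  qed
qed

lemma smooth_abs_disc_root:
  assumes c: "c \<in> A"
  shows "smooth_on (chart_map c ` chart_dom c) (\<lambda>x. \<bar>disc_root c (chart_inv c x)\<bar>)"
proof -
  let ?S = "chart_map c ` chart_dom c" and ?y = "\<lambda>x. disc_root c (chart_inv c x)"
  have S: "open ?S" using open_chart_image[OF c open_UNIV] by simp
  have nz: "?y x \<noteq> 0" if "x \<in> ?S" for x using that smooth_disc_root(2)[OF c] chart_inv_map[OF c] by auto
  show ?thesis
  \<comment> \<open>Away from zero, a function and its absolute value have the same logarithmic
    derivative.\<close>
  proof (rule smooth_on_logarithmic_derivative[OF S smooth_disc_root(1)[OF c] nz, where c = 1])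
    fix x assume x: "x \<in> ?S"
    from has_derivative_compose[OF smooth_on_has_derivative[OF smooth_disc_root(1)[OF c] x] has_derivative_abs[OF nz[OF x]]]
    show "((\<lambda>x. \<bar>?y x\<bar>) has_derivative (\<lambda>v. 1 *\<^sub>R (\<bar>?y x\<bar> * (frechet_derivative ?y (at x) v * inverse (?y x))))) (at x)"
      by (rule has_derivative_eq_rhs) (use nz[OF x] in \<open>auto simp: fun_eq_iff sgn_if field_simps\<close>)
  qed
qed

lemma std_basis_change:
  assumes c: "c \<in> A" "p \<in> chart_dom c" and d: "d \<in> A" "p \<in> chart_dom d" and \<omega>: "\<omega> \<in> alt_forms CARD('n) (TS p)"
  shows "\<omega> (map (tv c p) std_basis) = det (matrix (D c d p)) * \<omega> (map (tv d p) std_basis)"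
proof -
  have mv: "(*v) (matrix (D c d p)) = D c d p"
    by (rule matrix_vector_mul(2)[OF linear_D[OF c(1) d(1) c(2) d(2)]])
  have "map (tv c p) std_basis = map (tv d p) (map ((*v) (matrix (D c d p))) std_basis)"
    unfolding mv by (simp add: tv_change[OF c d])
  then have "\<omega> (map (tv c p) std_basis) = (\<lambda>xs. \<omega> (map (tv d p) xs)) (map ((*v) (matrix (D c d p))) std_basis)" by (simp only:)
  also have "\<dots> = \<omega> (map (tv d p) std_basis) * volume_form (map ((*v) (matrix (D c d p))) std_basis)"
    using top_form_eq_volume_form[OF frame.coordinates_alt_forms[OF tv_frame[OF d] \<omega>], of "map ((*v) (matrix (D c d p))) std_basis"]
    by (simp only: std_basis_def)
  finally show ?thesis by (simp only: volume_form_map) (simp add: std_basis_def volume_form_basis)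
qed

text \<open>The exponent in \<open>det_gram_pb\<close> is 9 times the weight, for 1 * 7 + 2 = 9 and
  2 * 8 + 2 = 18, so the real ninth root changes by exactly the power of the Jacobian given by
  \<open>weight\<close>.\<close>

lemma disc_root_change:
  assumes c: "c \<in> A" "p \<in> chart_dom c" and d: "d \<in> A" "p \<in> chart_dom d"
  shows "disc_root c p * det (matrix (D c d p)) ^ weight TYPE('n) = disc_root d p"
proof -
  let ?\<delta> = "det (matrix (D c d p))" and ?k = "weight TYPE('n)"
  have "det (gram (T c p)) = (?\<delta> ^ ?k) ^ 9 * det (gram (T d p))"
  proof -
    have "?k * CARD('n) + 2 = ?k * 9" using n by (auto simp: weight_def)
    then show ?thesis
      unfolding T_change(1)[OF c d] det_gram_pb[OF alternating_T[OF d] T_change(2)[OF c d]] by (simp only: power_mult)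
  qed
  then have "root 9 (det (gram (T c p))) = ?\<delta> ^ ?k * root 9 (det (gram (T d p)))"
    by (simp add: real_root_mult odd_real_root_power_cancel)
  then show ?thesis using T_change(2)[OF c d] by (simp add: disc_root_def)
qed

text \<open>The value of an n-form on the coordinate frame changes by the Jacobian determinant, and
  \<open>disc_root\<close> changes by the inverse of its power. These cancel for n = 7; for n = 8
  the square of the Jacobian from two forms meets the absolute value.\<close>

lemma \<rho>0_eq:
  assumes d: "d \<in> A" "p \<in> chart_dom d"
  shows "CARD('n) = 7 \<Longrightarrow> \<omega> \<in> alt_forms CARD('n) (TS p) \<Longrightarrow> \<rho>0 p \<omega> = disc_root d p * \<omega> (map (tv d p) std_basis)"
    and "CARD('n) \<noteq> 7 \<Longrightarrow> \<omega> \<in> alt_forms CARD('n) (TS p) \<Longrightarrow> \<omega>' \<in> alt_forms CARD('n) (TS p) \<Longrightarrow>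
      \<rho>0 p \<omega> * \<rho>0 p \<omega>' = \<bar>disc_root d p\<bar> * (\<omega> (map (tv d p) std_basis) * \<omega>' (map (tv d p) std_basis))"
proof -
  define c where "c = (SOME c. c \<in> A \<and> p \<in> chart_dom c)"
  have "c \<in> A \<and> p \<in> chart_dom c" unfolding c_def by (rule someI[of _ d]) (simp add: d)
  then have c: "c \<in> A" "p \<in> chart_dom c" by auto
  have \<rho>: "\<rho>0 p \<omega> = rho_scale c p * \<omega> (map (tv c p) std_basis)" for \<omega> by (simp add: \<rho>0_def c_def Let_def)
  note yc = disc_root_change[OF c d]
  show "\<rho>0 p \<omega> = disc_root d p * \<omega> (map (tv d p) std_basis)" if "CARD('n) = 7" "\<omega> \<in> alt_forms CARD('n) (TS p)"
    using yc that(1) by (simp add: \<rho> rho_scale_def std_basis_change[OF c d that(2)] weight_def)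
  assume n7: "CARD('n) \<noteq> 7" and \<omega>: "\<omega> \<in> alt_forms CARD('n) (TS p)" "\<omega>' \<in> alt_forms CARD('n) (TS p)"
  let ?\<delta> = "det (matrix (D c d p))" and ?a = "\<omega> (map (tv d p) std_basis)" and ?b = "\<omega>' (map (tv d p) std_basis)"
  have "\<rho>0 p \<omega> * \<rho>0 p \<omega>' = (sqrt \<bar>disc_root c p\<bar> * sqrt \<bar>disc_root c p\<bar>) * (?\<delta> * ?\<delta>) * (?a * ?b)"
    unfolding \<rho> std_basis_change[OF c d \<omega>(1)] std_basis_change[OF c d \<omega>(2)] using n7 by (simp add: rho_scale_def)
  also have "sqrt \<bar>disc_root c p\<bar> * sqrt \<bar>disc_root c p\<bar> = \<bar>disc_root c p\<bar>" by simp
  also have "\<bar>disc_root c p\<bar> * (?\<delta> * ?\<delta>) = \<bar>disc_root d p\<bar>"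
    using yc n7 by (simp add: weight_def power2_eq_square flip: yc) (simp add: abs_mult)
  finally show "\<rho>0 p \<omega> * \<rho>0 p \<omega>' = \<bar>disc_root d p\<bar> * (?a * ?b)" .
qed

lemma admissible_\<rho>0: "admissible_multivector_field A \<rho>0"
proof -
  have 1: "\<rho>0 p \<in> multivectors CARD('n) (TS p)" for p
    by (simp add: multivectors_def linear_map_on_def \<rho>0_def Let_def plus_fun_def scaleR_fun_def distrib_left)
  have 2: "\<exists>\<omega>\<in>alt_forms CARD('n) (TS p). \<rho>0 p \<omega> \<noteq> 0" for p
  proof -
    obtain d where d: "d \<in> A" "p \<in> chart_dom d" using chart_around .
    note f = tv_frame[OF d]
    let ?v = "frame.vol (TS p) (\<lambda>w. w d)"
    have v: "?v \<in> alt_forms CARD('n) (TS p)" by (rule frame.vol_alt_forms[OF f])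
    have "?v (map (tv d p) std_basis) = 1"
      unfolding frame.vol_def[OF f] frame.extend_map[OF f] by (simp add: std_basis_def volume_form_basis)
    then have "\<rho>0 p ?v \<noteq> 0"
      using \<rho>0_eq(1)[OF d _ v] \<rho>0_eq(2)[OF d _ v v] smooth_disc_root(2)[OF d]
      by (cases "CARD('n) = 7") auto
    then show ?thesis using v by blast
  qed
  have form: "smooth_on (chart_map d ` (U \<inter> chart_dom d)) (\<lambda>x. \<omega> (chart_inv d x) (map (tv d (chart_inv d x)) std_basis))"
    if "smooth_form_on A CARD('n) U \<omega>" "d \<in> A" for U \<omega> d
  proof -
    have "length (std_basis :: (real ^ 'n) list) = CARD('n)" by (simp add: std_basis_def)
    then show ?thesis using that unfolding smooth_form_on_def by blast
  qed
  have alt: "\<omega> p \<in> alt_forms CARD('n) (TS p)" if "smooth_form_on A CARD('n) U \<omega>" "p \<in> U" for U \<omega> p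
    using that unfolding smooth_form_on_def by blast
  have 3: "smooth_function_on A U (\<lambda>p. \<rho>0 p (\<omega> p))"
    if "CARD('n) = 7" "open U" "smooth_form_on A CARD('n) U \<omega>" for U \<omega>
    unfolding smooth_function_on_def
  proof
    fix d assume d: "d \<in> A"
    let ?S = "chart_map d ` (U \<inter> chart_dom d)"
    have S: "open ?S" by (rule open_chart_image[OF d that(2)])
    have *: "\<rho>0 (chart_inv d x) (\<omega> (chart_inv d x)) =
        disc_root d (chart_inv d x) * \<omega> (chart_inv d x) (map (tv d (chart_inv d x)) std_basis)" if "x \<in> ?S" for x
      using that \<rho>0_eq(1)[OF d _ \<open>CARD('n) = 7\<close>] alt[OF \<open>smooth_form_on A CARD('n) U \<omega>\<close>]
      by (auto simp: chart_inv_map[OF d])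
    show "smooth_on ?S (\<lambda>x. \<rho>0 (chart_inv d x) (\<omega> (chart_inv d x)))"
      by (rule iffD2[OF smooth_on_cong[OF S]], erule *)
         (intro smooth_on_mult S form that d smooth_on_subset[OF smooth_disc_root(1)[OF d]], auto)
  qed
  have 4: "smooth_function_on A U (\<lambda>p. \<rho>0 p (\<omega> p) * \<rho>0 p (\<omega>' p))"
    if "CARD('n) \<noteq> 7" "open U" "smooth_form_on A CARD('n) U \<omega>" "smooth_form_on A CARD('n) U \<omega>'" for U \<omega> \<omega>'
    unfolding smooth_function_on_def
  proof
    fix d assume d: "d \<in> A"
    let ?S = "chart_map d ` (U \<inter> chart_dom d)"
    have S: "open ?S" by (rule open_chart_image[OF d that(2)])
    have *: "\<rho>0 (chart_inv d x) (\<omega> (chart_inv d x)) * \<rho>0 (chart_inv d x) (\<omega>' (chart_inv d x)) =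
        \<bar>disc_root d (chart_inv d x)\<bar> * (\<omega> (chart_inv d x) (map (tv d (chart_inv d x)) std_basis) *
          \<omega>' (chart_inv d x) (map (tv d (chart_inv d x)) std_basis))" if "x \<in> ?S" for x
      using that \<rho>0_eq(2)[OF d _ \<open>CARD('n) \<noteq> 7\<close>] alt[OF \<open>smooth_form_on A CARD('n) U \<omega>\<close>]
        alt[OF \<open>smooth_form_on A CARD('n) U \<omega>'\<close>]
      by (auto simp: chart_inv_map[OF d])
    show "smooth_on ?S (\<lambda>x. \<rho>0 (chart_inv d x) (\<omega> (chart_inv d x)) * \<rho>0 (chart_inv d x) (\<omega>' (chart_inv d x)))"
      by (rule iffD2[OF smooth_on_cong[OF S]], erule *)
         (intro smooth_on_mult S form that d smooth_on_subset[OF smooth_abs_disc_root[OF d]], auto)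
  qed
  show ?thesis
    unfolding admissible_multivector_field_def using 1 2 3 4 by auto
qed

end

section \<open>The bundle of algebras\<close>

locale admissible_field = stable_form_field A \<phi> for A :: "('m::topological_space, 'n::finite) chart set" and \<phi> +
  fixes \<rho> :: "'m \<Rightarrow> ((('m, 'n) chart \<Rightarrow> real ^ 'n) list \<Rightarrow> real) \<Rightarrow> real"
  assumes admissible: "admissible_multivector_field A \<rho>"
begin

lemma \<rho>: "\<rho> p \<in> multivectors CARD('n) (TS p)" "\<exists>\<omega>\<in>alt_forms CARD('n) (TS p). \<rho> p \<omega> \<noteq> 0"
  using admissible by (auto simp: admissible_multivector_field_def)

text \<open>The factor between the reduced form in the frame of c and
  \<open>Bf (T c p)\<close>.\<close>

definition r :: "('m, 'n) chart \<Rightarrow> 'm \<Rightarrow> real" where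
  "r c p = \<rho> p (frame_vol c p) ^ weight TYPE('n)"

lemma r_nonzero: "c \<in> A \<Longrightarrow> p \<in> chart_dom c \<Longrightarrow> r c p \<noteq> 0"
  unfolding r_def frame_vol_def using frame.multivector_vol_nonzero[OF tv_frame \<rho>] by simp

lemma smooth_r:
  assumes c: "c \<in> A"
  shows "smooth_function_on A (chart_dom c) (r c)"
proof (cases "CARD('n) = 7")
  case True
  then have "smooth_function_on A (chart_dom c) (\<lambda>p. \<rho> p (frame_vol c p))"
    using admissible open_chart_dom[OF c] smooth_frame_vol[OF c] unfolding admissible_multivector_field_def by simp
  then show ?thesis using True by (simp add: r_def[abs_def] weight_def)
next
  case False
  then have "smooth_function_on A (chart_dom c) (\<lambda>p. \<rho> p (frame_vol c p) * \<rho> p (frame_vol c p))"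
    using admissible open_chart_dom[OF c] smooth_frame_vol[OF c] unfolding admissible_multivector_field_def by simp
  then show ?thesis using False by (simp add: r_def[abs_def] weight_def power2_eq_square)
qed

definition mult :: "'m \<Rightarrow> (('m, 'n) chart \<Rightarrow> real ^ 'n) \<Rightarrow> (('m, 'n) chart \<Rightarrow> real ^ 'n) \<Rightarrow> ('m, 'n) chart \<Rightarrow> real ^ 'n" where
  "mult p x y = (THE u. u \<in> TS p \<and> (\<forall>z\<in>TS p. reduced_form CARD('n) (TS p) (\<phi> p) (\<rho> p) u z = \<phi> p [x, y, z]))"

lemma product_iff:
  assumes c: "c \<in> A" "p \<in> chart_dom c" and m: "product_of (T c p) m" and xy: "x \<in> TS p" "y \<in> TS p"
  shows "u \<in> TS p \<and> (\<forall>z\<in>TS p. reduced_form CARD('n) (TS p) (\<phi> p) (\<rho> p) u z = \<phi> p [x, y, z]) \<longleftrightarrow>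
    u = tv c p (inverse (r c p) *\<^sub>R m (x c) (y c))"
  using frame.product_in_frame[OF tv_frame[OF c] n \<phi>_alt_forms \<rho>(1) frame.multivector_vol_nonzero[OF tv_frame[OF c] \<rho>]
      nondegenerate_T[OF c, unfolded T_def] m[unfolded T_def] xy, of u]
  by (simp add: r_def frame_vol_def)

lemma ex1_product:
  assumes "x \<in> TS p" "y \<in> TS p"
  shows "\<exists>!u. u \<in> TS p \<and> (\<forall>z\<in>TS p. reduced_form CARD('n) (TS p) (\<phi> p) (\<rho> p) u z = \<phi> p [x, y, z])"
proof -
  obtain c where c: "c \<in> A" "p \<in> chart_dom c" using chart_around .
  obtain m where m: "product_of (T c p) m" using product_of_exists[OF nondegenerate_T[OF c]] .
  show ?thesis using product_iff[OF c m assms] by auto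
qed

lemma mult_eq:
  assumes c: "c \<in> A" "p \<in> chart_dom c" and m: "product_of (T c p) m" and xy: "x \<in> TS p" "y \<in> TS p"
  shows "mult p x y = tv c p (inverse (r c p) *\<^sub>R m (x c) (y c))"
  unfolding mult_def product_iff[OF c m xy] by simp

lemma reduced_form_mult:
  assumes "x \<in> TS p" "y \<in> TS p" "z \<in> TS p"
  shows "reduced_form CARD('n) (TS p) (\<phi> p) (\<rho> p) (mult p x y) z = \<phi> p [x, y, z]"
  using theI'[OF ex1_product[OF assms(1,2)]] assms(3) unfolding mult_def by blast

text \<open>The fixed algebra is the product \<mu> of the tensor at p itself, in one chart c. A
  local section of the orbit map through this tensor provides matrices g q that pull it back to the
  tensor at q, and they intertwine the fibre products with \<mu> up to scalar factors.\<close>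

lemma local_trivialization:
  obtains U \<Psi> \<mu> where "open U" "p \<in> U" "simple_malcev_algebra (UNIV :: (real ^ 'n) set) \<mu>"
    "tangent_trivialization A U \<Psi>"
    "\<And>q x y. q \<in> U \<Longrightarrow> x \<in> TS q \<Longrightarrow> y \<in> TS q \<Longrightarrow> mult q x y \<in> TS q \<and> \<Psi> q (mult q x y) = \<mu> (\<Psi> q x) (\<Psi> q y)"
proof -
  obtain c where c: "c \<in> A" "p \<in> chart_dom c" using chart_around .
  let ?k = "weight TYPE('n)" and ?T = "T c p" and ?X = "chart_map c ` chart_dom c"
  have X: "open ?X" using open_chart_image[OF c(1) open_UNIV] by simp
  define a where "a x = T c (chart_inv c x)" for x
  have sma: "smooth_on ?X a" unfolding a_def by (rule smooth_T[OF c(1)])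
  obtain \<mu> where \<mu>: "product_of ?T \<mu>" using product_of_exists[OF nondegenerate_T[OF c]] .
  note \<mu>lin = product_of_linear[OF nondegenerate_T[OF c] \<mu>]
  obtain V G where V: "open V" "?T \<in> V" and smG: "\<And>i j. smooth_on V (\<lambda>S. G S $ i $ j)"
    and G: "\<And>S. S \<in> V \<Longrightarrow> det (G S) \<noteq> 0" "\<And>S. S \<in> V \<Longrightarrow> alternating S \<Longrightarrow> pb (G S) ?T = S"
    using orbit_local_section[OF alternating_T[OF c] stable_submersive[OF n stable_T[OF c]]] by metis
  define X' where "X' = ?X \<inter> a -` V"
  have X': "open X'" unfolding X'_def
    by (rule continuous_open_preimage[OF smooth_on_imp_continuous_on[OF sma] X V(1)])
  define U where "U = chart_dom c \<inter> chart_map c -` X'"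
  have "continuous_on (chart_dom c) (chart_map c)" using chart[OF c(1)] by (simp add: is_chart_def homeomorphism_def)
  then have U: "open U" unfolding U_def by (rule continuous_open_preimage[OF _ open_chart_dom[OF c(1)] X'])
  have UV: "q \<in> chart_dom c" "T c q \<in> V" if "q \<in> U" for q
  proof -
    show 1: "q \<in> chart_dom c" using that by (simp add: U_def)
    have "a (chart_map c q) \<in> V" using that by (simp add: U_def X'_def)
    then show "T c q \<in> V" by (simp add: a_def chart_inv_map[OF c(1) 1])
  qed
  have pU: "p \<in> U" using c V(2) by (simp add: U_def X'_def a_def chart_inv_map[OF c])
  define g where "g q = G (T c q)" for q
  \<comment> \<open>\<open>g q\<close> carries \<open>mult q\<close> to \<open>l q\<close> times
    \<mu>. Multiplying the map by \<open>l q\<close> turns this into (l q)^2 \<mu>(g x, g y), which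
    is \<mu> of the rescaled arguments, so the scaled map is an exact isomorphism.\<close>
  define l where "l q = inverse (r c q * det (g q) ^ ?k)" for q
  define \<Psi> where "\<Psi> q v = l q *\<^sub>R (g q *v v c)" for q and v :: "('m, 'n) chart \<Rightarrow> real ^ 'n"
  have g: "det (g q) \<noteq> 0" "pb (g q) ?T = T c q" if "q \<in> U" for q
    using UV[OF that] G alternating_T[OF c(1)] by (auto simp: g_def)
  have l: "l q \<noteq> 0" if "q \<in> U" for q
    using g(1)[OF that] r_nonzero[OF c(1) UV(1)[OF that]] by (simp add: l_def)
  have eq: "mult q x y \<in> TS q \<and> \<Psi> q (mult q x y) = \<mu> (\<Psi> q x) (\<Psi> q y)"
    if q: "q \<in> U" and xy: "x \<in> TS q" "y \<in> TS q" for q x y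
  proof -
    note cq = c(1) UV(1)[OF q]
    obtain m where m: "product_of (T c q) m" using product_of_exists[OF nondegenerate_T[OF cq]] .
    have me: "mult q x y = tv c q (inverse (r c q) *\<^sub>R m (x c) (y c))" by (rule mult_eq[OF cq m xy])
    have "g q *v m (x c) (y c) = inverse (det (g q) ^ ?k) *\<^sub>R \<mu> (g q *v x c) (g q *v y c)"
      by (rule product_of_pb[OF n alternating_T[OF c] g(1)[OF q] nondegenerate_T[OF c] \<mu>]) (simp add: g(2)[OF q] m)
    moreover have "mult q x y c = inverse (r c q) *\<^sub>R m (x c) (y c)"
      unfolding me using cq by (simp add: tv_apply D_self)
    ultimately have "\<Psi> q (mult q x y) = (l q * l q) *\<^sub>R \<mu> (g q *v x c) (g q *v y c)"
      by (simp add: \<Psi>_def matrix_vector_mult_scaleR l_def)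
    also have "\<dots> = \<mu> (\<Psi> q x) (\<Psi> q y)"
      by (simp add: \<Psi>_def linear_scale[OF \<mu>lin(1)] linear_scale[OF \<mu>lin(2)])
    finally show ?thesis using me tv_in_TS[OF cq] by simp
  qed
  have "tangent_trivialization A U \<Psi>"
    unfolding tangent_trivialization_def
  proof (intro conjI ballI allI)
    fix q assume q: "q \<in> U"
    note cq = c(1) UV(1)[OF q]
    show "linear_map_on (TS q) (\<Psi> q)"
      by (simp add: linear_map_on_def \<Psi>_def plus_fun_def scaleR_fun_def matrix_vector_right_distrib
          matrix_vector_mult_scaleR scaleR_add_right mult.commute)
    from g(1)[OF q] obtain h where h: "g q ** h = mat 1" "h ** g q = mat 1" by (metis invertible_det_nz invertible_def)
    show "bij_betw (\<Psi> q) (TS q) UNIV"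
    proof (rule bij_betw_byWitness[where f' = "\<lambda>e. tv c q (inverse (l q) *\<^sub>R (h *v e))"])
      show "\<forall>v\<in>TS q. tv c q (inverse (l q) *\<^sub>R (h *v \<Psi> q v)) = v"
        using l[OF q] by (simp add: \<Psi>_def matrix_vector_mult_scaleR matrix_vector_mul_assoc h TS_eq_tv[OF cq])
      show "\<forall>e\<in>UNIV. \<Psi> q (tv c q (inverse (l q) *\<^sub>R (h *v e))) = e"
        using l[OF q] cq by (simp add: \<Psi>_def tv_apply D_self matrix_vector_mult_scaleR matrix_vector_mul_assoc h)
    qed (use tv_in_TS[OF cq] in auto)
  next
    fix d and e :: "real ^ 'n" assume d: "d \<in> A"
    let ?S = "chart_map d ` (U \<inter> chart_dom d)"
    have S: "open ?S" by (rule open_chart_image[OF d U])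
    have q: "chart_inv d x \<in> U" "chart_inv d x \<in> chart_dom d" if "x \<in> ?S" for x
      using that by (auto simp: chart_inv_map[OF d])
    have tr: "smooth_on ?S (transition d c)"
      by (rule smooth_on_subset[OF smooth_transition[OF d c(1)]]) (use UV(1) in auto)
    have tr_X': "transition d c ` ?S \<subseteq> X'"
      by (auto simp: transition_def chart_inv_map[OF d] U_def)
    have smg: "smooth_on ?S (\<lambda>x. g (chart_inv d x) $ i $ j)" for i j
    proof -
      have "smooth_on X' (\<lambda>x. G (a x) $ i $ j)"
        by (rule smooth_on_compose[OF X' V(1) smG smooth_on_subset[OF sma]]) (auto simp: X'_def)
      then have sm: "smooth_on ?S (\<lambda>x. G (a (transition d c x)) $ i $ j)"
        by (rule smooth_on_compose[OF S X' _ tr tr_X'])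
      have eq: "g (chart_inv d x) $ i $ j = G (a (transition d c x)) $ i $ j" if "x \<in> ?S" for x
        using q[OF that] UV(1) by (simp add: g_def a_def transition_def chart_inv_map[OF c(1)])
      show ?thesis by (rule iffD2[OF smooth_on_cong[OF S] sm]) (erule eq)
    qed
    have smr: "smooth_on ?S (\<lambda>x. r c (chart_inv d x))"
    proof -
      have "smooth_on (chart_map d ` (chart_dom c \<inter> chart_dom d)) (\<lambda>x. r c (chart_inv d x))"
        using smooth_r[OF c(1)] d unfolding smooth_function_on_def by blast
      then show ?thesis by (rule smooth_on_subset) (use UV(1) in auto)
    qed
    have smpow: "smooth_on ?S (\<lambda>x. f x ^ k)" if "smooth_on ?S f" for f :: "real ^ 'n \<Rightarrow> real" and k
    proof (induction k)
      case 0
      show ?case using smooth_on_const[OF S, of "1 :: real"] by simp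
    next
      case (Suc k)
      show ?case using smooth_on_mult[OF S that Suc] by simp
    qed
    have "smooth_on ?S (\<lambda>x. r c (chart_inv d x) * det (g (chart_inv d x)) ^ ?k)"
      by (rule smooth_on_mult[OF S smr smpow[OF smooth_on_det[OF S smg]]])
    then have sml: "smooth_on ?S (\<lambda>x. l (chart_inv d x))"
      unfolding l_def
    proof (rule smooth_on_inverse[OF S, rotated])
      show "r c (chart_inv d x) * det (g (chart_inv d x)) ^ ?k \<noteq> 0" if "x \<in> ?S" for x
        by (simp add: g(1)[OF q(1)[OF that]] r_nonzero[OF c(1) UV(1)[OF q(1)[OF that]]])
    qed
    have smD: "smooth_on ?S (\<lambda>x. D d c (chart_inv d x) e $ j)" for j
    proof -
      have "smooth_on ?S (\<lambda>x. D d c (chart_inv d x) e)"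
        by (rule smooth_on_subset[OF smooth_D[OF d c(1) open_UNIV]]) (use UV(1) in auto)
      then show ?thesis unfolding smooth_on_vec_iff[OF S] by (rule spec)
    qed
    have "smooth_on ?S (\<lambda>x. g (chart_inv d x) *v D d c (chart_inv d x) e)"
      unfolding smooth_on_vec_iff[OF S]
    proof
      fix i
      have "smooth_on ?S (\<lambda>x. \<Sum>j\<in>UNIV. g (chart_inv d x) $ i $ j * D d c (chart_inv d x) e $ j)"
        by (intro smooth_on_sum smooth_on_mult S smg smD finite)
      then show "smooth_on ?S (\<lambda>x. (g (chart_inv d x) *v D d c (chart_inv d x) e) $ i)"
        by (simp add: matrix_vector_mult_def)
    qed
    then have sm: "smooth_on ?S (\<lambda>x. l (chart_inv d x) *\<^sub>R (g (chart_inv d x) *v D d c (chart_inv d x) e))"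
      by (rule smooth_on_scaleR[OF S sml])
    have eq: "\<Psi> (chart_inv d x) (tv d (chart_inv d x) e) =
        l (chart_inv d x) *\<^sub>R (g (chart_inv d x) *v D d c (chart_inv d x) e)" if "x \<in> ?S" for x
      using q(1)[OF that] UV(1) c(1) by (simp add: \<Psi>_def tv_apply)
    show "smooth_on ?S (\<lambda>x. \<Psi> (chart_inv d x) (tv d (chart_inv d x) e))"
      by (rule iffD2[OF smooth_on_cong[OF S] sm]) (erule eq)
  qed
  then show thesis using that[OF U pU stable_simple[OF n stable_T[OF c] \<mu>]] eq by blast
qed

text \<open>Simplicity of the fibre at p is pulled back from \<mu> through the trivialization around
  p.\<close>

lemma simple_malcev_bundle_mult: "simple_malcev_bundle A mult"
  unfolding simple_malcev_bundle_def
proof (intro conjI allI)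
  fix p
  obtain U \<Psi> \<mu> where U: "open U" "p \<in> U" "simple_malcev_algebra (UNIV :: (real ^ 'n) set) \<mu>"
    "tangent_trivialization A U \<Psi>"
    and eq: "\<And>q x y. q \<in> U \<Longrightarrow> x \<in> TS q \<Longrightarrow> y \<in> TS q \<Longrightarrow> mult q x y \<in> TS q \<and> \<Psi> q (mult q x y) = \<mu> (\<Psi> q x) (\<Psi> q y)"
    by (rule local_trivialization[of p]) blast
  show "\<exists>U \<Psi> \<mu>. open U \<and> p \<in> U \<and> simple_malcev_algebra (UNIV :: (real ^ 'n) set) \<mu> \<and>
      tangent_trivialization A U \<Psi> \<and>
      (\<forall>q\<in>U. \<forall>x\<in>TS q. \<forall>y\<in>TS q. \<Psi> q (mult q x y) = \<mu> (\<Psi> q x) (\<Psi> q y))"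
    using U eq by blast
  obtain c where c: "c \<in> A" "p \<in> chart_dom c" using chart_around .
  show "simple_malcev_algebra (TS p) (mult p)"
    by (rule simple_malcev_algebra_iso[OF frame.subspace[OF tv_frame[OF c]] _ _ _ _ U(3)])
       (use U(2,4) eq in \<open>auto simp: tangent_trivialization_def\<close>)
qed

end

theorem mainTheorem3:
  fixes A :: "('m::{t2_space, second_countable_topology}, 'n::finite) chart set"
    and \<phi> :: "'m \<Rightarrow> (('m, 'n) chart \<Rightarrow> real ^ 'n) list \<Rightarrow> real"
  assumes "CARD('n) = 7 \<or> CARD('n) = 8"
    and "smooth_atlas A"
    and "smooth_form_on A 3 UNIV \<phi>"
    and "\<And>p. stable_form (tangent_space A p) (\<phi> p)"
  shows "(\<exists>\<rho>. admissible_multivector_field A \<rho>) \<and>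
    (\<forall>\<rho>. admissible_multivector_field A \<rho> \<longrightarrow>
      (\<forall>p. \<forall>x\<in>tangent_space A p. \<forall>y\<in>tangent_space A p.
         \<exists>!u. u \<in> tangent_space A p \<and>
           (\<forall>z\<in>tangent_space A p.
              reduced_form CARD('n) (tangent_space A p) (\<phi> p) (\<rho> p) u z = \<phi> p [x, y, z])) \<and>
      (\<exists>m. simple_malcev_bundle A m \<and>
         (\<forall>p. \<forall>x\<in>tangent_space A p. \<forall>y\<in>tangent_space A p. \<forall>z\<in>tangent_space A p.
            reduced_form CARD('n) (tangent_space A p) (\<phi> p) (\<rho> p) (m p x y) z = \<phi> p [x, y, z])))"
proof -
  interpret stable_form_field A \<phi>
    using assms by unfold_locales
  have "admissible_field A \<phi> \<rho>" if "admissible_multivector_field A \<rho>" for \<rho>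
    using that by unfold_locales
  note af = this
  show ?thesis
  proof (intro conjI exI[of _ \<rho>0] allI impI)
    show "admissible_multivector_field A \<rho>0" by (rule admissible_\<rho>0)
  next
    fix \<rho> p assume "admissible_multivector_field A \<rho>"
    then interpret admissible_field A \<phi> \<rho> by (rule af)
    show "\<forall>x\<in>TS p. \<forall>y\<in>TS p. \<exists>!u. u \<in> TS p \<and>
        (\<forall>z\<in>TS p. reduced_form CARD('n) (TS p) (\<phi> p) (\<rho> p) u z = \<phi> p [x, y, z])"
      using ex1_product by blast
  next
    fix \<rho> assume "admissible_multivector_field A \<rho>"
    then interpret admissible_field A \<phi> \<rho> by (rule af)
    show "\<exists>m. simple_malcev_bundle A m \<and> (\<forall>p. \<forall>x\<in>TS p. \<forall>y\<in>TS p. \<forall>z\<in>TS p.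
        reduced_form CARD('n) (TS p) (\<phi> p) (\<rho> p) (m p x y) z = \<phi> p [x, y, z])"
      using simple_malcev_bundle_mult reduced_form_mult by blast
  qed
qed

end
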